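(* Let $R$ be a separable rational map with coefficients in $K$, of degree at least two. Then every probability measure $\nu$ on $\mathsf{P}^1_K$, invariant and ergodic for $R$, that is not supported on an attracting cycle satisfies $$\chi_\nu(R)\ge\log\min\{|\ell|:\ell\in\{1,\dots,\deg(R)\}\}.$$
   Context: $(K,|\cdot|)$ is an algebraically closed, complete, non-Archimedean, non-trivially valued field. $\mathsf{P}^1_K$ is the Berkovich projective line over $K$, $\mathbb{P}^1_K\subset\mathsf{P}^1_K$ the set of classical (type I) points. $R$ is separable if $R'$ is not identically zero. Spherical derivative: $\|R'\|(x)=|R'(x)|\max\{1,|x|\}^2/\max\{1,|R(x)|\}^2$, extended continuously to $\mathsf{P}^1_K$, where $|x|$ and $|R'(x)|$ are the values of the semi-norm $x$ on the coordinate $T$ and on $R'$. $\chi_\nu(R)=\int\log\|R'\|\,d\nu\in\mathbb{R}\cup\{-\infty\}$. For an integer $\ell$, $|\ell|$ denotes its norm in $K$ (with $\log0=-\infty$). An attracting cycle is a periodic orbit in $\mathbb{P}^1_K$ whose multiplier has norm $<1$. *)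

theory Defs
  imports "HOL-Probability.Probability" "HOL-Computational_Algebra.Computational_Algebra"
begin

locale complete_nonarch_field =
  fixes v :: "'a::alg_closed_field \<Rightarrow> real"
  assumes nonneg: "v x \<ge> 0"
    and eq_0_iff: "v x = 0 \<longleftrightarrow> x = 0"
    and mult: "v (x * y) = v x * v y"
    and ultrametric: "v (x + y) \<le> max (v x) (v y)"
    and nontrivial: "\<exists>x. x \<noteq> 0 \<and> v x \<noteq> 1"
    and complete: "Metric_space.mcomplete UNIV (\<lambda>x y. v (x - y))"


subsection \<open>The Berkovich projective line\<close>

text \<open>
  \<open>None\<close> is the point at infinity, in \<open>'a option\<close> (the classical projective line) as well as
  in \<open>'a berk\<close>. Only the elements of \<open>topspace (berk_P1 v)\<close> are points of the Berkovich line.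
\<close>

type_synonym 'a berk = "('a poly \<Rightarrow> real) option"

definition mult_seminorms :: "('a::field \<Rightarrow> real) \<Rightarrow> ('a poly \<Rightarrow> real) set" where
  "mult_seminorms v = {s.
     (\<forall>F. s F \<ge> 0) \<and>
     (\<forall>F G. s (F + G) \<le> s F + s G) \<and>
     (\<forall>F G. s (F * G) = s F * s G) \<and>
     (\<forall>c. s [:c:] = v c)}"

text \<open>The affine line has the coarsest topology making every \<open>s \<mapsto> s F\<close> continuous.\<close>

definition berk_A1 :: "('a::field \<Rightarrow> real) \<Rightarrow> ('a poly \<Rightarrow> real) topology" where
  "berk_A1 v = subtopology (product_topology (\<lambda>_. euclideanreal) UNIV) (mult_seminorms v)"

definition berk_P1 :: "('a::field \<Rightarrow> real) \<Rightarrow> 'a berk topology" where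
  "berk_P1 v = Alexandroff_compactification (berk_A1 v)"

definition berk_borel :: "('a::field \<Rightarrow> real) \<Rightarrow> 'a berk measure" where
  "berk_borel v = sigma (topspace (berk_P1 v)) {U. openin (berk_P1 v) U}"

definition classical :: "('a::field \<Rightarrow> real) \<Rightarrow> 'a option \<Rightarrow> 'a berk" where
  "classical v z = map_option (\<lambda>a F. v (poly F a)) z"


subsection \<open>Rational maps\<close>

text \<open>A rational map \<open>P / Q\<close> is given by its numerator and denominator, in lowest terms.\<close>

type_synonym 'a ratfun = "'a poly \<times> 'a poly"

abbreviation rnum :: "'a::field ratfun \<Rightarrow> 'a poly" where "rnum \<equiv> fst"
abbreviation rden :: "'a::field ratfun \<Rightarrow> 'a poly" where "rden \<equiv> snd"

definition rational_map :: "'a::field ratfun \<Rightarrow> bool" where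
  "rational_map R \<longleftrightarrow> coprime (rnum R) (rden R) \<and> rden R \<noteq> 0"

definition rat_degree :: "'a::field ratfun \<Rightarrow> nat" where
  "rat_degree R = max (degree (rnum R)) (degree (rden R))"

text \<open>\<open>rat_deriv_num R / (rden R)\<^sup>2\<close> is the derivative \<open>R'\<close>.\<close>

definition rat_deriv_num :: "'a::field ratfun \<Rightarrow> 'a poly" where
  "rat_deriv_num R = pderiv (rnum R) * rden R - rnum R * pderiv (rden R)"

definition separable :: "'a::field ratfun \<Rightarrow> bool" where
  "separable R \<longleftrightarrow> rat_deriv_num R \<noteq> 0"

definition rat_eval :: "'a::field ratfun \<Rightarrow> 'a option \<Rightarrow> 'a option" where
  "rat_eval R z = (case z of
     None \<Rightarrow> if degree (rden R) < degree (rnum R) then None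
             else Some (coeff (rnum R) (degree (rden R)) / lead_coeff (rden R))
   | Some a \<Rightarrow> if poly (rden R) a = 0 then None
               else Some (poly (rnum R) a / poly (rden R) a))"

text \<open>For \<open>degree F \<le> n\<close>, \<open>homog_subst n F R\<close> is \<open>(rden R)\<^sup>n \<cdot> F(R)\<close>, a polynomial.\<close>

definition homog_subst :: "nat \<Rightarrow> 'a::field poly \<Rightarrow> 'a ratfun \<Rightarrow> 'a poly" where
  "homog_subst n F R = (\<Sum>i\<le>n. smult (coeff F i) (rnum R ^ i * rden R ^ (n - i)))"

definition rat_comp :: "'a::field ratfun \<Rightarrow> 'a ratfun \<Rightarrow> 'a ratfun" where
  "rat_comp R S = (homog_subst (rat_degree R) (rnum R) S, homog_subst (rat_degree R) (rden R) S)"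

definition rat_iter :: "'a::field ratfun \<Rightarrow> nat \<Rightarrow> 'a ratfun" where
  "rat_iter R n = (rat_comp R ^^ n) ([:0, 1:], 1)"

text \<open>
  The action on the Berkovich line is \<open>|F|\<^bsub>R(s)\<^esub> = |F \<circ> R|\<^bsub>s\<^esub>\<close>; the points \<open>s\<close> with
  \<open>s (rden R) = 0\<close> are the (classical) poles of \<open>R\<close>.
\<close>

definition berk_map :: "('a::field \<Rightarrow> real) \<Rightarrow> 'a ratfun \<Rightarrow> 'a berk \<Rightarrow> 'a berk" where
  "berk_map v R x = (case x of
     None \<Rightarrow> classical v (rat_eval R None)
   | Some s \<Rightarrow> if s (rden R) = 0 then None
               else Some (\<lambda>F. s (homog_subst (degree F) F R) / s (rden R) ^ degree F))"


subsection \<open>Attracting cycles\<close>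

definition rat_deriv_at :: "'a::field ratfun \<Rightarrow> 'a \<Rightarrow> 'a" where
  "rat_deriv_at R a = poly (rat_deriv_num R) a / (poly (rden R) a)\<^sup>2"

text \<open>At infinity the derivative is taken in the coordinate \<open>1 / T\<close>.\<close>

definition fixed_point_multiplier :: "'a::field ratfun \<Rightarrow> 'a option \<Rightarrow> 'a" where
  "fixed_point_multiplier R z = (case z of
     Some a \<Rightarrow> rat_deriv_at R a
   | None \<Rightarrow> (let \<iota> = (1, [:0, 1:]) in rat_deriv_at (rat_comp \<iota> (rat_comp R \<iota>)) 0))"

definition attracting_cycle :: "('a::field \<Rightarrow> real) \<Rightarrow> 'a ratfun \<Rightarrow> 'a option set \<Rightarrow> bool" where
  "attracting_cycle v R C \<longleftrightarrow> (\<exists>z n. n > 0 \<and>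
     (rat_eval R ^^ n) z = z \<and>
     (\<forall>k. 0 < k \<and> k < n \<longrightarrow> (rat_eval R ^^ k) z \<noteq> z) \<and>
     C = (\<lambda>k. (rat_eval R ^^ k) z) ` {..<n} \<and>
     v (fixed_point_multiplier (rat_iter R n) z) < 1)"


subsection \<open>Invariant measures and the Lyapunov exponent\<close>

definition invariant_measure :: "'b measure \<Rightarrow> ('b \<Rightarrow> 'b) \<Rightarrow> bool" where
  "invariant_measure \<nu> f \<longleftrightarrow> f \<in> measurable \<nu> \<nu> \<and> distr \<nu> \<nu> f = \<nu>"

definition ergodic_measure :: "'b measure \<Rightarrow> ('b \<Rightarrow> 'b) \<Rightarrow> bool" where
  "ergodic_measure \<nu> f \<longleftrightarrow>
     (\<forall>A\<in>sets \<nu>. f -` A \<inter> space \<nu> = A \<longrightarrow> measure \<nu> A = 0 \<or> measure \<nu> A = 1)"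

definition supported_on_attracting_cycle ::
    "('a::field \<Rightarrow> real) \<Rightarrow> 'a ratfun \<Rightarrow> 'a berk measure \<Rightarrow> bool" where
  "supported_on_attracting_cycle v R \<nu> \<longleftrightarrow>
     (\<exists>C. attracting_cycle v R C \<and> emeasure \<nu> (space \<nu> - classical v ` C) = 0)"

text \<open>
  \<open>|R'(x)| max {1, |x|}\<^sup>2 / max {1, |R(x)|}\<^sup>2\<close> makes sense on \<open>sph_deriv_domain\<close>, that is, away
  from infinity and the poles of \<open>R\<close>; on this finite set of classical points \<open>sph_deriv\<close> is the
  limit.
\<close>

definition sph_deriv_domain :: "('a::field \<Rightarrow> real) \<Rightarrow> 'a ratfun \<Rightarrow> 'a berk set" where
  "sph_deriv_domain v R = {Some s | s. s \<in> mult_seminorms v \<and> s (rden R) \<noteq> 0}"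

definition sph_deriv_formula :: "'a::field ratfun \<Rightarrow> 'a berk \<Rightarrow> real" where
  "sph_deriv_formula R x = (let s = the x in
     (s (rat_deriv_num R) / (s (rden R))\<^sup>2) *
     (max 1 (s [:0, 1:]))\<^sup>2 / (max 1 (s (rnum R) / s (rden R)))\<^sup>2)"

definition sph_deriv :: "('a::field \<Rightarrow> real) \<Rightarrow> 'a ratfun \<Rightarrow> 'a berk \<Rightarrow> real" where
  "sph_deriv v R x =
     (if x \<in> sph_deriv_domain v R then sph_deriv_formula R x
      else (THE l. limitin euclideanreal (sph_deriv_formula R) l
                     (atin_within (berk_P1 v) x (sph_deriv_domain v R))))"

definition log_ereal :: "real \<Rightarrow> ereal" where
  "log_ereal t = (if t \<le> 0 then - \<infinity> else ereal (ln t))"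

text \<open>
  The integral is the difference of the integrals of the positive and negative parts
  (\<^const>\<open>e2ennreal\<close> maps negative numbers to 0). The first is finite, \<^const>\<open>sph_deriv\<close> being
  continuous on a compact space, so \<open>\<infinity> - \<infinity>\<close> does not arise.
\<close>

definition lyapunov :: "('a::field \<Rightarrow> real) \<Rightarrow> 'a ratfun \<Rightarrow> 'a berk measure \<Rightarrow> ereal" where
  "lyapunov v R \<nu> =
     enn2ereal (\<integral>\<^sup>+ x. e2ennreal (log_ereal (sph_deriv v R x)) \<partial>\<nu>) -
     enn2ereal (\<integral>\<^sup>+ x. e2ennreal (- log_ereal (sph_deriv v R x)) \<partial>\<nu>)"

end

(*
  Write sph for the spherical derivative and W = P' Q - P Q' for R = P / Q. By ergodicity, nu
  charges either no classical point or only classical points.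

  In the first case the points have a positive spherical diameter delta, and
  sph(x) >= min |l| * delta(R x) / delta(x). Integrating the logarithm, the coboundary
  log delta o R - log delta contributes nothing. The inequality compares W with P - b Q and Q on a
  disc: the logarithmic derivative of (P - b Q) / Q on the boundary circle has as its residue the
  number of zeros minus the number of poles inside, a nonzero integer at most deg R in absolute
  value when b is well chosen.

  In the second case a negative exponent forces an attracting cycle. The maximal ergodic theorem
  gives a set of positive measure, a union of balls of a fixed radius, along whose orbits R
  contracts uniformly. A union of such balls is always measurable, so the balls that never return
  to themselves can be graded by the integers such that R lowers the degree by one, and therefore
  have measure zero. A ball that returns contracts to an attracting periodic point, and there are
  only finitely many of these for each period.
*)

theory Submission
  imports Defs
begin

text \<open>Poincare recurrence says nothing about balls here: the classical line may be metrically
  nonseparable, so a set of positive measure may be a union of uncountably many null balls. The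
  grading by integers replaces recurrence. It involves arbitrary choices made ball by ball, which
  are harmless for measurability because every metrically open set of classical points is the trace
  of a Berkovich open set on the Borel set of classical points.

  Neither logarithm involved need be integrable. Near critical points log sph is unbounded below;
  truncating it at a small level \<epsilon> makes it integrable and, moreover, constant on balls of
  one radius, so that one radius serves all orbits. For log delta, whose integral may not exist, the
  coboundary is handled by truncating log delta itself to [-n, n].

  The constant min |l| bounds from below the norm of a residue, the difference of two distinct root
  counts between 0 and deg R. A difference that vanishes in K makes the minimum 0 and the bound
  -\<infinity>.\<close>

section \<open>Ergodic theory\<close>

text \<open>Garsia's argument. \<open>m N\<close> is the maximum of 0 and the Birkhoff sums of
  length at most \<open>N\<close>; comparing it with its shift shows that \<open>f\<close> has
  nonnegative integral over the set where some sum is positive. If the complement of that set were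
  null, this would be the whole integral of \<open>f\<close>.\<close>

lemma (in prob_space) maximal_ergodic:
  fixes f :: "'a \<Rightarrow> real"
  assumes T[measurable]: "T \<in> measurable M M" and inv: "distr M M T = M"
    and f: "integrable M f" and neg: "(\<integral>x. f x \<partial>M) < 0"
  shows "measure M {x\<in>space M. \<forall>n. (\<Sum>k<n. f ((T^^k) x)) \<le> 0} > 0"
proof -
  have [measurable]: "f \<in> borel_measurable M" using f by auto
  define m :: "nat \<Rightarrow> 'a \<Rightarrow> real"
    where "m = rec_nat (\<lambda>x. 0) (\<lambda>N mN x. max 0 (f x + mN (T x)))"
  have m0: "m 0 x = 0" and mS: "m (Suc N) x = max 0 (f x + m N (T x))" for N x
    by (simp_all add: m_def)
  have int_T: "integrable M (\<lambda>x. h (T x))" "(\<integral>x. h (T x) \<partial>M) = (\<integral>x. h x \<partial>M)"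
    if "integrable M h" for h :: "'a \<Rightarrow> real"
  proof -
    have [measurable]: "h \<in> borel_measurable M" using that by auto
    show "integrable M (\<lambda>x. h (T x))"
      using that integrable_distr[OF T, of h] inv by simp
    show "(\<integral>x. h (T x) \<partial>M) = (\<integral>x. h x \<partial>M)"
      using integral_distr[OF T, of h] inv by simp
  qed
  have mint: "integrable M (m N)" for N
  proof (induction N)
    case 0
    then show ?case by (simp add: m0[abs_def])
  next
    case (Suc N)
    have "m (Suc N) = (\<lambda>x. max 0 (f x + m N (T x)))" by (rule ext) (rule mS)
    then show ?case using int_T(1)[OF Suc] f by simp
  qed
  have [measurable]: "m N \<in> borel_measurable M" for N using mint[of N] by auto
  have mnn: "m N x \<ge> 0" for N x by (cases N) (auto simp: m0 mS)
  have mono: "m N x \<le> m (Suc N) x" for N x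
  proof (induction N arbitrary: x)
    case 0
    then show ?case by (simp add: m0 mS)
  next
    case (Suc N)
    show ?case using Suc[of "T x"] unfolding mS[of "Suc N" x] mS[of N x] by linarith
  qed
  have mono': "m N x \<le> m N' x" if "N \<le> N'" for N N' x
    using lift_Suc_mono_le[of "\<lambda>N. m N x", OF mono that] .
  define F where "F N x = (if m N x > 0 then f x else 0)" for N x
  define G where "G x = (if \<exists>N. m N x > 0 then f x else 0)" for x
  have [measurable]: "F N \<in> borel_measurable M" "G \<in> borel_measurable M" for N
    unfolding F_def[abs_def] G_def[abs_def] by measurable
  have Fint: "integrable M (F N)" for N
    by (rule Bochner_Integration.integrable_bound[OF f]) (auto simp: F_def)
  have Fpos: "(\<integral>x. F (Suc N) x \<partial>M) \<ge> 0" for N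
  proof -
    have "0 \<le> (\<integral>x. m (Suc N) x \<partial>M) - (\<integral>x. m N (T x) \<partial>M)"
      using integral_mono[OF mint mint mono] int_T(2)[OF mint] by simp
    also have "\<dots> = (\<integral>x. m (Suc N) x - m N (T x) \<partial>M)"
      using mint int_T(1)[OF mint] by simp
    also have "\<dots> \<le> (\<integral>x. F (Suc N) x \<partial>M)"
    proof (rule integral_mono)
      \<comment> \<open>Where \<open>m (Suc N)\<close> is positive the difference is exactly
        \<open>f\<close>; elsewhere it is \<open>- m N (T x)\<close>.\<close>
      fix x show "m (Suc N) x - m N (T x) \<le> F (Suc N) x"
        using mnn[of N "T x"] by (auto simp: F_def mS max_def)
    qed (use mint int_T(1)[OF mint] Fint in auto)
    finally show ?thesis .
  qed
  have lim: "(\<lambda>N. \<integral>x. F (Suc N) x \<partial>M) \<longlonglongrightarrow> (\<integral>x. G x \<partial>M)"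
  proof (rule integral_dominated_convergence[where w="\<lambda>x. \<bar>f x\<bar>"])
    show "AE x in M. (\<lambda>N. F (Suc N) x) \<longlonglongrightarrow> G x"
    proof (rule AE_I2)
      fix x
      show "(\<lambda>N. F (Suc N) x) \<longlonglongrightarrow> G x"
      proof (cases "\<exists>N. m N x > 0")
        case True
        then obtain N where N: "m N x > 0" by auto
        have "F (Suc n) x = G x" if "n \<ge> N" for n
          using mono'[of N "Suc n" x] that N True by (auto simp: F_def G_def)
        then show ?thesis
          by (intro tendsto_eventually) (auto simp: eventually_sequentially)
      next
        case False
        then show ?thesis by (auto simp: F_def G_def)
      qed
    qed
  qed (use f in \<open>auto simp: F_def\<close>)
  have Gpos: "(\<integral>x. G x \<partial>M) \<ge> 0"
    using LIMSEQ_le_const[OF lim] Fpos by auto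
  have Sm: "(\<Sum>k<n. f ((T^^k) x)) \<le> m n x" for n x
  proof (induction n arbitrary: x)
    case 0
    then show ?case by (simp add: m0)
  next
    case (Suc n)
    have "(\<Sum>k<Suc n. f ((T^^k) x)) = f x + (\<Sum>k<n. f ((T^^k) (T x)))"
      by (simp add: sum.lessThan_Suc_shift funpow_swap1 del: sum.lessThan_Suc)
    then show ?case using Suc[of "T x"] by (simp add: mS)
  qed
  let ?A = "{x\<in>space M. \<forall>n. (\<Sum>k<n. f ((T^^k) x)) \<le> 0}"
  have Tk[measurable]: "T ^^ k \<in> measurable M M" for k
    by (induction k) (auto simp: id_def)
  have [measurable]: "?A \<in> sets M" by measurable
  show ?thesis
  proof (rule ccontr)
    assume "\<not> ?thesis"
    then have "measure M ?A = 0" using measure_nonneg[of M ?A] by linarith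
    then have "AE x in M. x \<notin> ?A"
      by (simp add: prob_eq_0)
    with AE_space have "AE x in M. G x = f x"
    proof eventually_elim
      case (elim x)
      then obtain n where "(\<Sum>k<n. f ((T^^k) x)) > 0" by (auto simp: not_le)
      then have "m n x > 0" using Sm[of x n] by linarith
      then show ?case by (auto simp: G_def)
    qed
    then have "(\<integral>x. G x \<partial>M) = (\<integral>x. f x \<partial>M)"
      by (intro integral_cong_AE) auto
    then show False using Gpos neg by simp
  qed
qed

text \<open>\<open>u\<close> is not assumed integrable, so both sides may be infinite. For the
  truncation \<open>w n\<close> of \<open>u\<close> to \<open>[-n, n]\<close> the two sides agree by
  invariance. Truncation never enlarges the positive part of \<open>u (T x) - u x\<close>, and
  Fatou's lemma handles the limit on the left.\<close>

lemma (in prob_space) nn_integral_coboundary_le: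
  fixes u :: "'a \<Rightarrow> real"
  assumes T[measurable]: "T \<in> measurable M M" and inv: "distr M M T = M"
    and u[measurable]: "u \<in> borel_measurable M"
  shows "(\<integral>\<^sup>+x. ennreal (u x - u (T x)) \<partial>M) \<le> (\<integral>\<^sup>+x. ennreal (u (T x) - u x) \<partial>M)"
proof -
  define w where "w n x = max (- real n) (min (u x) (real n))" for n x
  have [measurable]: "w n \<in> borel_measurable M" for n
    unfolding w_def[abs_def] by measurable
  have bd: "\<bar>w n x\<bar> \<le> real n" for n x by (auto simp: w_def)
  have wint: "integrable M (w n)" for n
    by (rule integrable_const_bound[where B="real n"]) (use bd in auto)
  have wTint: "integrable M (\<lambda>x. w n (T x))" for n
    by (rule integrable_const_bound[where B="real n"]) (use bd in auto)
  have weq: "(\<integral>x. w n (T x) \<partial>M) = (\<integral>x. w n x \<partial>M)" for n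
    using integral_distr[OF T, of "w n"] inv by simp
  have eq: "(\<integral>\<^sup>+x. ennreal (w n x - w n (T x)) \<partial>M) = (\<integral>\<^sup>+x. ennreal (w n (T x) - w n x) \<partial>M)" (is "?l = ?r") for n
  proof -
    have i: "integrable M (\<lambda>x. w n x - w n (T x))" using wint wTint by auto
    have "(\<integral>x. w n x - w n (T x) \<partial>M) = 0"
      using wint wTint weq by simp
    moreover have "(\<integral>x. w n x - w n (T x) \<partial>M) = enn2real ?l - enn2real ?r"
      using real_lebesgue_integral_def[OF i] by simp
    moreover have "?l < \<infinity>" "?r < \<infinity>"
      using real_integrable_def[THEN iffD1, OF i] by (auto simp: less_top)
    ultimately show ?thesis
      by (cases ?l; cases ?r) auto
  qed
  have conv: "\<exists>N. \<forall>n\<ge>N. w n x - w n (T x) = u x - u (T x)" for x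
  proof -
    obtain N where N: "real N \<ge> max \<bar>u x\<bar> \<bar>u (T x)\<bar>" using real_arch_simple by blast
    show ?thesis
    proof (intro exI[of _ N] allI impI)
      fix n assume "n \<ge> N"
      then have "real n \<ge> real N" by simp
      then show "w n x - w n (T x) = u x - u (T x)"
        using N unfolding w_def by linarith
    qed
  qed
  have "(\<integral>\<^sup>+x. ennreal (u x - u (T x)) \<partial>M) = (\<integral>\<^sup>+x. liminf (\<lambda>n. ennreal (w n x - w n (T x))) \<partial>M)"
  proof (rule nn_integral_cong)
    fix x
    have "(\<lambda>n. ennreal (w n x - w n (T x))) \<longlonglongrightarrow> ennreal (u x - u (T x))"
      by (rule tendsto_eventually) (unfold eventually_sequentially, use conv[of x] in metis)
    then show "ennreal (u x - u (T x)) = liminf (\<lambda>n. ennreal (w n x - w n (T x)))"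
      by (simp add: lim_imp_Liminf)
  qed
  also have "\<dots> \<le> liminf (\<lambda>n. \<integral>\<^sup>+x. ennreal (w n x - w n (T x)) \<partial>M)"
    by (rule nn_integral_liminf) measurable
  also have "\<dots> = liminf (\<lambda>n. \<integral>\<^sup>+x. ennreal (w n (T x) - w n x) \<partial>M)"
    by (simp add: eq)
  also have "\<dots> \<le> liminf (\<lambda>n::nat. \<integral>\<^sup>+x. ennreal (u (T x) - u x) \<partial>M)"
  proof (intro Liminf_mono always_eventually allI nn_integral_mono)
    fix n x
    show "ennreal (w n (T x) - w n x) \<le> ennreal (u (T x) - u x)"
    proof (cases "w n (T x) - w n x \<le> 0")
      case True
      then show ?thesis by (simp add: ennreal_neg)
    next
      case False
      then show ?thesis unfolding w_def by (intro ennreal_leI) linarith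
    qed
  qed
  also have "\<dots> = (\<integral>\<^sup>+x. ennreal (u (T x) - u x) \<partial>M)"
    by (simp add: Liminf_const)
  finally show ?thesis .
qed


section \<open>Maps that contract an ultrametric on average\<close>

lemma (in prob_space) measure_funpow_vimage:
  assumes T[measurable]: "T \<in> measurable M M" and inv: "distr M M T = M" and X: "X \<in> sets M"
  shows "measure M ((T ^^ n) -` X \<inter> space M) = measure M X"
    and "(T ^^ n) \<in> measurable M M"
proof -
  have T1: "measure M (T -` Y \<inter> space M) = measure M Y" if "Y \<in> sets M" for Y
    using measure_distr[OF T that] inv by simp
  show Tn: "(T ^^ n) \<in> measurable M M" for n
    by (induction n) (auto simp: id_def)
  show "measure M ((T ^^ n) -` X \<inter> space M) = measure M X"
  proof (induction n)
    case 0
    then show ?case using sets.Int_space_eq2[OF X] by simp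
  next
    case (Suc n)
    have "(T ^^ Suc n) -` X \<inter> space M = T -` ((T ^^ n) -` X \<inter> space M) \<inter> space M"
      using measurable_space[OF T] by (auto simp: funpow_swap1)
    then show ?case
      using T1[OF measurable_sets[OF Tn X, of n]] Suc by (simp only:)
  qed
qed

text \<open>An abstract form of the classical line. \<open>L\<close> stands for the logarithm of a
  local Lipschitz constant, already truncated below so that it is integrable and constant on
  \<open>r\<close>-balls. \<open>open_sets\<close> makes arbitrary unions of balls measurable.
  \<open>complete\<close> mentions consecutive distances only, which in an ultrametric space is
  enough for a Cauchy sequence.\<close>

locale ultrametric_dynamics = prob_space M for M :: "'b measure" +
  fixes \<rho> :: "'b \<Rightarrow> 'b \<Rightarrow> real" and f :: "'b \<Rightarrow> 'b" and L :: "'b \<Rightarrow> real" and r :: real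
  assumes dist_nonneg: "\<rho> x y \<ge> 0"
    and dist_0: "\<rho> x y = 0 \<longleftrightarrow> x = y"
    and dist_sym: "\<rho> x y = \<rho> y x"
    and dist_ultra: "\<rho> x z \<le> max (\<rho> x y) (\<rho> y z)"
    and complete: "(\<lambda>k. \<rho> (X k) (X (Suc k))) \<longlonglongrightarrow> 0 \<Longrightarrow> \<exists>l. (\<lambda>k. \<rho> (X k) l) \<longlonglongrightarrow> 0"
    and space_UNIV: "space M = UNIV"
    and open_sets: "(\<And>x. x \<in> U \<Longrightarrow> \<exists>e>0. \<forall>y. \<rho> x y < e \<longrightarrow> y \<in> U) \<Longrightarrow> U \<in> sets M"
    and meas: "f \<in> measurable M M"
    and inv: "distr M M f = M"
    and ergodic: "A \<in> sets M \<Longrightarrow> f -` A = A \<Longrightarrow> measure M A = 0 \<or> measure M A = 1"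
    and r_pos: "r > 0"
    and step: "\<rho> x y < r \<Longrightarrow> \<rho> (f x) (f y) \<le> exp (L x) * \<rho> x y"
    and L_const: "\<rho> x y < r \<Longrightarrow> L y = L x"
    and L_int: "integrable M L"
    and L_neg: "(\<integral>x. L x \<partial>M) < 0"
    and fin_periodic: "p > 0 \<Longrightarrow> finite {z. (f ^^ p) z = z}"
begin

definition near :: "'b \<Rightarrow> 'b \<Rightarrow> bool" where "near x y \<longleftrightarrow> \<rho> x y < r"

lemma near_refl [simp]: "near x x"
  using r_pos dist_0[of x x] by (simp add: near_def)

lemma near_sym: "near x y \<Longrightarrow> near y x"
  by (simp add: near_def dist_sym)

lemma near_trans: "near x y \<Longrightarrow> near y z \<Longrightarrow> near x z"
  using dist_ultra[of x z y] by (simp add: near_def)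

lemma saturated_sets: "(\<And>x y. x \<in> U \<Longrightarrow> near x y \<Longrightarrow> y \<in> U) \<Longrightarrow> U \<in> sets M"
  using r_pos by (intro open_sets) (auto simp: near_def)

text \<open>Half of the mean, so that \<open>L + \<delta>\<close> still has negative integral: the
  maximal ergodic lemma then yields points whose Birkhoff sums decay linearly from the very first
  step.\<close>

definition \<delta> :: real where "\<delta> = - (\<integral>x. L x \<partial>M) / 2"

definition \<Lambda> :: real where "\<Lambda> = exp (- \<delta>)"

definition good :: "'b set" where
  "good = {x. \<forall>n. (\<Sum>k<n. L ((f ^^ k) x)) \<le> - (real n * \<delta>)}"

lemma \<delta>_pos: "\<delta> > 0"
  using L_neg by (simp add: \<delta>_def)

lemma \<Lambda>_bounds: "0 < \<Lambda>" "\<Lambda> < 1"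
  using \<delta>_pos by (auto simp: \<Lambda>_def)

lemma good_pos: "measure M good > 0"
proof -
  have "(\<integral>x. L x + \<delta> \<partial>M) < 0"
    using L_int L_neg prob_space by (simp add: \<delta>_def)
  from maximal_ergodic[OF meas inv _ this]
  have "measure M {x \<in> space M. \<forall>n. (\<Sum>k<n. L ((f ^^ k) x) + \<delta>) \<le> 0} > 0"
    using L_int by simp
  moreover have "{x \<in> space M. \<forall>n. (\<Sum>k<n. L ((f ^^ k) x) + \<delta>) \<le> 0} = good"
  proof -
    have "(\<Sum>k<n. L ((f ^^ k) x) + \<delta>) \<le> 0 \<longleftrightarrow> (\<Sum>k<n. L ((f ^^ k) x)) \<le> - (real n * \<delta>)" for n x
      by (simp add: sum.distrib) linarith
    then show ?thesis by (simp add: good_def space_UNIV)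
  qed
  ultimately show ?thesis by simp
qed

text \<open>One induction carries all three claims: the bound on the distance keeps the two orbits
  in a common \<open>r\<close>-ball, and only there does \<open>step\<close> apply once
  more.\<close>

lemma good_orbit:
  assumes x: "x \<in> good" and y: "near x y"
  shows "\<rho> ((f ^^ n) x) ((f ^^ n) y) \<le> exp (\<Sum>k<n. L ((f ^^ k) x)) * \<rho> x y"
    and "\<rho> ((f ^^ n) x) ((f ^^ n) y) \<le> \<Lambda> ^ n * \<rho> x y"
    and "near ((f ^^ n) x) ((f ^^ n) y)"
proof -
  have *: "\<rho> ((f ^^ n) x) ((f ^^ n) y) \<le> exp (\<Sum>k<n. L ((f ^^ k) x)) * \<rho> x y \<Longrightarrow>
      \<rho> ((f ^^ n) x) ((f ^^ n) y) \<le> \<Lambda> ^ n * \<rho> x y" for n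
  proof -
    assume "\<rho> ((f ^^ n) x) ((f ^^ n) y) \<le> exp (\<Sum>k<n. L ((f ^^ k) x)) * \<rho> x y"
    also have "\<dots> \<le> exp (- (real n * \<delta>)) * \<rho> x y"
      using x by (intro mult_right_mono dist_nonneg) (auto simp: good_def)
    also have "exp (- (real n * \<delta>)) = \<Lambda> ^ n"
      by (simp add: \<Lambda>_def exp_of_nat_mult[symmetric])
    finally show ?thesis .
  qed
  have **: "\<rho> ((f ^^ n) x) ((f ^^ n) y) \<le> \<Lambda> ^ n * \<rho> x y \<Longrightarrow> near ((f ^^ n) x) ((f ^^ n) y)" for n
  proof -
    assume "\<rho> ((f ^^ n) x) ((f ^^ n) y) \<le> \<Lambda> ^ n * \<rho> x y"
    also have "\<dots> \<le> 1 * \<rho> x y"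
      using \<Lambda>_bounds by (intro mult_right_mono dist_nonneg power_le_one) auto
    finally show ?thesis using y by (simp add: near_def)
  qed
  show 1: "\<rho> ((f ^^ n) x) ((f ^^ n) y) \<le> exp (\<Sum>k<n. L ((f ^^ k) x)) * \<rho> x y" for n
  proof (induction n)
    case 0
    then show ?case by simp
  next
    case (Suc n)
    have "\<rho> (f ((f ^^ n) x)) (f ((f ^^ n) y)) \<le> exp (L ((f ^^ n) x)) * \<rho> ((f ^^ n) x) ((f ^^ n) y)"
      using **[OF *[OF Suc]] by (intro step) (simp add: near_def)
    also have "\<dots> \<le> exp (L ((f ^^ n) x)) * (exp (\<Sum>k<n. L ((f ^^ k) x)) * \<rho> x y)"
      using Suc by (intro mult_left_mono) auto
    finally show ?case by (simp add: exp_add mult_ac)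
  qed
  show "\<rho> ((f ^^ n) x) ((f ^^ n) y) \<le> \<Lambda> ^ n * \<rho> x y" by (rule *[OF 1])
  show "near ((f ^^ n) x) ((f ^^ n) y)" by (rule **[OF *[OF 1]])
qed

text \<open>Orbits starting in one ball visit the same balls, where \<open>L\<close> is constant, so
  they have the same Birkhoff sums. Hence \<open>good\<close> is a union of balls.\<close>

lemma good_saturated:
  assumes x: "x \<in> good" and y: "near x y"
  shows "y \<in> good"
proof -
  have "L ((f ^^ k) y) = L ((f ^^ k) x)" for k
    using good_orbit(3)[OF x y, of k] by (intro L_const) (simp add: near_def)
  then show ?thesis using x by (simp add: good_def)
qed

lemma good_near_add:
  assumes "(f ^^ m) x \<in> good" and "near ((f ^^ m) x) ((f ^^ n) y)"
  shows "near ((f ^^ (j + m)) x) ((f ^^ (j + n)) y)"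
  using good_orbit(3)[OF assms, of j] by (simp add: funpow_add)

section \<open>Returning balls and the grading of the aperiodic points\<close>

lemma vimage_sets: "X \<in> sets M \<Longrightarrow> (f ^^ n) -` X \<in> sets M"
  using measurable_sets[OF measure_funpow_vimage(2)[OF meas inv], of X X n] by (simp add: space_UNIV)

lemma measure_vimage: "X \<in> sets M \<Longrightarrow> measure M ((f ^^ n) -` X) = measure M X"
  using measure_funpow_vimage(1)[OF meas inv, of X n] by (simp add: space_UNIV)

text \<open>For a good point the contraction turns \<open>near x ((f ^^ p) x)\<close> into the
  stronger fact that \<open>f ^^ p\<close> maps the ball of \<open>x\<close> into itself.\<close>

definition returning :: "nat \<Rightarrow> 'b set" where
  "returning p = {x \<in> good. near x ((f ^^ p) x)}"

text \<open>Returns are excluded along the whole orbit, since an orbit may enter a returning ball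
  late. One visit to \<open>good\<close> is enough to compare orbits from then on.\<close>

definition aperiodic :: "'b set" where
  "aperiodic = {x. \<exists>j. (f ^^ j) x \<in> good} - (\<Union>a. \<Union>p\<in>{0<..}. (f ^^ a) -` returning p)"

lemma good_sets: "good \<in> sets M"
  using good_saturated by (intro saturated_sets)

lemma returning_sets: "returning p \<in> sets M"
proof (rule saturated_sets)
  fix x y assume "x \<in> returning p" and xy: "near x y"
  then have "x \<in> good" "near x ((f ^^ p) x)" by (auto simp: returning_def)
  with xy good_orbit(3)[of x y p] good_saturated[of x y] show "y \<in> returning p"
    by (auto simp: returning_def intro: near_trans near_sym)
qed

lemma aperiodic_sets: "aperiodic \<in> sets M"
proof -
  have "{x. \<exists>j. (f ^^ j) x \<in> good} = (\<Union>j. (f ^^ j) -` good)" by auto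
  then show ?thesis
    unfolding aperiodic_def using vimage_sets good_sets returning_sets by auto
qed

text \<open>Only a return at time 0 could be overlooked by the orbit of \<open>f x\<close>. But a
  returning ball is returning again \<open>p\<close> steps later, and that positive time is seen by
  \<open>f x\<close>.\<close>

lemma aperiodicI:
  assumes "f x \<in> aperiodic"
  shows "x \<in> aperiodic"
proof -
  from assms obtain j where j: "(f ^^ j) (f x) \<in> good"
    and n: "\<And>a p. p > 0 \<Longrightarrow> (f ^^ a) (f x) \<notin> returning p"
    by (auto simp: aperiodic_def)
  have "(f ^^ a) x \<notin> returning p" if p: "p > 0" for a p
  proof
    assume *: "(f ^^ a) x \<in> returning p"
    then have g: "(f ^^ a) x \<in> good" and nr: "near ((f ^^ a) x) ((f ^^ (p + a)) x)"
      by (auto simp: returning_def funpow_add)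
    have "near ((f ^^ (p + a)) x) ((f ^^ (p + (p + a))) x)"
      using good_near_add[OF g nr] .
    moreover have "(f ^^ (p + a)) x \<in> good" using g nr by (rule good_saturated)
    ultimately have "(f ^^ (p + a)) x \<in> returning p" by (simp add: returning_def funpow_add)
    moreover obtain b where "p + a = Suc b" using p by (cases "p + a") auto
    ultimately show False using n[OF p, of b] by (simp add: funpow_swap1)
  qed
  moreover have "(f ^^ Suc j) x \<in> good" using j by (simp add: funpow_swap1)
  ultimately show ?thesis by (auto simp: aperiodic_def simp del: funpow.simps)
qed

text \<open>From these times on the two orbits stay in common balls, so \<open>int m - int n\<close>
  is the lag of \<open>x\<close> behind \<open>y\<close>.\<close>

definition merge :: "'b \<Rightarrow> nat \<Rightarrow> 'b \<Rightarrow> nat \<Rightarrow> bool" where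
  "merge x m y n \<longleftrightarrow> (f ^^ m) x \<in> good \<and> near ((f ^^ m) x) ((f ^^ n) y)"

lemma merge_sym: "merge x m y n \<Longrightarrow> merge y n x m"
  by (auto simp: merge_def intro: good_saturated near_sym)

text \<open>Lags add up. The two meeting times on the orbit of \<open>y\<close> need not agree; the
  earlier meeting is postponed to the later time, which is possible because merged orbits stay
  together.\<close>

lemma merge_trans:
  assumes xy: "merge x m y n" and yz: "merge y k z l"
  shows "\<exists>a b. merge x a z b \<and> int a - int b = (int m - int n) + (int k - int l)"
proof (cases "n \<le> k")
  case True
  define j where "j = k - n"
  have k: "k = j + n" using True by (simp add: j_def)
  have "near ((f ^^ (j + m)) x) ((f ^^ k) y)"
    using good_near_add[of m x n y j] xy by (simp add: merge_def k)
  then have "merge x (j + m) z l"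
    using yz unfolding merge_def by (meson good_saturated near_sym near_trans)
  then show ?thesis using k by (intro exI[of _ "j + m"] exI[of _ l]) auto
next
  case False
  define j where "j = n - k"
  have n: "n = j + k" using False by (simp add: j_def)
  have "near ((f ^^ n) y) ((f ^^ (j + l)) z)"
    using good_near_add[of k y l z j] yz by (simp add: merge_def n)
  then have "merge x m z (j + l)"
    using xy unfolding merge_def by (meson near_trans)
  then show ?thesis using n by (intro exI[of _ m] exI[of _ "j + l"]) auto
qed

text \<open>Visiting one good ball at two different times would make it a returning ball.\<close>

lemma aperiodic_merge_self:
  assumes x: "x \<in> aperiodic" and m: "merge x m x n"
  shows "m = n"
proof (rule ccontr)
  have *: False if "m < n" "merge x m x n" for m n
  proof -
    have "(f ^^ (n - m)) ((f ^^ m) x) = (f ^^ n) x"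
      using that(1) funpow_add[of "n - m" m f] by simp
    then have "(f ^^ m) x \<in> returning (n - m)"
      using that by (simp add: returning_def merge_def)
    then show False using x that by (auto simp: aperiodic_def)
  qed
  assume "m \<noteq> n"
  then consider "m < n" | "n < m" by linarith
  then show False using *[OF _ m] *[OF _ merge_sym[OF m]] by cases
qed

text \<open>
  Aperiodic points are graded by how far their orbit runs ahead of the orbit of a chosen
  representative. The choice is harmless: every set that is saturated under \<^const>\<open>near\<close> is
  open, so the level sets are measurable although the space need not be separable.
\<close>

definition rep :: "'b \<Rightarrow> 'b" where
  "rep x = (SOME y. \<exists>m n. merge x m y n)"

definition level :: "int \<Rightarrow> 'b set" where
  "level i = {x \<in> aperiodic. \<exists>m n. merge x m (rep x) n \<and> i = int m - int n}"

lemma rep_eq: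
  assumes "merge x m y n"
  shows "rep x = rep y"
proof -
  have "\<exists>m n. merge y m z n" if "merge x m z n" for m n z
    using merge_trans[OF merge_sym[OF assms] that] by blast
  moreover have "\<exists>m n. merge x m z n" if "merge y m z n" for m n z
    using merge_trans[OF assms that] by blast
  ultimately have "(\<exists>m n. merge x m z n) \<longleftrightarrow> (\<exists>m n. merge y m z n)" for z by blast
  then show ?thesis by (simp add: rep_def)
qed

lemma merge_rep:
  assumes "x \<in> aperiodic"
  shows "\<exists>m n. merge x m (rep x) n"
proof -
  obtain j where "(f ^^ j) x \<in> good" using assms by (auto simp: aperiodic_def)
  then have "\<exists>y m n. merge x m y n" by (metis merge_def near_refl)
  then show ?thesis unfolding rep_def by (rule someI_ex)
qed

lemma aperiodic_levels: "aperiodic = (\<Union>i. level i)"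
  using merge_rep by (auto simp: level_def)

text \<open>The grade does not depend on the merging times: two choices differ by a merging of
  \<open>x\<close> with itself, whose lag is 0.\<close>

lemma level_disjoint:
  assumes "x \<in> level i" "x \<in> level j"
  shows "i = j"
proof -
  obtain m n k l where *: "merge x m (rep x) n" "i = int m - int n"
    "merge x k (rep x) l" "j = int k - int l" "x \<in> aperiodic"
    using assms by (auto simp: level_def)
  obtain a b where "merge x a x b" "int a - int b = i - j"
    using merge_trans[OF *(1) merge_sym[OF *(3)]] * by auto
  with aperiodic_merge_self[OF *(5)] show ?thesis by fastforce
qed

text \<open>\<open>x\<close> lags one step behind \<open>f x\<close>, and both have the same
  representative.\<close>

lemma level_vimage: "f -` level i \<subseteq> level (i + 1)"
proof
  fix x assume "x \<in> f -` level i"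
  then obtain m n where *: "f x \<in> aperiodic" "merge (f x) m (rep (f x)) n" "i = int m - int n"
    by (auto simp: level_def)
  have m: "merge x (Suc m) (f x) m"
    using *(2) by (simp add: merge_def funpow_swap1)
  have "merge x (Suc m) (rep (f x)) n"
    using *(2) by (simp add: merge_def funpow_swap1)
  then show "x \<in> level (i + 1)"
    using aperiodicI[OF *(1)] rep_eq[OF m] *(3) by (force simp: level_def)
qed

text \<open>Within \<open>aperiodic\<close> the grade depends only on a good ball that is reached
  and on the time of reaching it. The balls reached at time \<open>m\<close> from grade
  \<open>i\<close> form a saturated set \<open>Y m\<close>, and a point that hits \<open>Y m\<close>
  at the same time \<open>m\<close> merges with lag 0.\<close>

lemma level_sets: "level i \<in> sets M"
proof -
  define Y where "Y m = {y \<in> good. \<exists>x\<in>level i. near y ((f ^^ m) x)}" for m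
  have "Y m \<in> sets M" for m
    unfolding Y_def by (rule saturated_sets) (blast intro: good_saturated near_sym near_trans)
  moreover have "level i = aperiodic \<inter> (\<Union>m. (f ^^ m) -` Y m)"
  proof (intro equalityI subsetI)
    fix x assume x: "x \<in> level i"
    then obtain j where "(f ^^ j) x \<in> good" by (auto simp: level_def aperiodic_def)
    then have "(f ^^ j) x \<in> Y j" using x near_refl unfolding Y_def by blast
    then show "x \<in> aperiodic \<inter> (\<Union>m. (f ^^ m) -` Y m)" using x by (auto simp: level_def)
  next
    fix x assume "x \<in> aperiodic \<inter> (\<Union>m. (f ^^ m) -` Y m)"
    then obtain m x' where x: "x \<in> aperiodic" "merge x m x' m" "x' \<in> level i"
      by (auto simp: Y_def merge_def)
    then obtain k l where kl: "merge x' k (rep x') l" "i = int k - int l"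
      by (auto simp: level_def)
    obtain a b where "merge x a (rep x) b" "int a - int b = i"
      using merge_trans[OF x(2) kl(1)] kl(2) rep_eq[OF x(2)] by auto
    then show "x \<in> level i" using x(1) unfolding level_def by blast
  qed
  ultimately show ?thesis using vimage_sets aperiodic_sets by auto
qed

text \<open>By invariance the measure does not decrease from one grade to the next. If one grade had
  positive measure, infinitely many disjoint sets would have at least that measure.\<close>

lemma level_null: "measure M (level i) = 0"
proof (rule ccontr)
  assume "measure M (level i) \<noteq> 0"
  then have pos: "measure M (level i) > 0" using measure_nonneg[of M "level i"] by linarith
  have mono: "measure M (level j) \<le> measure M (level (j + 1))" for j
  proof -
    have "measure M (level j) = measure M (f -` level j)"
      using measure_vimage[OF level_sets, of 1 j] by simp
    also have "\<dots> \<le> measure M (level (j + 1))"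
      by (intro finite_measure_mono level_vimage level_sets)
    finally show ?thesis .
  qed
  have le: "measure M (level i) \<le> measure M (level (i + int k))" for k
  proof (induction k)
    case (Suc k)
    then show ?case using mono[of "i + int k"] by (simp add: add_ac)
  qed simp
  obtain N where N: "1 < real N * measure M (level i)"
    using reals_Archimedean3[OF pos] by blast
  have "real N * measure M (level i) = (\<Sum>k<N. measure M (level i))" by simp
  also have "\<dots> \<le> (\<Sum>k<N. measure M (level (i + int k)))"
    by (intro sum_mono le)
  also have "\<dots> = measure M (\<Union>k<N. level (i + int k))"
    by (rule finite_measure_finite_Union[symmetric])
       (auto simp: disjoint_family_on_def level_sets dest: level_disjoint)
  also have "\<dots> \<le> 1" by (rule prob_le_1)
  finally show False using N by simp
qed

lemma ex_returning: "\<exists>p>0. measure M (returning p) > 0"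
proof (rule ccontr)
  assume "\<not> ?thesis"
  then have 0: "measure M (returning p) = 0" if "p > 0" for p
    using that measure_nonneg[of M "returning p"] by (metis less_eq_real_def)
  have null: "X \<in> null_sets M" if "X \<in> sets M" "measure M X = 0" for X
    using that by (simp add: null_sets_def emeasure_eq_measure)
  have 1: "(f ^^ a) -` returning p \<in> null_sets M" if "p > 0" for a p
    using 0[OF that] measure_vimage[OF returning_sets] vimage_sets[OF returning_sets] null by simp
  have "(\<Union>a. \<Union>p\<in>{0<..}. (f ^^ a) -` returning p) \<in> null_sets M"
    by (intro null_sets_UN' null_sets_UN 1) auto
  moreover have "aperiodic \<in> null_sets M"
    unfolding aperiodic_levels by (intro null_sets_UN' null level_sets level_null) auto
  ultimately have "aperiodic \<union> (\<Union>a. \<Union>p\<in>{0<..}. (f ^^ a) -` returning p) \<in> null_sets M"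
    by (rule null_sets.Un[rotated])
  moreover have "good \<subseteq> aperiodic \<union> (\<Union>a. \<Union>p\<in>{0<..}. (f ^^ a) -` returning p)"
    unfolding aperiodic_def by (auto intro: exI[of _ 0])
  ultimately have "good \<in> null_sets M"
    using good_sets null_sets_subset by blast
  then show False using good_pos by (simp add: measure_eq_0_null_sets)
qed

text \<open>Banach's fixed point argument for \<open>f ^^ p\<close> on the ball of \<open>y\<close>,
  which it contracts by \<open>\<Lambda> ^ p\<close>. The limit stays in the ball because balls are
  the classes of the equivalence relation \<open>near\<close>.\<close>

lemma returning_fixed_point:
  assumes "p > 0" and y: "y \<in> returning p"
  shows "\<exists>z. near y z \<and> (f ^^ p) z = z"
proof -
  define X where "X k = (f ^^ (k * p)) y" for k
  have yg: "y \<in> good" and yp: "near y ((f ^^ p) y)" using y by (auto simp: returning_def)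
  have XS: "X (Suc k) = (f ^^ p) (X k)" for k
    by (simp add: X_def funpow_add)
  have nX: "near y (X k)" for k
  proof (induction k)
    case (Suc k)
    then have "near ((f ^^ p) y) (X (Suc k))" unfolding XS by (intro good_orbit(3) yg)
    then show ?case using yp near_trans by blast
  qed (simp add: X_def)
  have step: "\<rho> (X (Suc k)) (X (Suc (Suc k))) \<le> \<Lambda> * \<rho> (X k) (X (Suc k))" for k
  proof -
    have g: "X k \<in> good" using good_saturated[OF yg nX] .
    have "near (X k) (X (Suc k))" using near_trans[OF near_sym[OF nX] nX] .
    from good_orbit(2)[OF g this, of p]
    have "\<rho> (X (Suc k)) (X (Suc (Suc k))) \<le> \<Lambda> ^ p * \<rho> (X k) (X (Suc k))"
      by (simp only: XS[symmetric])
    also have "\<dots> \<le> \<Lambda> * \<rho> (X k) (X (Suc k))"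
      using \<Lambda>_bounds power_decreasing[of 1 p \<Lambda>] \<open>p > 0\<close>
      by (intro mult_right_mono dist_nonneg) auto
    finally show ?thesis .
  qed
  have bd: "\<rho> (X k) (X (Suc k)) \<le> \<Lambda> ^ k * \<rho> (X 0) (X 1)" for k
  proof (induction k)
    case (Suc k)
    have "\<Lambda> * \<rho> (X k) (X (Suc k)) \<le> \<Lambda> * (\<Lambda> ^ k * \<rho> (X 0) (X 1))"
      using Suc \<Lambda>_bounds by (intro mult_left_mono) auto
    then show ?case using step[of k] by simp
  qed simp
  have \<Lambda>0: "(\<lambda>k. \<Lambda> ^ k) \<longlonglongrightarrow> 0" using \<Lambda>_bounds by (intro LIMSEQ_power_zero) auto
  have cv: "(\<lambda>k. \<rho> (X k) (X (Suc k))) \<longlonglongrightarrow> 0"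
  proof (rule Lim_null_comparison)
    show "\<forall>\<^sub>F k in sequentially. norm (\<rho> (X k) (X (Suc k))) \<le> \<Lambda> ^ k * \<rho> (X 0) (X 1)"
      using bd dist_nonneg by simp
    show "(\<lambda>k. \<Lambda> ^ k * \<rho> (X 0) (X 1)) \<longlonglongrightarrow> 0" using tendsto_mult_left_zero[OF \<Lambda>0] .
  qed
  then obtain z where z: "(\<lambda>k. \<rho> (X k) z) \<longlonglongrightarrow> 0" using complete by blast
  have "eventually (\<lambda>k. \<rho> (X k) z < r) sequentially"
    using order_tendstoD(2)[OF z r_pos] .
  then obtain k0 where "near (X k0) z" unfolding near_def eventually_sequentially by blast
  then have yz: "near y z" using nX near_trans by blast
  have "\<rho> (X (Suc k)) ((f ^^ p) z) \<le> \<rho> (X k) z" for k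
  proof -
    have g: "X k \<in> good" using good_saturated[OF yg nX] .
    have "\<rho> (X (Suc k)) ((f ^^ p) z) \<le> \<Lambda> ^ p * \<rho> (X k) z"
      unfolding XS by (intro good_orbit(2) g) (meson nX near_sym near_trans yz)
    also have "\<dots> \<le> 1 * \<rho> (X k) z"
      using \<Lambda>_bounds by (intro mult_right_mono dist_nonneg power_le_one) auto
    finally show ?thesis by simp
  qed
  then have "\<rho> z ((f ^^ p) z) \<le> max (\<rho> (X (Suc k)) z) (\<rho> (X k) z)" for k
    using dist_ultra[of z "(f ^^ p) z" "X (Suc k)"] dist_sym[of z "X (Suc k)"]
    by (smt (verit))
  moreover have "(\<lambda>k. max (\<rho> (X (Suc k)) z) (\<rho> (X k) z)) \<longlonglongrightarrow> max 0 0"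
    by (intro tendsto_max LIMSEQ_Suc z)
  ultimately have "\<rho> z ((f ^^ p) z) \<le> 0"
    using LIMSEQ_le_const[of "\<lambda>k. max (\<rho> (X (Suc k)) z) (\<rho> (X k) z)" 0 "\<rho> z ((f ^^ p) z)"] by auto
  then have "z = (f ^^ p) z" using dist_0[of z "(f ^^ p) z"] dist_nonneg[of z "(f ^^ p) z"] by linarith
  with yz show ?thesis by metis
qed

text \<open>The set \<open>W\<close> of points whose orbits enter the ball of a periodic point is
  invariant of positive measure, hence of full measure. These orbits approach the cycle, so
  invariance of the measure transfers full measure to every neighbourhood \<open>V e\<close> of the
  cycle, and then to the cycle itself.\<close>

theorem ex_attracting_cycle:
  "\<exists>z p. p > 0 \<and> (f ^^ p) z = z \<and> (\<forall>k. 0 < k \<and> k < p \<longrightarrow> (f ^^ k) z \<noteq> z) \<and>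
     (\<exists>c<1. \<forall>y. \<rho> z y < r \<longrightarrow> \<rho> ((f ^^ p) z) ((f ^^ p) y) \<le> c * \<rho> z y) \<and>
     (\<lambda>k. (f ^^ k) z) ` {..<p} \<in> sets M \<and> measure M ((\<lambda>k. (f ^^ k) z) ` {..<p}) = 1"
proof -
  define B where "B z = {w. near z w}" for z
  have B_sets: "B z \<in> sets M" for z
    unfolding B_def by (intro saturated_sets) (auto intro: near_trans)
  obtain q where q: "q > 0" "measure M (returning q) > 0" using ex_returning by blast
  define Z where "Z = {z. (f ^^ q) z = z} \<inter> good"
  have finZ: "finite Z" unfolding Z_def using fin_periodic[OF q(1)] by simp
  have sub: "returning q \<subseteq> (\<Union>z\<in>Z. B z)"
  proof
    fix y assume y: "y \<in> returning q"
    obtain z where "near y z" "(f ^^ q) z = z" using returning_fixed_point[OF q(1) y] by blast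
    then show "y \<in> (\<Union>z\<in>Z. B z)"
      using y good_saturated[of y z] by (auto simp: Z_def B_def returning_def intro: near_sym)
  qed
  have "\<exists>z\<in>Z. measure M (B z) > 0"
  proof (rule ccontr)
    assume "\<not> ?thesis"
    then have "measure M (B z) = 0" if "z \<in> Z" for z
      using that measure_nonneg[of M "B z"] by (metis less_eq_real_def)
    moreover have "measure M (returning q) \<le> (\<Sum>z\<in>Z. measure M (B z))"
    proof -
      have "measure M (returning q) \<le> measure M (\<Union>z\<in>Z. B z)"
        using finZ B_sets by (intro finite_measure_mono sub) auto
      also have "\<dots> \<le> (\<Sum>z\<in>Z. measure M (B z))"
        using finZ B_sets by (intro finite_measure_subadditive_finite) auto
      finally show ?thesis .
    qed
    ultimately show False using q(2) by simp
  qed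
  then obtain z where z: "(f ^^ q) z = z" "z \<in> good" "measure M (B z) > 0" by (auto simp: Z_def)
  \<comment> \<open>\<open>q\<close> is just some return time, while a cycle needs the exact period.
    This costs nothing, as \<open>good_orbit\<close> gives the contraction for every
    iterate.\<close>
  define p where "p = (LEAST p. p > 0 \<and> (f ^^ p) z = z)"
  have p: "p > 0" "(f ^^ p) z = z"
    using LeastI[of "\<lambda>p. p > 0 \<and> (f ^^ p) z = z" q] q(1) z(1) unfolding p_def by auto
  have pmin: "(f ^^ k) z \<noteq> z" if "0 < k" "k < p" for k
    using not_less_Least[of k "\<lambda>p. p > 0 \<and> (f ^^ p) z = z"] that unfolding p_def by auto
  define Orb where "Orb = (\<lambda>k. (f ^^ k) z) ` {..<p}"
  define W where "W = (\<Union>j. (f ^^ j) -` B z)"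
  have W_sets: "W \<in> sets M" unfolding W_def using vimage_sets[OF B_sets] by auto
  have "f -` W = W"
  proof (intro equalityI subsetI)
    fix x assume "x \<in> f -` W"
    then obtain j where "(f ^^ Suc j) x \<in> B z" by (auto simp: W_def funpow_swap1)
    then show "x \<in> W" unfolding W_def by blast
  next
    fix x assume "x \<in> W"
    then obtain j where "near z ((f ^^ j) x)" by (auto simp: W_def B_def)
    from good_orbit(3)[OF z(2) this, of p] p(2) have "near z ((f ^^ (p + j)) x)"
      by (simp add: funpow_add)
    moreover obtain i where "p + j = Suc i" using p(1) by (cases "p + j") auto
    ultimately have "(f ^^ i) (f x) \<in> B z" by (simp add: B_def funpow_swap1)
    then show "x \<in> f -` W" by (auto simp: W_def)
  qed
  moreover have "measure M W > 0"
  proof -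
    have "B z \<subseteq> W" unfolding W_def using UN_upper[of 0 UNIV "\<lambda>j. (f ^^ j) -` B z"] by simp
    then show ?thesis using finite_measure_mono[OF _ W_sets, of "B z"] z(3) by linarith
  qed
  ultimately have W1: "measure M W = 1" using ergodic[OF W_sets] by auto
  define V where "V e = {y. \<exists>k<p. \<rho> ((f ^^ k) z) y < e}" for e
  have V_sets: "V e \<in> sets M" for e
  proof (rule open_sets)
    fix x assume "x \<in> V e"
    then obtain k where k: "k < p" "\<rho> ((f ^^ k) z) x < e" by (auto simp: V_def)
    then have "e > 0" using dist_nonneg[of "(f ^^ k) z" x] by linarith
    moreover have "y \<in> V e" if "\<rho> x y < e" for y
      using k that dist_ultra[of "(f ^^ k) z" y x] by (auto simp: V_def intro!: exI[of _ k])
    ultimately show "\<exists>e'>0. \<forall>y. \<rho> x y < e' \<longrightarrow> y \<in> V e" by blast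
  qed
  have V1: "measure M (V e) = 1" if e: "e > 0" for e
  proof -
    define G where "G N = {y. \<forall>n\<ge>N. (f ^^ n) y \<in> V e}" for N
    have G_eq: "G N = (\<Inter>n\<in>{N..}. (f ^^ n) -` V e)" for N by (auto simp: G_def)
    have G_sets: "G N \<in> sets M" for N
      unfolding G_eq using vimage_sets[OF V_sets] by (intro sets.countable_INT'') (auto simp: space_UNIV[symmetric])
    have WG: "W \<subseteq> (\<Union>N. G N)"
    proof
      fix y assume "y \<in> W"
      then obtain j where j: "near z ((f ^^ j) y)" by (auto simp: W_def B_def)
      have "(\<lambda>n. \<Lambda> ^ n * \<rho> z ((f ^^ j) y)) \<longlonglongrightarrow> 0"
        using \<Lambda>_bounds by (intro tendsto_mult_left_zero LIMSEQ_power_zero) auto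
      from order_tendstoD(2)[OF this e] obtain N
        where N: "\<And>n. n \<ge> N \<Longrightarrow> \<Lambda> ^ n * \<rho> z ((f ^^ j) y) < e"
        unfolding eventually_sequentially by blast
      have "(f ^^ n) y \<in> V e" if n: "n \<ge> N + j" for n
      proof -
        define i where "i = n - j"
        have i: "n = i + j" "i \<ge> N" using n by (auto simp: i_def)
        have "\<rho> ((f ^^ i) z) ((f ^^ n) y) \<le> \<Lambda> ^ i * \<rho> z ((f ^^ j) y)"
          using good_orbit(2)[OF z(2) j, of i] by (simp add: i(1) funpow_add)
        moreover have "(f ^^ i) z = (f ^^ (i mod p)) z"
          using funpow_mod_eq[OF p(2), of i] by simp
        ultimately have "\<rho> ((f ^^ (i mod p)) z) ((f ^^ n) y) < e" using N[OF i(2)] by simp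
        then show ?thesis using p(1) by (auto simp: V_def intro!: exI[of _ "i mod p"])
      qed
      then show "y \<in> (\<Union>N. G N)" by (auto simp: G_def)
    qed
    have "(\<lambda>N. measure M (G N)) \<longlonglongrightarrow> measure M (\<Union>N. G N)"
      using G_sets by (intro finite_Lim_measure_incseq) (auto simp: incseq_def G_def)
    moreover have "measure M (\<Union>N. G N) = 1"
    proof -
      have "(\<Union>N. G N) \<in> sets M" using G_sets by auto
      then show ?thesis using finite_measure_mono[OF WG] W1 prob_le_1[of "\<Union>N. G N"] by linarith
    qed
    moreover have "measure M (G N) \<le> measure M (V e)" for N
    proof -
      have "measure M (G N) \<le> measure M ((f ^^ N) -` V e)"
        by (intro finite_measure_mono vimage_sets V_sets) (auto simp: G_def)
      then show ?thesis using measure_vimage[OF V_sets] by simp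
    qed
    ultimately have "1 \<le> measure M (V e)"
      by (metis LIMSEQ_le_const2)
    then show ?thesis using prob_le_1[of "V e"] by linarith
  qed
  have O_sets: "- Orb \<in> sets M" and O_V: "\<And>x. x \<notin> Orb \<Longrightarrow> \<exists>e>0. x \<notin> V e"
  proof -
    have *: "\<exists>e>0. \<forall>k<p. e \<le> \<rho> ((f ^^ k) z) x" if x: "x \<notin> Orb" for x
    proof (intro exI[of _ "Min ((\<lambda>k. \<rho> ((f ^^ k) z) x) ` {..<p})"] conjI)
      have "\<rho> ((f ^^ k) z) x > 0" if "k < p" for k
      proof -
        have "(f ^^ k) z \<noteq> x" using x that by (auto simp: Orb_def)
        then show ?thesis using dist_0 dist_nonneg by (metis less_eq_real_def)
      qed
      then show "0 < Min ((\<lambda>k. \<rho> ((f ^^ k) z) x) ` {..<p})"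
        using p(1) by (subst Min_gr_iff) auto
    qed auto
    show "\<exists>e>0. x \<notin> V e" if "x \<notin> Orb" for x
      using *[OF that] unfolding V_def by fastforce
    show "- Orb \<in> sets M"
    proof (rule open_sets)
      fix x assume "x \<in> - Orb"
      then obtain e where e: "e > 0" "\<And>k. k < p \<Longrightarrow> e \<le> \<rho> ((f ^^ k) z) x" using * by auto
      have "y \<notin> Orb" if "\<rho> x y < e" for y
        using e(2) that dist_sym[of x y] unfolding Orb_def by fastforce
      then show "\<exists>e>0. \<forall>y. \<rho> x y < e \<longrightarrow> y \<in> - Orb" using e(1) by auto
    qed
  qed
  have O_sets': "Orb \<in> sets M"
    using sets.compl_sets[OF O_sets] by (simp add: space_UNIV Compl_eq_Diff_UNIV[symmetric])
  have "AE x in M. \<forall>n. x \<in> V (1 / real (Suc n))"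
    unfolding AE_all_countable using V1 V_sets by (simp add: prob_eq_1)
  then have "AE x in M. x \<in> Orb"
  proof eventually_elim
    case (elim x)
    show ?case
    proof (rule ccontr)
      assume "x \<notin> Orb"
      then obtain e where e: "e > 0" "x \<notin> V e" using O_V by blast
      obtain n where "1 / real (Suc n) < e" using e(1) nat_approx_posE by blast
      moreover have "x \<in> V (1 / real (Suc n))" using elim by blast
      ultimately have "x \<in> V e" unfolding V_def by (auto intro: less_trans)
      then show False using e(2) by simp
    qed
  qed
  then have "measure M Orb = 1" using O_sets' by (simp add: prob_eq_1)
  moreover have "\<forall>y. \<rho> z y < r \<longrightarrow> \<rho> ((f ^^ p) z) ((f ^^ p) y) \<le> \<Lambda> ^ p * \<rho> z y"
    using good_orbit(2)[OF z(2)] by (simp add: near_def)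
  moreover have "\<Lambda> ^ p < 1" using \<Lambda>_bounds p(1) by (simp add: power_Suc_less_one power_less_one_iff)
  ultimately show ?thesis
    using p pmin O_sets' unfolding Orb_def by (intro exI[of _ z] exI[of _ p]) blast
qed

end

section \<open>Gauss norms and multiplicative seminorms\<close>

definition linear_prod :: "'a::comm_ring_1 multiset \<Rightarrow> 'a poly" where
  "linear_prod A = (\<Prod>z\<in>#A. [:- z, 1:])"

lemma linear_prod_simps [simp]:
  "linear_prod {#} = 1" "linear_prod (add_mset z A) = [:- z, 1:] * linear_prod A"
  by (simp_all add: linear_prod_def)

lemma linear_prod_factorization:
  fixes p :: "'a::alg_closed_field poly"
  assumes "p \<noteq> 0"
  obtains A where "size A = degree p" "p = smult (lead_coeff p) (linear_prod A)"
  using alg_closed_imp_factorization[OF assms] unfolding linear_prod_def by blast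

context complete_nonarch_field
begin

lemma v_0 [simp]: "v 0 = 0" by (simp add: eq_0_iff)

lemma v_1 [simp]: "v 1 = 1"
  using mult[of 1 1] eq_0_iff[of 1] by simp

lemma v_minus [simp]: "v (- x) = v x"
proof -
  have "v (-1) * v (-1) = 1" using mult[of "-1" "-1"] by simp
  then have "v (-1) = 1" using nonneg[of "-1"] by (metis abs_of_nonneg abs_mult_self_eq abs_1 real_sqrt_abs2 real_sqrt_one)
  then show ?thesis using mult[of "-1" x] by simp
qed

lemma v_minus_commute: "v (x - y) = v (y - x)"
  using v_minus[of "x - y"] by simp

lemma v_diff_le: "v (x - y) \<le> max (v x) (v y)"
  using ultrametric[of x "- y"] by simp

lemma v_power: "v (x ^ n) = v x ^ n"
  by (induction n) (auto simp: mult)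

lemma v_pos: "x \<noteq> 0 \<Longrightarrow> v x > 0"
  using nonneg[of x] eq_0_iff[of x] by linarith

lemma v_divide: "v (x / y) = v x / v y"
proof (cases "y = 0")
  case False
  then have "v (x / y) * v y = v x" using mult[of "x / y" y] by simp
  then show ?thesis using v_pos[OF False] by (simp add: field_simps)
qed simp

lemma v_of_nat_le_1: "v (of_nat n) \<le> 1"
proof (induction n)
  case (Suc n)
  then show ?case using ultrametric[of 1 "of_nat n"] by simp
qed simp

lemma v_isosceles:
  assumes "v x < v y"
  shows "v (x + y) = v y"
proof (rule antisym)
  show "v (x + y) \<le> v y" using ultrametric[of x y] assms by simp
  show "v y \<le> v (x + y)" using v_diff_le[of "x + y" x] assms by simp
qed

lemma v_complete:
  assumes "(\<lambda>k. v (X k - X (Suc k))) \<longlonglongrightarrow> 0"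
  shows "\<exists>l. (\<lambda>k. v (X k - l)) \<longlonglongrightarrow> 0"
proof -
  interpret MS: Metric_space UNIV "\<lambda>x y. v (x - y)"
  proof
    fix x y z :: 'a
    show "0 \<le> v (x - y)" by (rule nonneg)
    show "v (x - y) = v (y - x)" by (rule v_minus_commute)
    show "(v (x - y) = 0) = (x = y)" by (simp add: eq_0_iff)
    show "v (x - z) \<le> v (x - y) + v (y - z)"
      using ultrametric[of "x - y" "y - z"] nonneg[of "x - y"] nonneg[of "y - z"] by simp
  qed
  have "\<exists>N. \<forall>n n'. N \<le> n \<longrightarrow> N \<le> n' \<longrightarrow> v (X n - X n') < e" if e: "e > 0" for e
  proof -
    from order_tendstoD(2)[OF assms e] obtain N where N: "\<And>k. k \<ge> N \<Longrightarrow> v (X k - X (Suc k)) < e"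
      unfolding eventually_sequentially by blast
    have *: "v (X N - X (N + j)) < e" for j
    proof (induction j)
      case (Suc j)
      then show ?case
        using ultrametric[of "X N - X (N + j)" "X (N + j) - X (Suc (N + j))"] N[of "N + j"] by simp
    qed (use e in simp)
    have "v (X n - X n') < e" if "N \<le> n" "N \<le> n'" for n n'
      using ultrametric[of "X n - X N" "X N - X n'"] *[of "n - N"] *[of "n' - N"] that
        v_minus_commute[of "X n" "X N"] by simp
    then show ?thesis by blast
  qed
  then have "MS.MCauchy X" by (simp add: MS.MCauchy_def)
  then obtain l where "limitin MS.mtopology X l sequentially"
    using complete by (auto simp: MS.mcomplete_def)
  then have "\<forall>e>0. \<exists>N. \<forall>n\<ge>N. v (X n - l) < e"
    by (simp add: MS.limit_metric_sequentially)
  then have "(\<lambda>k. v (X k - l)) \<longlonglongrightarrow> 0"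
    using nonneg by (simp add: lim_sequentially dist_real_def)
  then show ?thesis by blast
qed

text \<open>The Gauss norm: the value on \<open>F\<close> of the Berkovich point attached to the
  closed disc of radius \<open>r\<close> around 0.\<close>

definition gauss :: "real \<Rightarrow> 'a poly \<Rightarrow> real" where
  "gauss r F = Max ((\<lambda>i. v (coeff F i) * r ^ i) ` {..degree F})"

lemma gauss_ge: "r \<ge> 0 \<Longrightarrow> v (coeff F i) * r ^ i \<le> gauss r F"
proof (cases "i \<le> degree F")
  case False
  assume r: "r \<ge> 0"
  have "v (coeff F i) * r ^ i = 0" using False by (simp add: coeff_eq_0)
  also have "0 \<le> v (coeff F 0) * r ^ 0" by (simp add: nonneg)
  also have "\<dots> \<le> gauss r F"
    unfolding gauss_def by (rule Max_ge) (auto intro!: image_eqI[of _ _ 0])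
  finally show ?thesis .
qed (auto simp: gauss_def)

lemma gauss_le: "(\<And>i. v (coeff F i) * r ^ i \<le> B) \<Longrightarrow> gauss r F \<le> B"
  by (auto simp: gauss_def)

lemma gauss_nonneg: "r \<ge> 0 \<Longrightarrow> 0 \<le> gauss r F"
  using gauss_ge[of r F 0] nonneg[of "coeff F 0"] by simp

lemma gauss_attained: obtains i where "gauss r F = v (coeff F i) * r ^ i"
proof -
  have "gauss r F \<in> (\<lambda>i. v (coeff F i) * r ^ i) ` {..degree F}"
    unfolding gauss_def by (rule Max_in) auto
  then show ?thesis using that by auto
qed

lemma gauss_add:
  assumes r: "r \<ge> 0"
  shows "gauss r (F + G) \<le> max (gauss r F) (gauss r G)"
proof (rule gauss_le)
  fix i
  have "v (coeff (F + G) i) * r ^ i \<le> max (v (coeff F i)) (v (coeff G i)) * r ^ i"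
    using r by (intro mult_right_mono) (auto simp: ultrametric)
  also have "\<dots> = max (v (coeff F i) * r ^ i) (v (coeff G i) * r ^ i)"
    using r by (simp add: max_mult_distrib_right)
  also have "\<dots> \<le> max (gauss r F) (gauss r G)"
    using gauss_ge[OF r] by (intro max.mono) auto
  finally show "v (coeff (F + G) i) * r ^ i \<le> max (gauss r F) (gauss r G)" .
qed

lemma gauss_minus [simp]: "gauss r (- F) = gauss r F"
  by (simp add: gauss_def)

lemma gauss_diff: "r \<ge> 0 \<Longrightarrow> gauss r (F - G) \<le> max (gauss r F) (gauss r G)"
  using gauss_add[of r F "- G"] by simp

lemma gauss_isosceles:
  assumes r: "r \<ge> 0" and lt: "gauss r F < gauss r G"
  shows "gauss r (F - G) = gauss r G" "gauss r (G - F) = gauss r G"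
proof -
  have "gauss r G \<le> max (gauss r F) (gauss r (G - F))"
    using gauss_add[OF r, of F "G - F"] by simp
  then show "gauss r (G - F) = gauss r G"
    using gauss_diff[OF r, of G F] lt by linarith
  then show "gauss r (F - G) = gauss r G"
    using gauss_minus[of r "G - F"] by simp
qed

lemma gauss_smult:
  assumes r: "r \<ge> 0"
  shows "gauss r (smult c F) = v c * gauss r F"
proof (rule antisym)
  show "gauss r (smult c F) \<le> v c * gauss r F"
    using gauss_ge[OF r, of F] by (intro gauss_le) (simp add: mult mult.assoc mult_left_mono nonneg)
  obtain i where "gauss r F = v (coeff F i) * r ^ i" by (rule gauss_attained)
  then show "v c * gauss r F \<le> gauss r (smult c F)"
    using gauss_ge[OF r, of "smult c F" i] by (simp add: mult mult_ac)
qed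

lemma gauss_pCons_0:
  assumes r: "r \<ge> 0"
  shows "gauss r (pCons 0 F) = r * gauss r F"
proof (rule antisym)
  show "gauss r (pCons 0 F) \<le> r * gauss r F"
  proof (rule gauss_le)
    fix i
    show "v (coeff (pCons 0 F) i) * r ^ i \<le> r * gauss r F"
    proof (cases i)
      case (Suc j)
      then show ?thesis using mult_left_mono[OF gauss_ge[OF r, of F j] r] by (simp add: mult_ac)
    qed (use r gauss_nonneg in auto)
  qed
  obtain i where "gauss r F = v (coeff F i) * r ^ i" by (rule gauss_attained)
  then show "r * gauss r F \<le> gauss r (pCons 0 F)"
    using gauss_ge[OF r, of "pCons 0 F" "Suc i"] by (simp add: mult_ac)
qed

lemma gauss_pCons_ge:
  assumes r: "r \<ge> 0"
  shows "r * gauss r F \<le> gauss r (pCons c F)" "v c \<le> gauss r (pCons c F)"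
proof -
  obtain i where "gauss r F = v (coeff F i) * r ^ i" by (rule gauss_attained)
  then show "r * gauss r F \<le> gauss r (pCons c F)"
    using gauss_ge[OF r, of "pCons c F" "Suc i"] by (simp add: mult_ac)
  show "v c \<le> gauss r (pCons c F)" using gauss_ge[OF r, of "pCons c F" 0] by simp
qed

lemma gauss_monom_mult:
  assumes r: "r \<ge> 0"
  shows "gauss r (monom 1 n * F) = r ^ n * gauss r F"
proof (induction n)
  case 0
  then show ?case by (simp add: monom_0 pCons_one)
next
  case (Suc n)
  have "monom 1 (Suc n) * F = pCons 0 (monom 1 n * F)" by (simp add: monom_Suc)
  then show ?case using Suc gauss_pCons_0[OF r] by simp
qed

lemma gauss_monom: "r \<ge> 0 \<Longrightarrow> gauss r (monom c n) = v c * r ^ n"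
  using gauss_monom_mult[of r n "[:c:]"] by (simp add: smult_monom gauss_def)

lemma gauss_mono:
  assumes "0 \<le> r" "r \<le> r'"
  shows "gauss r F \<le> gauss r' F"
proof (rule gauss_le)
  fix i
  have "v (coeff F i) * r ^ i \<le> v (coeff F i) * r' ^ i"
    using assms by (intro mult_left_mono power_mono nonneg) auto
  also have "\<dots> \<le> gauss r' F" using assms by (intro gauss_ge) auto
  finally show "v (coeff F i) * r ^ i \<le> gauss r' F" .
qed

text \<open>The price of passing to a slightly larger radius; it disappears when \<open>t\<close>
  tends to 1 in \<open>radius_expansion\<close>.\<close>

lemma gauss_scale_le:
  assumes "0 \<le> r" "r \<le> r'" "r' \<le> t * r" "t \<ge> 1"
  shows "gauss r' F \<le> t ^ degree F * gauss r F"
proof (rule gauss_le)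
  fix i
  show "v (coeff F i) * r' ^ i \<le> t ^ degree F * gauss r F"
  proof (cases "i \<le> degree F")
    case True
    have "v (coeff F i) * r' ^ i \<le> v (coeff F i) * (t * r) ^ i"
      using assms by (intro mult_left_mono power_mono nonneg) auto
    also have "\<dots> = t ^ i * (v (coeff F i) * r ^ i)" by (simp add: power_mult_distrib)
    also have "\<dots> \<le> t ^ degree F * gauss r F"
      using assms True by (intro mult_mono gauss_ge power_increasing mult_nonneg_nonneg nonneg) auto
    finally show ?thesis .
  next
    case False
    then show ?thesis using assms gauss_nonneg[of r F] by (simp add: coeff_eq_0)
  qed
qed

section \<open>Root counts and logarithmic derivatives on a circle\<close>

definition root_size :: "real \<Rightarrow> 'a multiset \<Rightarrow> real" where
  "root_size r A = (\<Prod>z\<in>#A. max (v z) r)"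

lemma root_size_simps [simp]:
  "root_size r {#} = 1" "root_size r (add_mset z A) = max (v z) r * root_size r A"
  by (simp_all add: root_size_def)

lemma root_size_pos: "r > 0 \<Longrightarrow> root_size r A > 0"
  by (induction A) auto

lemma linear_mult_eq: "[:- z, 1:] * F = pCons 0 F - smult z F" for F :: "'a poly"
  by simp

text \<open>With the root off the circle, the two terms in \<open>linear_mult_eq\<close> have
  different Gauss norms (for nonzero \<open>F\<close>), and the larger one decides. This is why
  radii are chosen off the roots later on.\<close>

lemma gauss_linear:
  assumes r: "r > 0" and z: "v z \<noteq> r"
  shows "gauss r ([:- z, 1:] * F) = max (v z) r * gauss r F"
proof (cases "F = 0")
  case True
  then show ?thesis by (simp add: gauss_def)
next
  case False
  have pos: "gauss r F > 0"
  proof -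
    have "0 < v (lead_coeff F) * r ^ degree F" using r False v_pos[of "lead_coeff F"] by simp
    also have "\<dots> \<le> gauss r F" using r by (intro gauss_ge) auto
    finally show ?thesis .
  qed
  have 1: "gauss r (pCons 0 F) = r * gauss r F" "gauss r (smult z F) = v z * gauss r F"
    using gauss_pCons_0 gauss_smult r by auto
  show ?thesis
  proof (cases "v z < r")
    case True
    then have "gauss r (smult z F) < gauss r (pCons 0 F)" using 1 pos by simp
    then show ?thesis
      unfolding linear_mult_eq using gauss_isosceles(2)[of r "smult z F" "pCons 0 F"] r True 1 by simp
  next
    case False
    then have "gauss r (pCons 0 F) < gauss r (smult z F)" using 1 pos z by simp
    then show ?thesis
      unfolding linear_mult_eq using gauss_isosceles(1)[of r "pCons 0 F" "smult z F"] r False 1 by simp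
  qed
qed

text \<open>The half that survives when the root lies on the circle. It serves for the roots of the
  Wronskian in \<open>radius_expansion\<close>, where the radius is dictated by the
  seminorm.\<close>

lemma gauss_linear_le:
  assumes r: "r \<ge> 0"
  shows "gauss r ([:- z, 1:] * F) \<le> max (v z) r * gauss r F"
proof -
  have "gauss r (pCons 0 F - smult z F) \<le> max (r * gauss r F) (v z * gauss r F)"
    using gauss_diff[OF r, of "pCons 0 F" "smult z F"] gauss_pCons_0[OF r] gauss_smult[OF r] by simp
  also have "\<dots> = max (v z) r * gauss r F"
    using gauss_nonneg[OF r, of F] by (simp add: max_mult_distrib_right max.commute)
  finally show ?thesis unfolding linear_mult_eq .
qed

lemma gauss_linear_prod:
  assumes r: "r > 0" and A: "\<And>z. z \<in># A \<Longrightarrow> v z \<noteq> r"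
  shows "gauss r (linear_prod A * F) = root_size r A * gauss r F"
  using A
proof (induction A)
  case (add z A)
  then show ?case
    using gauss_linear[OF r, of z "linear_prod A * F"] by (simp only: linear_prod_simps root_size_simps mult.assoc) simp
qed simp

lemma gauss_one [simp]: "gauss r 1 = 1"
  by (simp add: gauss_def)

lemma gauss_linear_prod_le:
  assumes r: "r \<ge> 0"
  shows "gauss r (linear_prod A) \<le> root_size r A"
proof (induction A)
  case (add z A)
  have "gauss r ([:- z, 1:] * linear_prod A) \<le> max (v z) r * gauss r (linear_prod A)"
    by (rule gauss_linear_le[OF r])
  also have "\<dots> \<le> max (v z) r * root_size r A"
    using add r by (intro mult_left_mono) auto
  finally show ?case by (simp only: linear_prod_simps root_size_simps)
qed simp

definition inner_count :: "real \<Rightarrow> 'a multiset \<Rightarrow> nat" where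
  "inner_count r A = size (filter_mset (\<lambda>z. v z < r) A)"

text \<open>A Newton polygon statement: the maximum in the Gauss norm is attained at the index that
  counts the roots inside the circle. A new factor shifts the dominant index by one or keeps it, and
  in either case one of the two contributions to the coefficient strictly dominates.\<close>

lemma coeff_inner_count:
  assumes r: "r > 0" and A: "\<And>z. z \<in># A \<Longrightarrow> v z \<noteq> r"
  shows "v (coeff (linear_prod A) (inner_count r A)) * r ^ inner_count r A = root_size r A"
  using A
proof (induction A)
  case empty
  then show ?case by (simp add: inner_count_def)
next
  case (add z A)
  define k where "k = inner_count r A"
  define G where "G = linear_prod A"
  have IH: "v (coeff G k) * r ^ k = root_size r A" using add by (simp add: k_def G_def)
  have le: "v (coeff G i) * r ^ i \<le> root_size r A" for i
    using gauss_ge[of r G i] gauss_linear_prod[OF r, of A 1] add r by (simp add: G_def)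
  have pos: "root_size r A > 0" using root_size_pos[OF r] .
  have eq: "linear_prod (add_mset z A) = pCons 0 G - smult z G"
    by (simp add: G_def)
  show ?case
  proof (cases "v z < r")
    case True
    then have k: "inner_count r (add_mset z A) = Suc k" by (simp add: inner_count_def k_def)
    have c: "coeff (linear_prod (add_mset z A)) (Suc k) = coeff G k - z * coeff G (Suc k)"
      unfolding eq by simp
    have "v (z * coeff G (Suc k)) * r ^ Suc k \<le> v z * root_size r A"
      using mult_left_mono[OF le[of "Suc k"] nonneg[of z]] by (simp add: mult mult_ac)
    also have "\<dots> < r * root_size r A" using True pos by simp
    also have "\<dots> = v (coeff G k) * r ^ Suc k" using IH by (simp add: mult_ac)
    finally have "v (- (z * coeff G (Suc k))) < v (coeff G k)" using r by (simp only: v_minus mult_less_cancel_right_pos zero_less_power)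
    from v_isosceles[OF this] have "v (coeff G k - z * coeff G (Suc k)) = v (coeff G k)" by simp
    then show ?thesis unfolding k c using IH True by (simp add: mult_ac)
  next
    case False
    then have k: "inner_count r (add_mset z A) = k" by (simp add: inner_count_def k_def)
    have zr: "v z > r" using False add.prems[of z] by simp
    show ?thesis
    proof (cases k)
      case 0
      have "coeff (linear_prod (add_mset z A)) k = - (z * coeff G k)"
        unfolding eq by (simp add: 0)
      then show ?thesis unfolding k using IH zr 0 by (simp add: mult G_def)
    next
      case (Suc j)
      have c: "coeff (linear_prod (add_mset z A)) k = coeff G j + (- (z * coeff G k))"
        unfolding eq by (simp add: Suc)
      have "v (coeff G j) * r ^ k \<le> r * root_size r A"
        using mult_left_mono[OF le[of j], of r] r by (simp add: Suc mult_ac)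
      also have "\<dots> < v z * root_size r A" using zr pos by simp
      also have "\<dots> = v (- (z * coeff G k)) * r ^ k" using IH by (simp add: mult mult_ac)
      finally have "v (coeff G j) < v (- (z * coeff G k))" using r by (simp only: mult_less_cancel_right_pos zero_less_power)
      from v_isosceles[OF this] have "v (coeff G j + (- (z * coeff G k))) = v z * v (coeff G k)"
        by (simp add: mult)
      then show ?thesis unfolding k c using IH zr by (simp add: mult_ac)
    qed
  qed
qed

text \<open>
  The Laurent expansion of the logarithmic derivative on the circle of radius \<open>r\<close>, truncated and
  multiplied by a power of the variable; its residue is the number of roots inside the circle.
\<close>

lemma log_derivative_linear:
  assumes r: "r > 0" and z: "v z \<noteq> r" and e: "\<epsilon> > 0"
  shows "\<exists>N0. \<forall>N\<ge>N0. \<exists>E. gauss r (monom 1 (Suc N) - E * [:- z, 1:]) \<le> \<epsilon> * r ^ N * max (v z) r \<and>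
           coeff E N = (if v z < r then 1 else 0)"
proof (cases "v z < r")
  case True
  have "(\<lambda>n. (v z / r) ^ n) \<longlonglongrightarrow> 0"
    using True r nonneg[of z] by (intro LIMSEQ_power_zero) auto
  from order_tendstoD(2)[OF this e] obtain N0 where N0: "\<And>n. n \<ge> N0 \<Longrightarrow> (v z / r) ^ n < \<epsilon>"
    unfolding eventually_sequentially by blast
  \<comment> \<open>Geometric sum: \<open>X^(N+1) - z^(N+1)\<close> is divisible by
    \<open>X - z\<close>, with monic quotient \<open>E\<close> of degree \<open>N\<close>. After
    multiplication by \<open>X^(N+1)\<close> the residue, i.e. the coefficient of
    \<open>X^(-1)\<close>, sits at index \<open>N\<close>.\<close>
  have "\<exists>E. monom 1 (Suc N) - E * [:- z, 1:] = [:z ^ Suc N:] \<and> coeff E N = 1" for N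
  proof (induction N)
    case 0
    then show ?case by (intro exI[of _ 1]) (simp add: monom_Suc monom_0)
  next
    case (Suc N)
    then obtain E where E: "monom 1 (Suc N) - E * [:- z, 1:] = [:z ^ Suc N:]" "coeff E N = 1" by blast
    have "monom (1::'a) (Suc (Suc N)) = [:0, 1:] * monom 1 (Suc N)"
      by (simp add: monom_Suc)
    also have "monom 1 (Suc N) = E * [:- z, 1:] + [:z ^ Suc N:]" using E(1) by (simp add: diff_eq_eq)
    finally have "monom 1 (Suc (Suc N)) - ([:0, 1:] * E + [:z ^ Suc N:]) * [:- z, 1:] = [:z ^ Suc (Suc N):]"
      by (simp add: algebra_simps smult_add_right)
    moreover have "coeff ([:0, 1:] * E + [:z ^ Suc N:]) (Suc N) = 1" using E(2) by simp
    ultimately show ?case by blast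
  qed
  then obtain E where E: "\<And>N. monom 1 (Suc N) - E N * [:- z, 1:] = [:z ^ Suc N:] \<and> coeff (E N) N = 1"
    by metis
  have "gauss r (monom 1 (Suc N) - E N * [:- z, 1:]) \<le> \<epsilon> * r ^ N * max (v z) r" if "N \<ge> N0" for N
  proof -
    have "gauss r (monom 1 (Suc N) - E N * [:- z, 1:]) = v z ^ Suc N"
      using E[of N] by (simp add: gauss_def v_power mult)
    also have "\<dots> = (v z / r) ^ Suc N * r ^ Suc N" using r by (simp add: power_divide)
    also have "\<dots> \<le> \<epsilon> * r ^ Suc N"
      using N0[of "Suc N"] that r by (intro mult_right_mono) auto
    finally show ?thesis using True by (simp add: mult_ac)
  qed
  then have "\<exists>E. gauss r (monom 1 (Suc N) - E * [:- z, 1:]) \<le> \<epsilon> * r ^ N * max (v z) r \<and> coeff E N = 1"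
    if "N \<ge> N0" for N
    using E[of N] that by blast
  then show ?thesis unfolding if_P[OF True] by blast
next
  case False
  with z have zr: "r < v z" by simp
  then have z0: "z \<noteq> 0" using r by auto
  have "(\<lambda>n. (r / v z) ^ n) \<longlonglongrightarrow> 0"
    using zr r by (intro LIMSEQ_power_zero) auto
  from order_tendstoD(2)[OF this e] obtain K where K: "(r / v z) ^ K < \<epsilon>"
    unfolding eventually_sequentially by blast
  \<comment> \<open>For a root outside the circle the expansion goes in powers of
    \<open>X / z\<close>. It starts at index \<open>N + 1\<close>, so there is no residue, and the
    number \<open>K\<close> of terms can be chosen independently of \<open>N\<close>.\<close>
  have "\<exists>E. monom 1 (Suc N) - E * [:- z, 1:] = monom (1 / z ^ k) (Suc (N + k)) \<and> coeff E N = 0" for N k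
  proof (induction k)
    case 0
    then show ?case by (intro exI[of _ 0]) simp
  next
    case (Suc k)
    then obtain E where E: "monom 1 (Suc N) - E * [:- z, 1:] = monom (1 / z ^ k) (Suc (N + k))" "coeff E N = 0" by blast
    define E' where "E' = E - monom (1 / z ^ Suc k) (Suc (N + k))"
    have "monom (1 / z ^ Suc k) (Suc (N + k)) * [:- z, 1:] =
        monom (1 / z ^ Suc k) (Suc (N + Suc k)) - monom (1 / z ^ k) (Suc (N + k))"
      using z0 by (simp add: monom_Suc smult_monom minus_monom mult.commute[of _ "[:- z, 1:]"])
    then have "monom 1 (Suc N) - E' * [:- z, 1:] = monom (1 / z ^ Suc k) (Suc (N + Suc k))"
      unfolding E'_def left_diff_distrib using E(1) by (simp add: algebra_simps del: mult_pCons_right)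
    moreover have "coeff E' N = 0" using E(2) by (simp add: E'_def)
    ultimately show ?case by blast
  qed
  then have "\<forall>N. \<exists>E. monom 1 (Suc N) - E * [:- z, 1:] = monom (1 / z ^ K) (Suc (N + K)) \<and> coeff E N = 0"
    by blast
  from choice[OF this] obtain E
    where E: "\<And>N. monom 1 (Suc N) - E N * [:- z, 1:] = monom (1 / z ^ K) (Suc (N + K)) \<and> coeff (E N) N = 0"
    by blast
  have "gauss r (monom 1 (Suc N) - E N * [:- z, 1:]) \<le> \<epsilon> * r ^ N * max (v z) r" for N
  proof -
    have "gauss r (monom 1 (Suc N) - E N * [:- z, 1:]) = (1 / v z ^ K) * r ^ Suc (N + K)"
      using E[of N] r by (simp only: gauss_monom less_imp_le) (simp add: v_divide v_power)
    also have "\<dots> = (r / v z) ^ K * r ^ Suc N" by (simp add: power_add power_divide mult_ac)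
    also have "\<dots> \<le> \<epsilon> * (r ^ N * v z)"
      using K r zr e by (intro mult_mono) (auto simp: mult_ac)
    finally show ?thesis using zr by (simp add: mult_ac)
  qed
  then have "\<exists>E. gauss r (monom 1 (Suc N) - E * [:- z, 1:]) \<le> \<epsilon> * r ^ N * max (v z) r \<and> coeff E N = 0" for N
    using E[of N] by blast
  then show ?thesis unfolding if_not_P[OF False] by blast
qed

text \<open>Logarithmic derivatives add up over the factors, and so do their residues. The errors do
  not accumulate because the Gauss norm is ultrametric: one \<epsilon> serves any number of
  factors.\<close>

lemma log_derivative_linear_prod:
  assumes r: "r > 0" and e: "\<epsilon> > 0" and A: "\<And>z. z \<in># A \<Longrightarrow> v z \<noteq> r"
  shows "\<exists>N0. \<forall>N\<ge>N0. \<exists>E.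
           gauss r (monom 1 (Suc N) * pderiv (linear_prod A) - E * linear_prod A) \<le> \<epsilon> * r ^ N * root_size r A \<and>
           coeff E N = of_nat (inner_count r A)"
  using A
proof (induction A)
  case empty
  show ?case using r e by (intro exI[of _ 0] allI impI exI[of _ 0]) (auto simp: gauss_def inner_count_def)
next
  case (add z A)
  then have A: "\<And>z. z \<in># A \<Longrightarrow> v z \<noteq> r" and z: "v z \<noteq> r" by auto
  let ?l = "[:- z, 1:]"
  from add obtain N1 where N1: "\<And>N. N \<ge> N1 \<Longrightarrow> \<exists>E.
      gauss r (monom 1 (Suc N) * pderiv (linear_prod A) - E * linear_prod A) \<le> \<epsilon> * r ^ N * root_size r A \<and>
      coeff E N = of_nat (inner_count r A)" by auto
  obtain N2 where N2: "\<And>N. N \<ge> N2 \<Longrightarrow> \<exists>E. gauss r (monom 1 (Suc N) - E * ?l) \<le> \<epsilon> * r ^ N * max (v z) r \<and>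
      coeff E N = (if v z < r then 1 else 0)"
    using log_derivative_linear[OF r z e] by blast
  show ?case
  proof (intro exI[of _ "max N1 N2"] allI impI)
    fix N assume N: "max N1 N2 \<le> N"
    from N N1 obtain E1 where E1:
      "gauss r (monom 1 (Suc N) * pderiv (linear_prod A) - E1 * linear_prod A) \<le> \<epsilon> * r ^ N * root_size r A"
      "coeff E1 N = of_nat (inner_count r A)" by fastforce
    from N N2 obtain E2 where E2: "gauss r (monom 1 (Suc N) - E2 * ?l) \<le> \<epsilon> * r ^ N * max (v z) r"
      "coeff E2 N = (if v z < r then 1 else 0)" by fastforce
    define G where "G = linear_prod A"
    have "pderiv (linear_prod (add_mset z A)) = ?l * pderiv G + G"
      by (simp only: linear_prod_simps pderiv_mult G_def) (simp add: pderiv_pCons)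
    then have eq: "monom 1 (Suc N) * pderiv (linear_prod (add_mset z A)) - (E1 + E2) * linear_prod (add_mset z A)
        = ?l * (monom 1 (Suc N) * pderiv G - E1 * G) + G * (monom 1 (Suc N) - E2 * ?l)" (is "?L = ?R1 + ?R2")
    proof -
      have "m * (l * G' + G) - (E1 + E2) * (l * G) = l * (m * G' - E1 * G) + G * (m - E2 * l)"
        for m l G' G :: "'a poly"
        by (simp add: algebra_simps)
      then show ?thesis using \<open>pderiv _ = _\<close> unfolding linear_prod_simps G_def[symmetric] by (simp only:)
    qed
    have "gauss r ?R1 = max (v z) r * gauss r (monom 1 (Suc N) * pderiv G - E1 * G)"
      by (rule gauss_linear[OF r z])
    also have "\<dots> \<le> max (v z) r * (\<epsilon> * r ^ N * root_size r A)"
      using E1 r by (intro mult_left_mono) (auto simp: G_def)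
    finally have 1: "gauss r ?R1 \<le> \<epsilon> * r ^ N * root_size r (add_mset z A)"
      unfolding root_size_simps by (simp only: mult_ac)
    have "gauss r ?R2 = root_size r A * gauss r (monom 1 (Suc N) - E2 * ?l)"
      unfolding G_def by (rule gauss_linear_prod[OF r A])
    also have "\<dots> \<le> root_size r A * (\<epsilon> * r ^ N * max (v z) r)"
      using E2 root_size_pos[OF r, of A] by (intro mult_left_mono) auto
    finally have 2: "gauss r ?R2 \<le> \<epsilon> * r ^ N * root_size r (add_mset z A)"
      unfolding root_size_simps by (simp only: mult_ac)
    have "gauss r ?L \<le> \<epsilon> * r ^ N * root_size r (add_mset z A)"
      unfolding eq using gauss_add[of r ?R1 ?R2] 1 2 r by linarith
    moreover have "coeff (E1 + E2) N = of_nat (inner_count r (add_mset z A))"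
      using E1(2) E2(2) by (simp add: inner_count_def)
    ultimately show "\<exists>E. gauss r (monom 1 (Suc N) * pderiv (linear_prod (add_mset z A)) - E * linear_prod (add_mset z A))
        \<le> \<epsilon> * r ^ N * root_size r (add_mset z A) \<and> coeff E N = of_nat (inner_count r (add_mset z A))"
      by blast
  qed
qed


text \<open>
  The Wronskian is unchanged when a multiple of \<open>Q\<close> is subtracted from \<open>P\<close>. The choice of \<open>b\<close> makes \<open>P - b Q\<close>
  and \<open>Q\<close> have different numbers of roots in the disc, so that the logarithmic derivative of their
  quotient has a nonzero residue.
\<close>

lemma gauss_wronskian_ge:
  fixes P Q :: "'a poly"
  assumes W: "pderiv P * Q - P * pderiv Q \<noteq> 0"
    and deg: "degree P \<le> d" "degree Q \<le> d"
    and c: "\<And>l. 1 \<le> l \<Longrightarrow> l \<le> d \<Longrightarrow> c \<le> v (of_nat l)"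
    and r01: "0 < r0" "r0 < r1"
  shows "\<exists>r b. r0 < r \<and> r < r1 \<and>
    c * gauss r (P - smult b Q) * gauss r Q \<le> gauss r (pderiv P * Q - P * pderiv Q) * r"
proof -
  have "Q \<noteq> 0" using W by auto
  then obtain A where A: "size A = degree Q" "Q = smult (lead_coeff Q) (linear_prod A)"
    by (rule linear_prod_factorization)
  define q where "q = lead_coeff Q"
  have q: "q \<noteq> 0" "Q = smult q (linear_prod A)" using \<open>Q \<noteq> 0\<close> A by (auto simp: q_def)
  \<comment> \<open>\<open>r2\<close> is the next size of a root of \<open>Q\<close> beyond
    \<open>r0\<close>, capped at \<open>r1\<close>. No root of \<open>Q\<close> has size strictly
    between \<open>r0\<close> and \<open>r2\<close>, so the root count \<open>j\<close> is known
    before \<open>r\<close> is chosen.\<close>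
  define S where "S = insert r1 {x \<in> v ` set_mset A. r0 < x}"
  have S: "finite S" "S \<noteq> {}" by (auto simp: S_def)
  define r2 where "r2 = Min S"
  have r2: "r0 < r2" "r2 \<le> r1"
    using r01 S by (auto simp: r2_def S_def)
  have noA: "v z \<le> r0 \<or> r2 \<le> v z" if "z \<in># A" for z
  proof (cases "v z \<le> r0")
    case False
    then have "v z \<in> S" using that by (auto simp: S_def)
    then show ?thesis using S by (simp add: r2_def)
  qed simp
  define j where "j = size (filter_mset (\<lambda>z. v z \<le> r0) A)"
  have inA: "v z \<noteq> r" "v z < r \<longleftrightarrow> v z \<le> r0" if "z \<in># A" "r0 < r" "r < r2" for r z
    using noA[OF that(1)] that by auto
  have jA: "inner_count r A = j" if "r0 < r" "r < r2" for r
    unfolding inner_count_def j_def using inA(2)[OF _ that]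
    by (intro arg_cong[where f=size] filter_mset_cong) auto
  obtain ra where ra: "r0 < ra" "ra < r2" using dense r2(1) by blast
  have "coeff (linear_prod A) j \<noteq> 0"
    using coeff_inner_count[of ra A] inA(1) jA[OF ra] root_size_pos[of ra A] ra r01 by fastforce
  then have Qj: "coeff Q j \<noteq> 0" using q by simp
  \<comment> \<open>Cancels the coefficient of index \<open>j\<close> in \<open>P - b Q\<close>. By
    \<open>coeff_inner_count\<close> this polynomial then cannot have exactly \<open>j\<close> roots
    inside a circle that avoids its roots.\<close>
  define b where "b = coeff P j / coeff Q j"
  define F where "F = P - smult b Q"
  have WF: "pderiv P * Q - P * pderiv Q = pderiv F * Q - F * pderiv Q"
    by (simp add: F_def pderiv_diff pderiv_smult algebra_simps)
  then have "F \<noteq> 0" using W by auto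
  then obtain B where B: "size B = degree F" "F = smult (lead_coeff F) (linear_prod B)"
    by (rule linear_prod_factorization)
  define f where "f = lead_coeff F"
  have f: "f \<noteq> 0" "F = smult f (linear_prod B)" using \<open>F \<noteq> 0\<close> B by (auto simp: f_def)
  \<comment> \<open>The roots of \<open>F\<close> depend on \<open>b\<close>, so \<open>r\<close> is
    chosen only now, off their finitely many sizes.\<close>
  have "infinite ({r0<..<r2} - v ` set_mset B)"
    using r2(1) by (intro Diff_infinite_finite) auto
  then obtain r where r: "r0 < r" "r < r2" "r \<notin> v ` set_mset B"
    by (metis Diff_iff equals0I finite.emptyI greaterThanLessThan_iff)
  have rpos: "r > 0" using r r01 by simp
  have Br: "v z \<noteq> r" if "z \<in># B" for z using r(3) that by auto
  have Ar: "v z \<noteq> r" if "z \<in># A" for z using inA(1)[OF that r(1,2)] .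
  define k where "k = inner_count r B"
  have "coeff (linear_prod B) k \<noteq> 0"
    using coeff_inner_count[OF rpos Br] root_size_pos[OF rpos, of B] unfolding k_def by fastforce
  moreover have "coeff F j = 0" using Qj by (simp add: F_def b_def)
  ultimately have kj: "k \<noteq> j" using f by auto
  have "k \<le> degree F" unfolding k_def inner_count_def B(1)[symmetric] by (rule size_filter_mset_lesseq)
  also have "degree F \<le> d" unfolding F_def using deg by (intro degree_diff_le) auto
  finally have kd: "k \<le> d" .
  have "j \<le> degree Q" unfolding j_def A(1)[symmetric] by (rule size_filter_mset_lesseq)
  then have jd: "j \<le> d" using deg by simp
  \<comment> \<open>Both counts lie between 0 and \<open>d\<close> and they differ, so up to sign
    \<open>k - j\<close> is one of the integers in the hypothesis on \<open>c\<close>.\<close>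
  define \<eta> where "\<eta> = v (of_nat k - of_nat j)"
  have c\<eta>: "c \<le> \<eta>"
  proof (cases "j < k")
    case True
    then show ?thesis using c[of "k - j"] kd by (simp add: \<eta>_def of_nat_diff)
  next
    case False
    then show ?thesis using c[of "j - k"] jd kj v_minus_commute[of "of_nat k" "of_nat j"] by (simp add: \<eta>_def of_nat_diff)
  qed
  define a where "a = linear_prod A"
  define h where "h = linear_prod B"
  define w where "w = pderiv h * a - h * pderiv a"
  have Ww: "pderiv P * Q - P * pderiv Q = smult (f * q) w"
    unfolding WF unfolding q(2) f(2) w_def a_def h_def
    by (simp add: pderiv_smult algebra_simps smult_diff_right)
  have gF: "gauss r F = v f * root_size r B"
    using f(2) gauss_smult[of r f h] gauss_linear_prod[OF rpos Br, where F=1] rpos by (simp add: h_def)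
  have gQ: "gauss r Q = v q * root_size r A"
    using q(2) gauss_smult[of r q a] gauss_linear_prod[OF rpos Ar, where F=1] rpos by (simp add: a_def)
  have gW: "gauss r (pderiv P * Q - P * pderiv Q) = v f * v q * gauss r w"
    unfolding Ww using gauss_smult[of r] rpos by (simp add: mult)
  let ?M = "root_size r A * root_size r B"
  have M: "?M > 0" using root_size_pos[OF rpos] by simp
  have key: "\<eta> * ?M \<le> r * gauss r w"
  proof (cases "\<eta> = 0")
    \<comment> \<open>\<open>k - j\<close> may vanish in the field, in positive
      characteristic.\<close>
    case True
    then show ?thesis using gauss_nonneg[of r w] rpos by simp
  next
    case False
    then have \<eta>: "\<eta> > 0" using nonneg[of "of_nat k - of_nat j"] unfolding \<eta>_def by linarith
    \<comment> \<open>Half the norm of the residue: the truncation error has to be strictly smaller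
      than the term of index \<open>N\<close>.\<close>
    then have e: "\<eta> / 2 > 0" by simp
    obtain N1 where N1: "\<And>N. N \<ge> N1 \<Longrightarrow> \<exists>E. gauss r (monom 1 (Suc N) * pderiv a - E * a) \<le> \<eta> / 2 * r ^ N * root_size r A \<and>
           coeff E N = of_nat (inner_count r A)"
      unfolding a_def using log_derivative_linear_prod[OF rpos e Ar] by blast
    obtain N2 where N2: "\<And>N. N \<ge> N2 \<Longrightarrow> \<exists>E. gauss r (monom 1 (Suc N) * pderiv h - E * h) \<le> \<eta> / 2 * r ^ N * root_size r B \<and>
           coeff E N = of_nat (inner_count r B)"
      unfolding h_def using log_derivative_linear_prod[OF rpos e Br] by blast
    define N where "N = max N1 N2"
    obtain E1 where E1: "gauss r (monom 1 (Suc N) * pderiv a - E1 * a) \<le> \<eta> / 2 * r ^ N * root_size r A"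
      "coeff E1 N = of_nat j" using N1[of N] jA[OF r(1,2)] by (auto simp: N_def)
    obtain E2 where E2: "gauss r (monom 1 (Suc N) * pderiv h - E2 * h) \<le> \<eta> / 2 * r ^ N * root_size r B"
      "coeff E2 N = of_nat k" using N2[of N] by (auto simp: N_def k_def)
    let ?X = "monom (1::'a) (Suc N)"
    \<comment> \<open>\<open>E\<close> approximates \<open>X^(N+1)\<close> times
      \<open>w / (a h)\<close>, the logarithmic derivative of \<open>h / a\<close>; its coefficient
      of index \<open>N\<close> is the residue \<open>k - j\<close>.\<close>
    define E where "E = E2 - E1"
    have "gauss r (?X * w - a * (h * E)) = gauss r (a * (?X * pderiv h - E2 * h) - h * (?X * pderiv a - E1 * a))"
      by (rule arg_cong[where f="gauss r"]) (simp add: w_def E_def algebra_simps)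
    also have "\<dots> \<le> max (gauss r (a * (?X * pderiv h - E2 * h))) (gauss r (h * (?X * pderiv a - E1 * a)))"
      using rpos by (intro gauss_diff) auto
    also have "\<dots> \<le> \<eta> / 2 * r ^ N * ?M"
    proof (rule max.boundedI)
      have "gauss r (a * (?X * pderiv h - E2 * h)) = root_size r A * gauss r (?X * pderiv h - E2 * h)"
        unfolding a_def by (rule gauss_linear_prod[OF rpos Ar])
      also have "\<dots> \<le> root_size r A * (\<eta> / 2 * r ^ N * root_size r B)"
        using E2(1) root_size_pos[OF rpos, of A] by (intro mult_left_mono) auto
      finally show "gauss r (a * (?X * pderiv h - E2 * h)) \<le> \<eta> / 2 * r ^ N * ?M" by (simp add: mult_ac)
      have "gauss r (h * (?X * pderiv a - E1 * a)) = root_size r B * gauss r (?X * pderiv a - E1 * a)"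
        unfolding h_def by (rule gauss_linear_prod[OF rpos Br])
      also have "\<dots> \<le> root_size r B * (\<eta> / 2 * r ^ N * root_size r A)"
        using E1(1) root_size_pos[OF rpos, of B] by (intro mult_left_mono) auto
      finally show "gauss r (h * (?X * pderiv a - E1 * a)) \<le> \<eta> / 2 * r ^ N * ?M" by (simp add: mult_ac)
    qed
    finally have small: "gauss r (?X * w - a * (h * E)) \<le> \<eta> / 2 * r ^ N * ?M" .
    have "\<eta> * r ^ N \<le> gauss r E"
      using gauss_ge[of r E N] E1(2) E2(2) rpos by (simp add: E_def \<eta>_def)
    then have "?M * (\<eta> * r ^ N) \<le> ?M * gauss r E" using M by (intro mult_left_mono) auto
    also have "\<dots> = gauss r (a * (h * E))"
      using gauss_linear_prod[OF rpos Ar, where F="h * E"] gauss_linear_prod[OF rpos Br, where F=E]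
      by (simp only: a_def h_def mult.assoc)
    finally have big: "?M * (\<eta> * r ^ N) \<le> gauss r (a * (h * E))" .
    have pos: "?M * (\<eta> * r ^ N) > 0" using M \<eta> rpos by simp
    have "gauss r (?X * w - a * (h * E)) < gauss r (a * (h * E))"
      using small big pos by (simp add: mult_ac)
    then have "gauss r (a * (h * E) - ?X * w) < gauss r (a * (h * E))"
      using gauss_minus[of r "?X * w - a * (h * E)"] by (simp only: minus_diff_eq)
    from gauss_isosceles(2)[OF _ this] have "gauss r (?X * w) = gauss r (a * (h * E))"
      using rpos by simp
    then have "?M * (\<eta> * r ^ N) \<le> r ^ Suc N * gauss r w"
      using big gauss_monom_mult[of r "Suc N" w] rpos by simp
    then have "r ^ N * (\<eta> * ?M) \<le> r ^ N * (r * gauss r w)" by (simp add: mult_ac)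
    then show ?thesis using rpos by simp
  qed
  have "c * gauss r F * gauss r Q = v f * v q * (c * ?M)" by (simp add: gF gQ mult_ac)
  also have "\<dots> \<le> v f * v q * (r * gauss r w)"
    using key c\<eta> M by (intro mult_left_mono mult_nonneg_nonneg nonneg)
      (meson less_imp_le mult_right_mono order_trans)
  finally have "c * gauss r F * gauss r Q \<le> gauss r (pderiv P * Q - P * pderiv Q) * r"
    unfolding gW by (simp add: mult_ac)
  then show ?thesis using r r2 unfolding F_def by (intro exI[of _ r] exI[of _ b]) auto
qed

subsection \<open>Multiplicative seminorms\<close>

lemma
  assumes "s \<in> mult_seminorms v"
  shows seminorm_nonneg: "s F \<ge> 0" and seminorm_triangle: "s (F + G) \<le> s F + s G"
    and seminorm_mult: "s (F * G) = s F * s G" and seminorm_const: "s [:c:] = v c"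
  using assms by (auto simp: mult_seminorms_def)

lemma seminorm_0: "s \<in> mult_seminorms v \<Longrightarrow> s 0 = 0"
  using seminorm_const[of s 0] by simp

lemma seminorm_1: "s \<in> mult_seminorms v \<Longrightarrow> s 1 = 1"
  using seminorm_const[of s 1] by (simp add: one_pCons)

lemma seminorm_smult: "s \<in> mult_seminorms v \<Longrightarrow> s (smult c F) = v c * s F"
  using seminorm_mult[of s "[:c:]" F] seminorm_const[of s c] by simp

lemma seminorm_minus: "s \<in> mult_seminorms v \<Longrightarrow> s (- F) = s F"
  using seminorm_smult[of s "-1" F] by simp

lemma seminorm_power: "s \<in> mult_seminorms v \<Longrightarrow> s (F ^ n) = s F ^ n"
  by (induction n) (auto simp: seminorm_1 seminorm_mult)

text \<open>The definition asks only for the triangle inequality. Expanding an \<open>n\<close>-th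
  power by the binomial theorem costs a factor \<open>n + 1\<close>, since integers have norm at
  most 1, and that factor loses against exponential growth.\<close>

lemma seminorm_ultra:
  assumes s: "s \<in> mult_seminorms v"
  shows "s (F + G) \<le> max (s F) (s G)"
proof (rule ccontr)
  define m where "m = max (s F) (s G)"
  define t where "t = s (F + G)"
  assume "\<not> ?thesis"
  then have mt: "m < t" unfolding m_def t_def by (rule not_le_imp_less)
  have m0: "m \<ge> 0" using seminorm_nonneg[OF s, of F] by (simp add: m_def)
  then have t0: "t > 0" using mt by simp
  have sum_le: "s (\<Sum>i\<in>I. h i) \<le> (\<Sum>i\<in>I. s (h i))" for I :: "nat set" and h
  proof (induction I rule: infinite_finite_induct)
    case (insert x I)
    then show ?case using seminorm_triangle[OF s, of "h x" "sum h I"] by simp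
  qed (auto simp: seminorm_0[OF s])
  have bound: "t ^ n \<le> (real n + 1) * m ^ n" for n
  proof -
    have "t ^ n = s ((F + G) ^ n)" by (simp add: t_def seminorm_power[OF s])
    also have "\<dots> = s (\<Sum>k\<le>n. of_nat (n choose k) * F ^ k * G ^ (n - k))"
      by (simp add: binomial_ring)
    also have "\<dots> \<le> (\<Sum>k\<le>n. s (of_nat (n choose k) * F ^ k * G ^ (n - k)))" by (rule sum_le)
    also have "\<dots> \<le> (\<Sum>k\<le>n. m ^ n)"
    proof (rule sum_mono)
      fix k assume k: "k \<in> {..n}"
      have "s (of_nat (n choose k) * F ^ k * G ^ (n - k)) = v (of_nat (n choose k)) * (s F ^ k * s G ^ (n - k))"
        using seminorm_const[OF s, of "of_nat (n choose k)"]
        by (simp add: seminorm_mult[OF s] seminorm_power[OF s] seminorm_smult[OF s] of_nat_poly)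
      also have "\<dots> \<le> 1 * (m ^ k * m ^ (n - k))"
        using v_of_nat_le_1 seminorm_nonneg[OF s] m0
        by (intro mult_mono power_mono mult_nonneg_nonneg) (auto simp: m_def nonneg)
      also have "\<dots> = m ^ n" using k by (simp add: power_add[symmetric])
      finally show "s (of_nat (n choose k) * F ^ k * G ^ (n - k)) \<le> m ^ n" .
    qed
    also have "\<dots> = (real n + 1) * m ^ n" by simp
    finally show ?thesis .
  qed
  have lim: "(\<lambda>n. real n * (m / t) ^ n + (m / t) ^ n) \<longlonglongrightarrow> 0 + 0"
    using mt m0 t0 by (intro tendsto_add powser_times_n_limit_0 LIMSEQ_power_zero) auto
  have "1 \<le> real n * (m / t) ^ n + (m / t) ^ n" for n
    using bound[of n] t0 by (simp add: power_divide field_simps)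
  then show False using LIMSEQ_le_const[OF lim, of 1] by auto
qed

lemma seminorm_diff_ultra:
  "s \<in> mult_seminorms v \<Longrightarrow> s (F - G) \<le> max (s F) (s G)"
  using seminorm_ultra[of s F "- G"] seminorm_minus[of s G] by simp

lemma seminorm_linear_prod:
  "s \<in> mult_seminorms v \<Longrightarrow> s (linear_prod A) = (\<Prod>z\<in>#A. s [:- z, 1:])"
proof (induction A)
  case (add z A)
  then show ?case using seminorm_mult[of s "[:- z, 1:]" "linear_prod A"] by (simp only: linear_prod_simps) simp
qed (simp add: seminorm_1)

section \<open>Centres and radius of a point\<close>

lemma seminorm_linear_diff:
  assumes s: "s \<in> mult_seminorms v"
  shows "s [:- a, 1:] \<le> max (v (a - b)) (s [:- b, 1:])" "v (a - b) \<le> max (s [:- a, 1:]) (s [:- b, 1:])"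
proof -
  have "[:- a, 1:] = [:- (a - b):] + [:- b, 1:]" by simp
  then show "s [:- a, 1:] \<le> max (v (a - b)) (s [:- b, 1:])"
    using seminorm_ultra[OF s, of "[:- (a - b):]" "[:- b, 1:]"] seminorm_const[OF s, of "-(a-b)"] by (metis v_minus)
  have "[:a - b:] = [:- b, 1:] - [:- a, 1:]" by simp
  then show "v (a - b) \<le> max (s [:- a, 1:]) (s [:- b, 1:])"
    using seminorm_diff_ultra[OF s, of "[:- b, 1:]" "[:- a, 1:]"] seminorm_const[OF s, of "a-b"] by (metis max.commute)
qed

text \<open>The diameter of the point: \<open>r\<close> for the point of a disc of radius
  \<open>r\<close>, and still positive for type IV, where the infimum is not attained. As an infimum
  of continuous functions it has open strict sublevel sets.\<close>

definition radius :: "('a poly \<Rightarrow> real) \<Rightarrow> real" where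
  "radius s = (INF a. s [:- a, 1:])"

lemma radius_le: "s \<in> mult_seminorms v \<Longrightarrow> radius s \<le> s [:- a, 1:]"
  unfolding radius_def using seminorm_nonneg[of s]
  by (intro cINF_lower) (auto intro: bdd_belowI[of _ 0])

lemma radius_nonneg: "s \<in> mult_seminorms v \<Longrightarrow> 0 \<le> radius s"
  unfolding radius_def using seminorm_nonneg[of s] by (intro cINF_greatest) auto

lemma radius_less: "s \<in> mult_seminorms v \<Longrightarrow> radius s < t \<longleftrightarrow> (\<exists>a. s [:- a, 1:] < t)"
  unfolding radius_def using seminorm_nonneg[of s]
  by (subst cINF_less_iff) (auto intro: bdd_belowI[of _ 0])

text \<open>Completeness of the field enters: the approximate centres form a Cauchy sequence, and
  its limit is the classical point.\<close>

lemma radius_0_imp_classical: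
  assumes s: "s \<in> mult_seminorms v" and 0: "radius s = 0"
  shows "\<exists>a. s [:- a, 1:] = 0"
proof -
  have "\<exists>a. s [:- a, 1:] < 1 / real (Suc n)" for n
    using radius_less[OF s, of "1 / real (Suc n)"] 0 by simp
  then obtain X where X: "\<And>n. s [:- X n, 1:] < 1 / real (Suc n)" by metis
  have X0: "(\<lambda>n. s [:- X n, 1:]) \<longlonglongrightarrow> 0"
  proof (rule Lim_null_comparison)
    show "\<forall>\<^sub>F n in sequentially. norm (s [:- X n, 1:]) \<le> 1 / real (Suc n)"
      using X seminorm_nonneg[OF s] by (simp add: less_imp_le)
    show "(\<lambda>n. 1 / real (Suc n)) \<longlonglongrightarrow> 0" using LIMSEQ_inverse_real_of_nat by (simp add: inverse_eq_divide)
  qed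
  have "(\<lambda>n. v (X n - X (Suc n))) \<longlonglongrightarrow> 0"
  proof (rule Lim_null_comparison)
    show "\<forall>\<^sub>F n in sequentially. norm (v (X n - X (Suc n))) \<le> max (s [:- X n, 1:]) (s [:- X (Suc n), 1:])"
      using seminorm_linear_diff(2)[OF s] nonneg by simp
    show "(\<lambda>n. max (s [:- X n, 1:]) (s [:- X (Suc n), 1:])) \<longlonglongrightarrow> 0"
      using tendsto_max[OF X0 LIMSEQ_Suc[OF X0]] by simp
  qed
  then obtain l where l: "(\<lambda>n. v (X n - l)) \<longlonglongrightarrow> 0" using v_complete by blast
  have "s [:- l, 1:] \<le> max (v (X n - l)) (s [:- X n, 1:])" for n
    using seminorm_linear_diff(1)[OF s, of l "X n"] v_minus_commute[of l "X n"] by simp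
  moreover have "(\<lambda>n. max (v (X n - l)) (s [:- X n, 1:])) \<longlonglongrightarrow> 0"
    using tendsto_max[OF l X0] by simp
  ultimately have "s [:- l, 1:] \<le> 0" using LIMSEQ_le_const by blast
  then show ?thesis using seminorm_nonneg[OF s, of "[:- l, 1:]"] by (intro exI[of _ l]) simp
qed

text \<open>\<open>F - F(a)\<close> is a multiple of \<open>T - a\<close>, so its seminorm is
  0.\<close>

lemma seminorm_classical:
  assumes s: "s \<in> mult_seminorms v" and 0: "s [:- a, 1:] = 0"
  shows "s F = v (poly F a)"
proof -
  have "[:- a, 1:] dvd F - [:poly F a:]" by (simp add: poly_eq_0_iff_dvd[symmetric])
  then obtain G where "F - [:poly F a:] = [:- a, 1:] * G" by (elim dvdE)
  then have d: "s (F - [:poly F a:]) = 0" using seminorm_mult[OF s, of "[:- a, 1:]" G] 0 by (simp only:)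
  show ?thesis
  proof (rule antisym)
    show "s F \<le> v (poly F a)"
      using seminorm_ultra[OF s, of "F - [:poly F a:]" "[:poly F a:]"] d seminorm_const[OF s] nonneg by simp
    show "v (poly F a) \<le> s F"
      using seminorm_diff_ultra[OF s, of F "F - [:poly F a:]"] d seminorm_const[OF s] seminorm_nonneg[OF s, of F] by simp
  qed
qed

lemma seminorm_pos:
  assumes s: "s \<in> mult_seminorms v" and r: "radius s > 0" and F: "F \<noteq> 0"
  shows "s F > 0"
proof -
  obtain A where A: "F = smult (lead_coeff F) (linear_prod A)"
    using linear_prod_factorization[OF F] by metis
  have "(\<Prod>z\<in>#A. s [:- z, 1:]) > 0"
  proof (induction A)
    case (add z A)
    then show ?case using radius_le[OF s, of z] r by (simp add: mult_pos_pos)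
  qed simp
  then show ?thesis
    using A seminorm_smult[OF s, of "lead_coeff F" "linear_prod A"] seminorm_linear_prod[OF s, of A] v_pos[of "lead_coeff F"] F
    by simp
qed

text \<open>Horner's scheme. For \<open>l = T - a\<close> it says that \<open>s\<close> is dominated
  by the Gauss norm of the disc about \<open>a\<close> of radius \<open>s (T - a)\<close>.\<close>

lemma seminorm_pcompose_le:
  assumes s: "s \<in> mult_seminorms v"
  shows "s (pcompose G l) \<le> gauss (s l) G"
proof (induction G)
  case 0
  then show ?case by (simp add: seminorm_0[OF s] gauss_def)
next
  case (pCons c G)
  have n: "s l \<ge> 0" by (rule seminorm_nonneg[OF s])
  have "s (pcompose (pCons c G) l) \<le> max (v c) (s l * s (pcompose G l))"
    using seminorm_ultra[OF s, of "[:c:]" "l * pcompose G l"] seminorm_const[OF s] seminorm_mult[OF s]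
    by (simp add: pcompose_pCons)
  also have "\<dots> \<le> max (v c) (s l * gauss (s l) G)"
    using pCons n by (intro max.mono mult_left_mono) auto
  also have "\<dots> \<le> gauss (s l) (pCons c G)" using gauss_pCons_ge[OF n] by simp
  finally show ?case .
qed

lemma linear_prod_pcompose:
  "pcompose (linear_prod A) [:a, 1:] = linear_prod (image_mset (\<lambda>z. z - a) A)" for a :: 'a
proof (induction A)
  case (add z A)
  have "pcompose [:- z, 1:] [:a, 1:] = [:- (z - a), 1:]" by (simp add: pcompose_pCons)
  then show ?case using add by (simp only: linear_prod_simps image_mset_add_mset pcompose_mult)
qed (simp add: pcompose_1)

text \<open>
  The infimum is \<open>s(Q)\<close> times the radius of the image of \<open>s\<close>. If \<open>s\<close> has type IV then no disc attains
  the radius, but the seminorm of the finitely many factors of the Wronskian is that of a small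
  enough disc.
\<close>

lemma radius_expansion:
  fixes P Q :: "'a poly"
  assumes s: "s \<in> mult_seminorms v" and pos: "radius s > 0"
    and W0: "pderiv P * Q - P * pderiv Q \<noteq> 0"
    and deg: "degree P \<le> d" "degree Q \<le> d"
    and c0: "c \<ge> 0" and c: "\<And>l. 1 \<le> l \<Longrightarrow> l \<le> d \<Longrightarrow> c \<le> v (of_nat l)"
  shows "c * s Q * (INF b. s (P - smult b Q)) \<le> s (pderiv P * Q - P * pderiv Q) * radius s"
proof -
  define W where "W = pderiv P * Q - P * pderiv Q"
  define D where "D = radius s"
  define I where "I = (INF b. s (P - smult b Q))"
  have I_le: "I \<le> s (P - smult b Q)" for b
    unfolding I_def using seminorm_nonneg[OF s] by (intro cINF_lower) (auto intro: bdd_belowI[of _ 0])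
  have W0: "W \<noteq> 0" using W0 by (simp add: W_def)
  then obtain A where A: "W = smult (lead_coeff W) (linear_prod A)"
    using linear_prod_factorization by metis
  have bound: "c * s Q * I \<le> t ^ degree W * s W * (t * (t * D))" if t: "t > 1" for t
  proof -
    have "D < t * D" using t pos by (simp add: D_def)
    then obtain a0 where a0: "s [:- a0, 1:] < t * D" using radius_less[OF s] by (auto simp: D_def)
    define Z where "Z = insert a0 (set_mset A)"
    have "finite Z" "Z \<noteq> {}" by (auto simp: Z_def)
    \<comment> \<open>The closest centre to \<open>s\<close> among the roots of \<open>W\<close> and
      an almost optimal \<open>a0\<close>. Each root \<open>z\<close> then satisfies
      \<open>r \<le> s (T - z)\<close>, which gives for \<open>W\<close> the reverse of
      \<open>s_le\<close>; for other polynomials that may fail.\<close>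
    then obtain a where a: "a \<in> Z" "\<And>z. z \<in> Z \<Longrightarrow> s [:- a, 1:] \<le> s [:- z, 1:]"
      using arg_min_if_finite[of Z "\<lambda>z. s [:- z, 1:]"] by (metis not_le)
    define r where "r = s [:- a, 1:]"
    have r: "r > 0" "r < t * D"
      using radius_le[OF s, of a] pos a(2)[of a0] a0 by (auto simp: r_def Z_def)
    define sh where "sh F = pcompose F [:a, 1:]" for F :: "'a poly"
    have s_le: "s F \<le> gauss r (sh F)" for F
    proof -
      have "pcompose (sh F) [:- a, 1:] = F"
        by (simp add: sh_def pcompose_assoc[symmetric] pcompose_pCons)
      then show ?thesis using seminorm_pcompose_le[OF s, of "sh F" "[:- a, 1:]"] by (simp add: r_def)
    qed
    have W_ge: "gauss r (sh W) \<le> s W"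
    proof -
      let ?A = "image_mset (\<lambda>z. z - a) A"
      have "sh W = smult (lead_coeff W) (linear_prod ?A)"
        unfolding sh_def linear_prod_pcompose[symmetric] pcompose_smult[symmetric] A[symmetric] ..
      then have "gauss r (sh W) \<le> v (lead_coeff W) * root_size r ?A"
        using gauss_smult[of r] r gauss_linear_prod_le[of r ?A] by (simp add: mult_left_mono nonneg)
      also have "root_size r ?A \<le> (\<Prod>z\<in>#A. s [:- z, 1:])"
      proof -
        have "set_mset A \<subseteq> Z" by (auto simp: Z_def)
        then show ?thesis
        proof (induction A)
          case (add z A)
          have "r \<le> s [:- z, 1:]" using a(2)[of z] add.prems by (simp add: r_def)
          then have "max (v (z - a)) r \<le> s [:- z, 1:]"
            using seminorm_linear_diff(2)[OF s, of z a] by (simp add: r_def)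
          then show ?case
            using add r by (simp only: image_mset_add_mset root_size_simps prod_mset.add_mset)
              (intro mult_mono, auto simp: seminorm_nonneg[OF s] less_imp_le root_size_pos)
        qed simp
      qed
      finally show ?thesis
        using A seminorm_smult[OF s, of "lead_coeff W" "linear_prod A"] seminorm_linear_prod[OF s, of A] nonneg
        by (simp add: mult_left_mono)
    qed
    have sh_W: "pderiv (sh P) * sh Q - sh P * pderiv (sh Q) = sh W"
      by (simp add: sh_def W_def pderiv_pcompose pcompose_mult pcompose_diff pderiv_pCons)
    have sh0: "sh W \<noteq> 0"
      using s_le[of W] seminorm_pos[OF s pos W0] by (auto simp: gauss_def)
    have dsh: "degree (sh F) = degree F" for F by (simp add: sh_def degree_pcompose)
    \<comment> \<open>Restricting to radii between \<open>r\<close> and \<open>t r\<close> makes the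
      change of radius cost only powers of \<open>t\<close>.\<close>
    have "r < t * r" using t r by simp
    then obtain r' b where r': "r < r'" "r' < t * r" and
      ineq: "c * gauss r' (sh P - smult b (sh Q)) * gauss r' (sh Q) \<le> gauss r' (sh W) * r'"
      using gauss_wronskian_ge[of "sh P" "sh Q" d c r "t * r"] sh0 deg c r unfolding sh_W dsh by metis
    have shb: "sh P - smult b (sh Q) = sh (P - smult b Q)"
      by (simp add: sh_def pcompose_diff pcompose_smult)
    have "c * s Q * I \<le> c * gauss r' (sh Q) * gauss r' (sh (P - smult b Q))"
    proof (intro mult_mono)
      show "s Q \<le> gauss r' (sh Q)"
        using s_le[of Q] gauss_mono[of r r' "sh Q"] r r' by simp
      show "I \<le> gauss r' (sh (P - smult b Q))"
        using I_le[of b] s_le[of "P - smult b Q"] gauss_mono[of r r' "sh (P - smult b Q)"] r r' by simp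
      show "0 \<le> I" unfolding I_def using seminorm_nonneg[OF s] by (intro cINF_greatest) auto
    qed (use c0 r r' gauss_nonneg seminorm_nonneg[OF s] in auto)
    also have "\<dots> \<le> gauss r' (sh W) * r'" using ineq unfolding shb by (simp add: mult_ac)
    also have "\<dots> \<le> (t ^ degree W * s W) * (t * (t * D))"
    proof (intro mult_mono)
      have "gauss r' (sh W) \<le> t ^ degree W * gauss r (sh W)"
        using gauss_scale_le[of r r' t "sh W"] r r' t by (simp add: dsh)
      also have "\<dots> \<le> t ^ degree W * s W" using W_ge t by (intro mult_left_mono) auto
      finally show "gauss r' (sh W) \<le> t ^ degree W * s W" .
      have "t * r \<le> t * (t * D)" using r t by (intro mult_left_mono) auto
      then show "r' \<le> t * (t * D)" using r' by simp
    qed (use r r' t seminorm_nonneg[OF s] in auto)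
    finally show ?thesis .
  qed
  have "((\<lambda>t. t ^ degree W * s W * (t * (t * D))) \<longlongrightarrow> 1 ^ degree W * s W * (1 * (1 * D))) (at_right 1)"
    by (intro tendsto_intros)
  moreover have "\<forall>\<^sub>F t in at_right 1. c * s Q * I \<le> t ^ degree W * s W * (t * (t * D))"
    using bound by (auto simp: eventually_at_right_less eventually_at_filter)
  ultimately have "c * s Q * I \<le> 1 ^ degree W * s W * (1 * (1 * D))"
    by (intro tendsto_lowerbound) auto
  then show ?thesis by (simp add: W_def D_def I_def)
qed

end

section \<open>Classical dynamics\<close>

subsection \<open>Rational maps in homogeneous coordinates\<close>

text \<open>The form of formal degree \<open>n\<close> attached to \<open>F\<close>. If
  \<open>n\<close> exceeds the degree of \<open>F\<close>, it has a zero at infinity.\<close>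

definition hom_eval :: "nat \<Rightarrow> 'a::field poly \<Rightarrow> 'a \<Rightarrow> 'a \<Rightarrow> 'a" where
  "hom_eval n F x y = (\<Sum>i\<le>n. coeff F i * (x ^ i * y ^ (n - i)))"

definition proj :: "'a::field \<Rightarrow> 'a \<Rightarrow> 'a option" where
  "proj x y = (if y = 0 then None else Some (x / y))"

lemma proj_exhaust:
  obtains x y :: "'a::field" where "z = proj x y" "x \<noteq> 0 \<or> y \<noteq> 0"
proof (cases z)
  case None
  then show ?thesis using that[of 1 0] by (simp add: proj_def)
next
  case (Some a)
  then show ?thesis using that[of a 1] by (simp add: proj_def)
qed

lemma poly_homog_subst: "poly (homog_subst n F R) a = hom_eval n F (poly (rnum R) a) (poly (rden R) a)"
  by (simp add: homog_subst_def hom_eval_def poly_sum)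

lemma hom_eval_scale: "hom_eval n F (t * x) (t * y) = t ^ n * hom_eval n F x y"
  unfolding hom_eval_def sum_distrib_left
proof (rule sum.cong)
  fix i assume "i \<in> {..n}"
  then have "t ^ n = t ^ i * t ^ (n - i)" by (simp add: power_add[symmetric])
  then show "coeff F i * ((t * x) ^ i * (t * y) ^ (n - i)) = t ^ n * (coeff F i * (x ^ i * y ^ (n - i)))"
    by (simp add: power_mult_distrib mult_ac)
qed simp

lemma poly_eq_sum:
  fixes F :: "'a::comm_ring_1 poly"
  assumes "degree F \<le> n"
  shows "poly F x = (\<Sum>i\<le>n. coeff F i * x ^ i)"
proof -
  from assms
  have "poly F x = poly (\<Sum>i\<le>n. monom (coeff F i) i) x" by (simp add: poly_as_sum_of_monoms')
  then show ?thesis by (simp add: poly_sum poly_monom)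
qed

lemma pderiv_sum_monom: "pderiv (\<Sum>i\<in>I. monom (h i) (k i)) = (\<Sum>i\<in>I. monom (of_nat (k i) * h i) (k i - 1))"
  by (induction I rule: infinite_finite_induct) (auto simp: pderiv_add pderiv_monom)

lemma hom_eval_1: "degree F \<le> n \<Longrightarrow> hom_eval n F x 1 = poly F x"
  using poly_eq_sum[of F n x] by (simp add: hom_eval_def mult_ac)

lemma hom_eval_affine: "degree F \<le> n \<Longrightarrow> y \<noteq> 0 \<Longrightarrow> hom_eval n F x y = y ^ n * poly F (x / y)"
  using hom_eval_scale[of n F y "x / y" 1] hom_eval_1[of F n "x / y"] by simp

lemma hom_eval_infinity: "hom_eval n F x 0 = coeff F n * x ^ n"
proof -
  have "hom_eval n F x 0 = (\<Sum>i\<le>n. if i = n then coeff F n * x ^ n else 0)"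
    unfolding hom_eval_def by (rule sum.cong) auto
  then show ?thesis by simp
qed

lemma coeff_mult_add_degree:
  fixes A B :: "'a::comm_ring_1 poly"
  assumes "degree A \<le> m" "degree B \<le> n"
  shows "coeff (A * B) (m + n) = coeff A m * coeff B n"
proof -
  have "coeff (A * B) (m + n) = (\<Sum>i\<le>m + n. if i = m then coeff A m * coeff B n else 0)"
    unfolding coeff_mult
  proof (rule sum.cong)
    fix i assume "i \<in> {..m + n}"
    show "coeff A i * coeff B (m + n - i) = (if i = m then coeff A m * coeff B n else 0)"
    proof (cases "i < m")
      case True
      then show ?thesis using assms by (simp add: coeff_eq_0)
    next
      case False
      then show ?thesis using assms by (cases "i = m") (auto simp: coeff_eq_0)
    qed
  qed simp
  then show ?thesis by simp
qed

lemma coeff_power_mult_degree: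
  fixes A :: "'a::comm_ring_1 poly"
  assumes "degree A \<le> m"
  shows "coeff (A ^ i) (i * m) = coeff A m ^ i" "degree (A ^ i) \<le> i * m"
proof -
  show 1: "degree (A ^ i) \<le> i * m" for i
    using degree_power_le[of A i] mult_le_mono1[OF assms, of i] by (metis mult.commute order_trans)
  show "coeff (A ^ i) (i * m) = coeff A m ^ i"
  proof (induction i)
    case (Suc i)
    then show ?case using coeff_mult_add_degree[OF assms 1[of i]] by simp
  qed simp
qed

text \<open>The coefficient at the formal degree is the value of the composed form at infinity. It
  may be 0, and then the degree drops.\<close>

lemma homog_subst_coeff:
  fixes S :: "'a::field ratfun"
  defines "e \<equiv> rat_degree S"
  shows "degree (homog_subst n F S) \<le> n * e"
    and "coeff (homog_subst n F S) (n * e) = hom_eval n F (coeff (rnum S) e) (coeff (rden S) e)"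
proof -
  have deg: "degree (rnum S) \<le> e" "degree (rden S) \<le> e" by (auto simp: e_def rat_degree_def)
  have *: "degree (rnum S ^ i * rden S ^ (n - i)) \<le> n * e \<and>
      coeff (rnum S ^ i * rden S ^ (n - i)) (n * e) = coeff (rnum S) e ^ i * coeff (rden S) e ^ (n - i)"
    if "i \<le> n" for i
  proof -
    have eq: "n * e = i * e + (n - i) * e" using that by (simp add: add_mult_distrib[symmetric])
    note d = coeff_power_mult_degree[OF deg(1), of i] coeff_power_mult_degree[OF deg(2), of "n - i"]
    have "degree (rnum S ^ i * rden S ^ (n - i)) \<le> i * e + (n - i) * e"
      using degree_mult_le add_mono[OF d(2) d(4)] by (rule order_trans)
    then show ?thesis
      unfolding eq using coeff_mult_add_degree[OF d(2) d(4)] by (simp only: d(1) d(3) simp_thms)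
  qed
  show "degree (homog_subst n F S) \<le> n * e"
    unfolding homog_subst_def using * by (intro degree_sum_le) (auto intro: order_trans[OF degree_smult_le])
  show "coeff (homog_subst n F S) (n * e) = hom_eval n F (coeff (rnum S) e) (coeff (rden S) e)"
    unfolding homog_subst_def hom_eval_def using * by (simp add: coeff_sum)
qed

text \<open>Substitution is composition of forms: away from infinity after dehomogenizing, at
  infinity by comparing top coefficients.\<close>

lemma hom_eval_homog_subst:
  fixes S :: "'a::field ratfun"
  defines "e \<equiv> rat_degree S"
  shows "hom_eval (n * e) (homog_subst n F S) x y
       = hom_eval n F (hom_eval e (rnum S) x y) (hom_eval e (rden S) x y)"
proof (cases "y = 0")
  case True
  have "hom_eval n F (hom_eval e (rnum S) x 0) (hom_eval e (rden S) x 0)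
      = hom_eval n F (x ^ e * coeff (rnum S) e) (x ^ e * coeff (rden S) e)"
    by (simp add: hom_eval_infinity mult.commute)
  then show ?thesis
    using homog_subst_coeff(2)[of n F S] True
    by (simp add: hom_eval_scale hom_eval_infinity e_def power_mult[symmetric] mult.commute)
next
  case False
  have deg: "degree (rnum S) \<le> e" "degree (rden S) \<le> e" by (auto simp: e_def rat_degree_def)
  have "hom_eval (n * e) (homog_subst n F S) x y = y ^ (n * e) * poly (homog_subst n F S) (x / y)"
    using homog_subst_coeff(1)[of n F S] False by (intro hom_eval_affine) (auto simp: e_def)
  also have "\<dots> = (y ^ e) ^ n * hom_eval n F (poly (rnum S) (x / y)) (poly (rden S) (x / y))"
    by (simp add: poly_homog_subst power_mult[symmetric] mult.commute)
  also have "\<dots> = hom_eval n F (hom_eval e (rnum S) x y) (hom_eval e (rden S) x y)"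
    using hom_eval_affine[OF deg(1) False] hom_eval_affine[OF deg(2) False] by (simp add: hom_eval_scale)
  finally show ?thesis .
qed

lemma rational_map_no_common_root:
  assumes "rational_map R"
  shows "poly (rnum R) a \<noteq> 0 \<or> poly (rden R) a \<noteq> 0"
proof (rule ccontr)
  assume "\<not> ?thesis"
  then have "[:- a, 1:] dvd rnum R" "[:- a, 1:] dvd rden R" by (auto simp: poly_eq_0_iff_dvd)
  then have "is_unit [:- a, 1:]" using assms by (meson rational_map_def coprime_common_divisor)
  then show False by (simp add: is_unit_iff_degree)
qed

text \<open>Coprimality excludes common zeros in the affine part, and the choice of the formal
  degree excludes one at infinity.\<close>

lemma rational_map_hom_eval:
  assumes R: "rational_map R" and xy: "x \<noteq> 0 \<or> y \<noteq> 0"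
  shows "hom_eval (rat_degree R) (rnum R) x y \<noteq> 0 \<or> hom_eval (rat_degree R) (rden R) x y \<noteq> 0"
proof (cases "y = 0")
  case True
  have "coeff (rnum R) (rat_degree R) \<noteq> 0 \<or> coeff (rden R) (rat_degree R) \<noteq> 0"
  proof (cases "degree (rden R) < degree (rnum R)")
    case True
    then have "rnum R \<noteq> 0" by auto
    then show ?thesis using True by (simp add: rat_degree_def max_def)
  next
    case False
    then show ?thesis using R by (simp add: rat_degree_def rational_map_def max_def)
  qed
  then show ?thesis using True xy by (simp add: hom_eval_infinity)
next
  case False
  then show ?thesis
    using hom_eval_affine[of "rnum R" "rat_degree R" y x] hom_eval_affine[of "rden R" "rat_degree R" y x]
      rational_map_no_common_root[OF R, of "x / y"] by (simp add: rat_degree_def)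
qed

lemma rat_eval_proj:
  assumes R: "rational_map R" and xy: "x \<noteq> 0 \<or> y \<noteq> 0"
  shows "rat_eval R (proj x y) = proj (hom_eval (rat_degree R) (rnum R) x y) (hom_eval (rat_degree R) (rden R) x y)"
proof (cases "y = 0")
  case True
  show ?thesis
  proof (cases "degree (rden R) < degree (rnum R)")
    case True
    then show ?thesis using \<open>y = 0\<close>
      by (simp add: proj_def rat_eval_def hom_eval_infinity rat_degree_def max_def coeff_eq_0)
  next
    case False
    then show ?thesis using \<open>y = 0\<close> R xy
      by (simp add: proj_def rat_eval_def hom_eval_infinity rat_degree_def max_def rational_map_def)
  qed
next
  case False
  then show ?thesis
    using hom_eval_affine[of "rnum R" "rat_degree R" y x] hom_eval_affine[of "rden R" "rat_degree R" y x]
    by (simp add: rat_degree_def proj_def rat_eval_def)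
qed

lemma coprime_polyI:
  fixes P Q :: "'a::alg_closed_field poly"
  assumes "\<And>a. poly P a \<noteq> 0 \<or> poly Q a \<noteq> 0" and "Q \<noteq> 0"
  shows "coprime P Q"
proof (rule coprimeI)
  fix c assume c: "c dvd P" "c dvd Q"
  have "c \<noteq> 0" using c assms(2) by auto
  moreover have "degree c = 0"
  proof (rule ccontr)
    assume "degree c \<noteq> 0"
    then obtain a where "poly c a = 0" using alg_closed_imp_poly_has_root[of c] by auto
    then have "poly P a = 0" "poly Q a = 0" using c by (auto elim!: dvdE)
    then show False using assms(1) by auto
  qed
  ultimately show "is_unit c" by (simp add: is_unit_iff_degree)
qed

lemma bezout_poly:
  fixes P Q :: "'a::field poly"
  shows "\<exists>A B. A * P + B * Q dvd P \<and> A * P + B * Q dvd Q"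
proof (induction "euclidean_size Q" arbitrary: P Q rule: less_induct)
  case less
  show ?case
  proof (cases "Q = 0")
    case True
    then show ?thesis by (intro exI[of _ 1] exI[of _ 0]) simp
  next
    case False
    then obtain A B where AB: "A * Q + B * (P mod Q) dvd Q" "A * Q + B * (P mod Q) dvd P mod Q"
      using less[of "P mod Q" Q] mod_size_less by blast
    then have "A * Q + B * (P mod Q) dvd P" by (simp add: dvd_mod_iff)
    moreover have "A * Q + B * (P mod Q) = B * P + (A - B * (P div Q)) * Q"
      by (simp add: minus_div_mult_eq_mod[symmetric] algebra_simps)
    ultimately show ?thesis using AB(1) by metis
  qed
qed

lemma coprime_poly_bezout:
  fixes P Q :: "'a::field poly"
  assumes "coprime P Q"
  shows "\<exists>A B. A * P + B * Q = 1"
proof -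
  obtain A B where "A * P + B * Q dvd P" "A * P + B * Q dvd Q" using bezout_poly by blast
  with assms have "is_unit (A * P + B * Q)" by (rule coprime_common_divisor)
  then obtain c where "1 = (A * P + B * Q) * c" by (elim dvdE)
  then have "(c * A) * P + (c * B) * Q = 1" by (simp add: algebra_simps)
  then show ?thesis by blast
qed

text \<open>Forms without a common zero compose to forms without a common zero, so nothing cancels
  and the degree is exactly the product.\<close>

lemma rat_comp:
  fixes R S :: "'a::alg_closed_field ratfun"
  assumes R: "rational_map R" "rat_degree R \<ge> 1" and S: "rational_map S" "rat_degree S \<ge> 1"
  shows "rational_map (rat_comp R S)" (is ?rat)
    and "rat_degree (rat_comp R S) = rat_degree R * rat_degree S" (is ?deg)
    and "rat_eval (rat_comp R S) z = rat_eval R (rat_eval S z)" (is ?eval)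
proof -
  let ?d = "rat_degree R" and ?e = "rat_degree S"
  let ?N = "homog_subst ?d (rnum R) S" and ?D = "homog_subst ?d (rden R) S"
  have cmp: "rat_comp R S = (?N, ?D)" by (simp add: rat_comp_def)
  have "hom_eval ?e (rnum S) 1 0 \<noteq> 0 \<or> hom_eval ?e (rden S) 1 0 \<noteq> 0"
    by (rule rational_map_hom_eval[OF S(1)]) simp
  then have "coeff (rnum S) ?e \<noteq> 0 \<or> coeff (rden S) ?e \<noteq> 0" by (simp add: hom_eval_infinity)
  from rational_map_hom_eval[OF R(1) this]
  have c: "coeff ?N (?d * ?e) \<noteq> 0 \<or> coeff ?D (?d * ?e) \<noteq> 0"
    by (simp add: homog_subst_coeff(2))
  show deg: ?deg
  proof (rule antisym)
    show "rat_degree (rat_comp R S) \<le> ?d * ?e"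
      using homog_subst_coeff(1)[of ?d _ S] unfolding cmp by (simp add: rat_degree_def[of "(?N, ?D)"])
    show "?d * ?e \<le> rat_degree (rat_comp R S)"
      using c le_degree[of ?N "?d * ?e"] le_degree[of ?D "?d * ?e"]
      unfolding cmp by (auto simp: rat_degree_def[of "(?N, ?D)"] le_max_iff_disj)
  qed
  have root: "poly ?N a \<noteq> 0 \<or> poly ?D a \<noteq> 0" for a
    unfolding poly_homog_subst
    by (rule rational_map_hom_eval[OF R(1) rational_map_no_common_root[OF S(1)]])
  have D0: "?D \<noteq> 0"
  proof
    assume D: "?D = 0"
    then have "poly ?N a \<noteq> 0" for a using root by simp
    then have "degree ?N = 0" using alg_closed_imp_poly_has_root[of ?N] by auto
    then have "rat_degree (rat_comp R S) = 0" unfolding cmp D by (simp add: rat_degree_def[of "(?N, 0)"])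
    then show False using deg R S by simp
  qed
  show rat: ?rat
    using coprime_polyI[OF root D0] D0 by (simp add: rational_map_def cmp)
  obtain x y where z: "z = proj x y" and xy: "x \<noteq> 0 \<or> y \<noteq> 0" by (rule proj_exhaust)
  show ?eval
    unfolding z rat_eval_proj[OF rat xy] rat_eval_proj[OF S(1) xy]
      rat_eval_proj[OF R(1) rational_map_hom_eval[OF S(1) xy]] deg
    by (simp add: cmp hom_eval_homog_subst)
qed

lemma rat_iter:
  fixes R :: "'a::alg_closed_field ratfun"
  assumes R: "rational_map R" "rat_degree R \<ge> 1"
  shows "rational_map (rat_iter R n) \<and> rat_degree (rat_iter R n) = rat_degree R ^ n \<and>
    rat_eval (rat_iter R n) = rat_eval R ^^ n"
proof (induction n)
  case 0
  show ?case
    by (auto simp: rat_iter_def rational_map_def rat_degree_def rat_eval_def fun_eq_iff split: option.split)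
next
  case (Suc n)
  have "rat_iter R (Suc n) = rat_comp R (rat_iter R n)" by (simp add: rat_iter_def)
  moreover have "rat_degree (rat_iter R n) \<ge> 1" using Suc R by simp
  ultimately show ?case using rat_comp[OF R, of "rat_iter R n"] Suc by (auto simp: fun_eq_iff)
qed

text \<open>The finite fixed points are roots of \<open>P - T Q\<close>. If this polynomial were 0,
  coprimality would make \<open>Q\<close> constant and the degree at most 1.\<close>

lemma finite_rat_fixed_points:
  fixes S :: "'a::alg_closed_field ratfun"
  assumes S: "rational_map S" "rat_degree S \<ge> 2"
  shows "finite {z. rat_eval S z = z}"
proof -
  define F where "F = rnum S - [:0, 1:] * rden S"
  have "F \<noteq> 0"
  proof
    assume F: "F = 0"
    then have "poly (rden S) a \<noteq> 0" for a
      using rational_map_no_common_root[OF S(1), of a] by (auto simp: F_def)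
    then have "degree (rden S) = 0" using alg_closed_imp_poly_has_root[of "rden S"] by auto
    moreover have "degree (rnum S) \<le> 1 + degree (rden S)"
      using F degree_mult_le[of "[:0, 1:]" "rden S"] by (simp add: F_def)
    ultimately show False using S(2) by (simp add: rat_degree_def)
  qed
  then have "finite {a. poly F a = 0}" by (rule poly_roots_finite)
  moreover have "{z. rat_eval S z = z} \<subseteq> insert None (Some ` {a. poly F a = 0})"
  proof
    fix z assume z: "z \<in> {z. rat_eval S z = z}"
    show "z \<in> insert None (Some ` {a. poly F a = 0})"
    proof (cases z)
      case (Some a)
      then have "poly (rden S) a \<noteq> 0" "poly (rnum S) a / poly (rden S) a = a"
        using z by (auto simp: rat_eval_def split: if_splits)
      then have "poly F a = 0" by (simp add: F_def field_simps)
      then show ?thesis using Some by auto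
    qed simp
  qed
  ultimately show ?thesis by (meson finite_imageI finite_insert finite_subset)
qed

section \<open>The coordinate at infinity\<close>

definition rat_inversion :: "'a::field ratfun" where "rat_inversion = (1, [:0, 1:])"

lemma rat_inversion:
  "rational_map rat_inversion" "rat_degree (rat_inversion :: 'a::field ratfun) = 1"
  by (auto simp: rat_inversion_def rational_map_def rat_degree_def)

lemma rat_eval_inversion: "x \<noteq> 0 \<or> y \<noteq> 0 \<Longrightarrow> rat_eval rat_inversion (proj x y) = proj y x"
  by (simp add: rat_eval_proj rat_inversion) (simp add: rat_inversion_def hom_eval_def)

text \<open>\<open>R\<close> in the coordinate \<open>1 / T\<close> of the source.\<close>

abbreviation at_infinity_chart :: "'a::field ratfun \<Rightarrow> 'a ratfun" where
  "at_infinity_chart R \<equiv> rat_comp R rat_inversion"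

lemma rat_eval_at_infinity_chart:
  fixes R :: "'a::alg_closed_field ratfun"
  assumes "rational_map R" "rat_degree R \<ge> 1"
  shows "rat_eval (at_infinity_chart R) (Some a) = rat_eval R (proj 1 a)"
  using rat_comp(3)[OF assms rat_inversion(1), of "Some a"] rat_eval_inversion[of a 1]
  by (simp add: proj_def rat_inversion(2))

lemma homog_subst_inversion: "homog_subst n F rat_inversion = (\<Sum>i\<le>n. monom (coeff F i) (n - i))"
  by (simp add: homog_subst_def rat_inversion_def monom_altdef)

lemma poly_homog_subst_inversion:
  "degree F \<le> n \<Longrightarrow> a \<noteq> 0 \<Longrightarrow> poly (homog_subst n F rat_inversion) a = a ^ n * poly F (1 / a)"
  using hom_eval_affine[of F n a 1] by (simp add: poly_homog_subst) (simp add: rat_inversion_def)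

lemma poly_pderiv_sum:
  assumes "degree F \<le> n"
  shows "x * poly (pderiv F) x = (\<Sum>i\<le>n. of_nat i * coeff F i * x ^ i)"
proof -
  have "x * poly (pderiv F) x = x * poly (pderiv (\<Sum>i\<le>n. monom (coeff F i) i)) x"
    using poly_as_sum_of_monoms'[OF assms] by simp
  also have "\<dots> = (\<Sum>i\<le>n. x * (of_nat i * coeff F i * x ^ (i - 1)))"
    by (simp add: pderiv_sum_monom poly_sum poly_monom sum_distrib_left)
  also have "\<dots> = (\<Sum>i\<le>n. of_nat i * coeff F i * x ^ i)"
  proof (rule sum.cong)
    fix i show "x * (of_nat i * coeff F i * x ^ (i - 1)) = of_nat i * coeff F i * x ^ i"
      by (cases i) (auto simp: mult_ac)
  qed simp
  finally show ?thesis .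
qed

lemma pderiv_homog_subst_inversion:
  assumes F: "degree F \<le> n" and a: "a \<noteq> 0"
  shows "a * poly (pderiv (homog_subst n F rat_inversion)) a
    = of_nat n * (a ^ n * poly F (1 / a)) - a ^ n * (1 / a * poly (pderiv F) (1 / a))"
proof -
  have "a * poly (pderiv (homog_subst n F rat_inversion)) a
      = (\<Sum>i\<le>n. a * (of_nat (n - i) * coeff F i * a ^ (n - i - 1)))"
    by (simp add: homog_subst_inversion pderiv_sum_monom poly_sum poly_monom sum_distrib_left)
  also have "\<dots> = (\<Sum>i\<le>n. of_nat n * (a ^ n * (coeff F i * (1 / a) ^ i)) - a ^ n * (of_nat i * coeff F i * (1 / a) ^ i))"
  proof (rule sum.cong)
    fix i assume i: "i \<in> {..n}"
    have "a ^ n = a ^ (n - i) * a ^ i" using i by (simp add: power_add[symmetric])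
    then have an: "a ^ n * (1 / a) ^ i = a ^ (n - i)" using a by (simp add: power_one_over)
    have "a * (of_nat (n - i) * coeff F i * a ^ (n - i - 1)) = of_nat (n - i) * coeff F i * a ^ (n - i)"
      by (cases "n - i") auto
    also have "\<dots> = of_nat n * (coeff F i * (a ^ n * (1 / a) ^ i)) - of_nat i * coeff F i * (a ^ n * (1 / a) ^ i)"
      unfolding an using i by (simp add: of_nat_diff algebra_simps)
    finally show "a * (of_nat (n - i) * coeff F i * a ^ (n - i - 1)) =
        of_nat n * (a ^ n * (coeff F i * (1 / a) ^ i)) - a ^ n * (of_nat i * coeff F i * (1 / a) ^ i)"
      by (simp add: mult_ac)
  qed simp
  also have "\<dots> = of_nat n * (a ^ n * poly F (1 / a)) - a ^ n * (1 / a * poly (pderiv F) (1 / a))"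
    unfolding poly_pderiv_sum[OF F, of "1 / a"] poly_eq_sum[OF F, of "1 / a"]
    by (simp add: sum_subtractf sum_distrib_left)
  finally show ?thesis .
qed

text \<open>The chain rule for \<open>1 / T\<close> with denominators cleared by powers of
  \<open>a\<close>. Clearing them produces terms that carry the integer \<open>d\<close>, and these
  cancel in the Wronskian.\<close>

lemma poly_deriv_num_at_infinity:
  assumes a: "a \<noteq> 0" and d: "rat_degree R = d" "d \<ge> 1"
  shows "poly (rat_deriv_num (at_infinity_chart R)) a = - (a ^ (2 * d - 2) * poly (rat_deriv_num R) (1 / a))"
proof -
  have deg: "degree (rnum R) \<le> d" "degree (rden R) \<le> d" using d(1) by (auto simp: rat_degree_def)
  define P Q p q where "P = poly (rnum R) (1 / a)" "Q = poly (rden R) (1 / a)"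
    "p = poly (pderiv (rnum R)) (1 / a)" "q = poly (pderiv (rden R)) (1 / a)"
  define N1 D1 where "N1 = homog_subst d (rnum R) rat_inversion" "D1 = homog_subst d (rden R) rat_inversion"
  have "a * poly (rat_deriv_num (at_infinity_chart R)) a
      = (a * poly (pderiv N1) a) * poly D1 a - poly N1 a * (a * poly (pderiv D1) a)"
    by (simp add: rat_deriv_num_def rat_comp_def d N1_D1_def algebra_simps)
  also have "\<dots> = (of_nat d * (a ^ d * P) - a ^ d * (1 / a * p)) * (a ^ d * Q) - (a ^ d * P) * (of_nat d * (a ^ d * Q) - a ^ d * (1 / a * q))"
    using pderiv_homog_subst_inversion[OF deg(1) a] pderiv_homog_subst_inversion[OF deg(2) a]
      poly_homog_subst_inversion[OF deg(1) a] poly_homog_subst_inversion[OF deg(2) a]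
    by (simp only: P_Q_p_q_def N1_D1_def)
  also have "\<dots> = - (a ^ d * a ^ d * (1 / a) * (p * Q - P * q))"
  proof -
    have "(n * (t * P) - t * (u * p)) * (t * Q) - (t * P) * (n * (t * Q) - t * (u * q)) = - (t * t * u * (p * Q - P * q))"
      for n t u :: 'a
      by (simp add: algebra_simps)
    then show ?thesis by blast
  qed
  also have "a ^ d * a ^ d * (1 / a) = a * a ^ (2 * d - 2)"
  proof -
    obtain k where "d = Suc k" using d(2) by (cases d) auto
    then show ?thesis using a by (simp add: power_add[symmetric] mult_2)
  qed
  also have "- (a * a ^ (2 * d - 2) * (p * Q - P * q)) = a * - (a ^ (2 * d - 2) * (p * Q - P * q))" by simp
  finally have "poly (rat_deriv_num (at_infinity_chart R)) a = - (a ^ (2 * d - 2) * (p * Q - P * q))"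
    by (rule mult_left_cancel[OF a, THEN iffD1])
  then show ?thesis by (simp add: rat_deriv_num_def P_Q_p_q_def)
qed

subsection \<open>The spherical metric on the classical projective line\<close>

context complete_nonarch_field
begin

lemma ex_small:
  assumes "e > 0"
  shows "\<exists>h. 0 < v h \<and> v h < e"
proof -
  obtain x where x: "x \<noteq> 0" "v x \<noteq> 1" using nontrivial by blast
  have "\<exists>y. y \<noteq> 0 \<and> v y < 1"
  proof (cases "v x < 1")
    case False
    then have "v (1 / x) < 1" using x by (simp add: v_divide)
    then show ?thesis using x by (intro exI[of _ "1 / x"]) simp
  qed (use x in blast)
  then obtain y where y: "y \<noteq> 0" "v y < 1" by blast
  then have "(\<lambda>n. v y ^ n) \<longlonglongrightarrow> 0" using nonneg[of y] by (intro LIMSEQ_power_zero) auto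
  from order_tendstoD(2)[OF this assms] obtain n where "v y ^ n < e"
    unfolding eventually_sequentially by blast
  then show ?thesis using y v_pos[of y] by (intro exI[of _ "y ^ n"]) (simp add: v_power)
qed

definition vnorm :: "'a \<Rightarrow> 'a \<Rightarrow> real" where "vnorm x y = max (v x) (v y)"

lemma vnorm_pos: "x \<noteq> 0 \<or> y \<noteq> 0 \<Longrightarrow> vnorm x y > 0"
  using v_pos[of x] v_pos[of y] by (auto simp: vnorm_def less_max_iff_disj)

lemma vnorm_scale: "vnorm (t * x) (t * y) = v t * vnorm x y"
  using nonneg[of t] by (simp add: vnorm_def mult max_mult_distrib_left)

text \<open>The chordal metric; \<open>pdist_proj\<close> gives its homogeneous form, a two-by-two
  minor divided by two norms.\<close>

definition pdist :: "'a option \<Rightarrow> 'a option \<Rightarrow> real" where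
  "pdist z w = (case z of
     None \<Rightarrow> (case w of None \<Rightarrow> 0 | Some b \<Rightarrow> 1 / max 1 (v b))
   | Some a \<Rightarrow> (case w of None \<Rightarrow> 1 / max 1 (v a) | Some b \<Rightarrow> v (a - b) / (max 1 (v a) * max 1 (v b))))"

lemma pdist_proj:
  assumes xy: "x \<noteq> 0 \<or> y \<noteq> 0" and xy': "x' \<noteq> 0 \<or> y' \<noteq> 0"
  shows "pdist (proj x y) (proj x' y') = v (x * y' - x' * y) / (vnorm x y * vnorm x' y')"
proof -
  have n: "vnorm x y = v y * max 1 (v (x / y))" if "y \<noteq> 0" for x y
    using vnorm_scale[of y "x / y" 1] that by (simp add: vnorm_def max.commute)
  have n0: "vnorm x 0 = v x" for x using nonneg[of x] by (simp add: vnorm_def)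
  consider "y = 0" "y' = 0" | "y = 0" "y' \<noteq> 0" | "y \<noteq> 0" "y' = 0" | "y \<noteq> 0" "y' \<noteq> 0" by blast
  then show ?thesis
  proof cases
    case 1
    then show ?thesis by (simp add: proj_def pdist_def)
  next
    case 2
    then have "v x > 0" "v y' > 0" using xy v_pos by auto
    then show ?thesis using 2 by (simp add: proj_def pdist_def n n0 mult)
  next
    case 3
    then have "v x' > 0" "v y > 0" using xy' v_pos by auto
    then show ?thesis using 3 by (simp add: proj_def pdist_def n n0 mult)
  next
    case 4
    then have *: "v y > 0" "v y' > 0" using v_pos by auto
    have "x * y' - x' * y = (y * y') * (x / y - x' / y')" using 4 by (simp add: field_simps)
    then have "v (x * y' - x' * y) = (v y * v y') * v (x / y - x' / y')" by (simp only: mult)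
    then show ?thesis using 4 * by (simp add: proj_def pdist_def n)
  qed
qed

lemma pdist_nonneg: "pdist z w \<ge> 0"
  using nonneg by (auto simp: pdist_def split: option.split)

lemma pdist_eq_0: "pdist z w = 0 \<longleftrightarrow> z = w"
proof (cases "z = None \<or> w = None")
  case False
  then obtain a b where "z = Some a" "w = Some b" by auto
  moreover have "max 1 (v a) \<noteq> 0" for a by linarith
  ultimately show ?thesis using eq_0_iff[of "a - b"] by (simp add: pdist_def)
next
  case True
  have "max 1 (v a) \<noteq> 0" for a by linarith
  then show ?thesis using True by (auto simp: pdist_def split: option.split)
qed

lemma pdist_sym: "pdist z w = pdist w z"
  using v_minus_commute by (auto simp: pdist_def mult.commute split: option.split)

text \<open>The Pluecker relation between the three two-by-two minors.\<close>

lemma pdist_ultra: "pdist z w \<le> max (pdist z u) (pdist u w)"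
proof -
  obtain x1 x2 where x: "z = proj x1 x2" "x1 \<noteq> 0 \<or> x2 \<noteq> 0" by (rule proj_exhaust)
  obtain y1 y2 where y: "u = proj y1 y2" "y1 \<noteq> 0 \<or> y2 \<noteq> 0" by (rule proj_exhaust)
  obtain z1 z2 where z: "w = proj z1 z2" "z1 \<noteq> 0 \<or> z2 \<noteq> 0" by (rule proj_exhaust)
  define X Y Z where "X = vnorm x1 x2" "Y = vnorm y1 y2" "Z = vnorm z1 z2"
  have pos: "X > 0" "Y > 0" "Z > 0" using vnorm_pos x y z by (auto simp: X_Y_Z_def)
  define xz xy yz where "xz = x1 * z2 - z1 * x2" "xy = x1 * y2 - y1 * x2" "yz = y1 * z2 - z1 * y2"
  have b: "v x1 \<le> X" "v x2 \<le> X" "v z1 \<le> Z" "v z2 \<le> Z" by (auto simp: X_Y_Z_def vnorm_def)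
  have *: "v (t * xz) \<le> max (X * v yz) (Z * v xy)"
    if "t * xz = x * yz + z * xy" "v x \<le> X" "v z \<le> Z" for t x z
  proof -
    have "v (t * xz) \<le> max (v (x * yz)) (v (z * xy))" unfolding that(1) by (rule ultrametric)
    also have "\<dots> \<le> max (X * v yz) (Z * v xy)"
      using that unfolding mult by (intro max.mono mult_right_mono nonneg) auto
    finally show ?thesis .
  qed
  have "v (y1 * xz) \<le> max (X * v yz) (Z * v xy)" "v (y2 * xz) \<le> max (X * v yz) (Z * v xy)"
    by (rule *[of _ x1 z1]; use b in \<open>simp add: xz_xy_yz_def algebra_simps\<close>)
       (rule *[of _ x2 z2]; use b in \<open>simp add: xz_xy_yz_def algebra_simps\<close>)
  then have "Y * v xz \<le> max (X * v yz) (Z * v xy)"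
    by (simp add: X_Y_Z_def vnorm_def mult max_mult_distrib_right nonneg)
  then have "Y * v xz / (X * Y * Z) \<le> max (X * v yz) (Z * v xy) / (X * Y * Z)"
    using pos by (intro divide_right_mono) auto
  also have "\<dots> = max (X * v yz / (X * Y * Z)) (Z * v xy / (X * Y * Z))"
    using pos by (simp add: max_divide_distrib_right)
  finally have "v xz / (X * Z) \<le> max (v yz / (Y * Z)) (v xy / (X * Y))"
    using pos by (simp add: mult_ac)
  then show ?thesis
    using x y z by (simp add: pdist_proj X_Y_Z_def[symmetric] xz_xy_yz_def[symmetric] max.commute)
qed

lemma pdist_charts:
  assumes "v a \<le> 1" "v b \<le> 1"
  shows "pdist (proj a 1) (proj b 1) = v (a - b)" "pdist (proj 1 a) (proj 1 b) = v (a - b)"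
  using pdist_proj[of a 1 b 1] pdist_proj[of 1 a 1 b] assms v_minus_commute
  by (auto simp: vnorm_def max_def)

definition unit_disc :: "'a option set" where "unit_disc = {proj a 1 |a. v a \<le> 1}"

lemma not_unit_disc: "z \<notin> unit_disc \<Longrightarrow> \<exists>a. v a < 1 \<and> z = proj 1 a"
proof (cases z)
  case None
  then show ?thesis by (intro exI[of _ 0]) (simp add: proj_def)
next
  case (Some b)
  assume "z \<notin> unit_disc"
  then have "v b > 1" using Some by (force simp: unit_disc_def proj_def)
  then have "b \<noteq> 0" "v (1 / b) < 1" by (auto simp: v_divide)
  then show ?thesis using Some by (intro exI[of _ "1 / b"]) (simp add: proj_def)
qed

lemma pdist_unit_disc:
  assumes "z \<in> unit_disc" "w \<notin> unit_disc"
  shows "pdist z w = 1"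
proof -
  obtain a where a: "v a \<le> 1" "z = proj a 1" using assms by (auto simp: unit_disc_def)
  obtain b where b: "v b < 1" "w = proj 1 b" using not_unit_disc[OF assms(2)] by blast
  have "v a * v b \<le> 1 * v b" using a nonneg by (intro mult_right_mono) auto
  then have "v (- (a * b)) < v 1" using b by (simp add: mult)
  then have "v (- (a * b) + 1) = 1" using v_isosceles by fastforce
  then have "v (a * b - 1) = 1" using v_minus_commute[of 1 "a * b"] by simp
  then show ?thesis using a b pdist_proj[of a 1 1 b] by (simp add: vnorm_def max_def)
qed

text \<open>The unit disc and its complement are at distance 1, so two closer points lie in one of
  the charts \<open>T\<close> and \<open>1 / T\<close>. Both charts are isometric on the unit disc,
  which reduces local estimates to that disc.\<close>

lemma pdist_less_1:
  assumes "pdist z w < 1"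
  shows "(\<exists>a b. v a \<le> 1 \<and> v b \<le> 1 \<and> z = proj a 1 \<and> w = proj b 1) \<or>
    (\<exists>a b. v a \<le> 1 \<and> v b \<le> 1 \<and> z = proj 1 a \<and> w = proj 1 b)"
proof (cases "z \<in> unit_disc")
  case True
  then have "w \<in> unit_disc" using pdist_unit_disc assms by fastforce
  then show ?thesis using True by (auto simp: unit_disc_def)
next
  case False
  then have "w \<notin> unit_disc" using pdist_unit_disc[of w z] pdist_sym[of z w] assms by fastforce
  then show ?thesis using False not_unit_disc by (meson less_imp_le)
qed

lemma ex_close:
  assumes "e > 0"
  shows "\<exists>w. 0 < pdist z w \<and> pdist z w < e"
proof -
  obtain h where h: "0 < v h" "v h < min e 1" using ex_small[of "min e 1"] assms by auto
  have le: "v (a - h) \<le> 1" if "v a \<le> 1" for a using v_diff_le[of a h] that h by linarith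
  show ?thesis
  proof (cases "z \<in> unit_disc")
    case True
    then obtain a where "v a \<le> 1" "z = proj a 1" by (auto simp: unit_disc_def)
    then show ?thesis using pdist_charts(1)[of a "a - h"] le h by (intro exI[of _ "proj (a - h) 1"]) auto
  next
    case False
    then obtain a where "v a \<le> 1" "z = proj 1 a" using not_unit_disc by (meson less_imp_le)
    then show ?thesis using pdist_charts(2)[of a "a - h"] le h by (intro exI[of _ "proj 1 (a - h)"]) auto
  qed
qed

text \<open>A tail of the sequence stays in one chart, where completeness of the field
  applies.\<close>

lemma pdist_complete:
  fixes X :: "nat \<Rightarrow> 'a option"
  assumes lim: "(\<lambda>k. pdist (X k) (X (Suc k))) \<longlonglongrightarrow> 0"
  shows "\<exists>l. (\<lambda>k. pdist (X k) l) \<longlonglongrightarrow> 0"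
proof -
  from order_tendstoD(2)[OF lim, of 1] obtain N where N: "\<And>k. k \<ge> N \<Longrightarrow> pdist (X k) (X (Suc k)) < 1"
    unfolding eventually_sequentially by auto
  have same: "X (N + k) \<in> unit_disc \<longleftrightarrow> X N \<in> unit_disc" for k
  proof (induction k)
    case (Suc k)
    have "X (Suc (N + k)) \<in> unit_disc \<longleftrightarrow> X (N + k) \<in> unit_disc"
      using N[of "N + k"] pdist_unit_disc[of "X (N + k)" "X (Suc (N + k))"]
        pdist_unit_disc[of "X (Suc (N + k))" "X (N + k)"] pdist_sym[of "X (N + k)" "X (Suc (N + k))"] by fastforce
    then show ?case using Suc by simp
  qed simp
  define ch where "ch a = (if X N \<in> unit_disc then proj a 1 else proj 1 a)" for a :: 'a
  have ch: "pdist (ch a) (ch b) = v (a - b)" if "v a \<le> 1" "v b \<le> 1" for a b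
    using pdist_charts[OF that] by (simp add: ch_def)
  have "\<exists>a. v a \<le> 1 \<and> X (N + k) = ch a" for k
  proof (cases "X N \<in> unit_disc")
    case True
    then show ?thesis using same[of k] by (auto simp: unit_disc_def ch_def)
  next
    case False
    then obtain a where "v a < 1" "X (N + k) = proj 1 a"
      using same[of k] not_unit_disc[of "X (N + k)"] by blast
    then show ?thesis using False by (intro exI[of _ a]) (simp add: ch_def)
  qed
  then obtain a where a: "\<And>k. v (a k) \<le> 1" "\<And>k. X (N + k) = ch (a k)" by metis
  have "(\<lambda>k. pdist (X (N + k)) (X (Suc (N + k)))) \<longlonglongrightarrow> 0"
    using LIMSEQ_ignore_initial_segment[OF lim, of N] by (simp add: add.commute)
  moreover have "pdist (X (N + k)) (X (Suc (N + k))) = v (a k - a (Suc k))" for k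
    using ch[OF a(1)[of k] a(1)[of "Suc k"]] a(2)[of k] a(2)[of "Suc k"] by simp
  ultimately obtain l where l: "(\<lambda>k. v (a k - l)) \<longlonglongrightarrow> 0" using v_complete by auto
  from order_tendstoD(2)[OF l, of 1] obtain k0 where "v (a k0 - l) < 1"
    unfolding eventually_sequentially by auto
  then have "v l \<le> 1" using v_diff_le[of "a k0" "a k0 - l"] a(1)[of k0] by simp
  then have "pdist (X (N + k)) (ch l) = v (a k - l)" for k
    using ch[OF a(1)] a(2) by simp
  then have "(\<lambda>k. pdist (X (k + N)) (ch l)) \<longlonglongrightarrow> 0" using l by (simp add: add.commute)
  then show ?thesis using LIMSEQ_offset[of "\<lambda>k. pdist (X k) (ch l)"] by blast
qed

section \<open>Taylor estimates and the spherical derivative\<close>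

lemma poly_lipschitz:
  assumes x: "v x \<le> 1" and y: "v y \<le> 1"
  shows "v (poly F y) \<le> gauss 1 F"
    and "v (poly F x - poly F y) \<le> gauss 1 F * v (x - y)"
    and "v (poly F x - poly F y - poly (pderiv F) y * (x - y)) \<le> gauss 1 F * v (x - y) ^ 2"
proof -
  \<comment> \<open>The three bounds are proved together: in Horner's scheme the bound of each order
    for \<open>pCons c G\<close> uses those of the same and of the preceding order for
    \<open>G\<close>.\<close>
  have "v (poly F y) \<le> gauss 1 F \<and> v (poly F x - poly F y) \<le> gauss 1 F * v (x - y) \<and>
    v (poly F x - poly F y - poly (pderiv F) y * (x - y)) \<le> gauss 1 F * v (x - y) ^ 2"
  proof (induction F)
    case 0
    then show ?case by (simp add: gauss_def)
  next
    case (pCons c G)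
    define h where "h = x - y"
    define g where "g = gauss 1 G"
    have IH: "v (poly G y) \<le> g" "v (poly G x - poly G y) \<le> g * v h"
      "v (poly G x - poly G y - poly (pderiv G) y * h) \<le> g * v h ^ 2"
      using pCons by (auto simp: h_def g_def)
    have g: "g \<le> gauss 1 (pCons c G)" "v c \<le> gauss 1 (pCons c G)"
      using gauss_pCons_ge[of 1] by (auto simp: g_def)
    have g0: "g \<ge> 0" using gauss_nonneg by (simp add: g_def)
    have le: "v (t * u) \<le> B" if "v t \<le> 1" "v u \<le> B" for t u B
      using mult_mono[OF that _ nonneg] by (simp add: mult)
    have 1: "v (poly (pCons c G) y) \<le> gauss 1 (pCons c G)"
      using ultrametric[of c "y * poly G y"] le[OF y IH(1)] g by simp
    have "poly (pCons c G) x - poly (pCons c G) y = x * (poly G x - poly G y) + h * poly G y"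
      by (simp add: h_def algebra_simps)
    moreover have "v (h * poly G y) \<le> g * v h" using mult_left_mono[OF IH(1) nonneg[of h]] by (simp add: mult mult.commute)
    ultimately have "v (poly (pCons c G) x - poly (pCons c G) y) \<le> g * v h"
      using ultrametric[of "x * (poly G x - poly G y)" "h * poly G y"] le[OF x IH(2)] by simp
    then have 2: "v (poly (pCons c G) x - poly (pCons c G) y) \<le> gauss 1 (pCons c G) * v h"
      using g(1) mult_right_mono[OF g(1) nonneg[of h]] by simp
    have "poly (pCons c G) x - poly (pCons c G) y - poly (pderiv (pCons c G)) y * h
        = y * (poly G x - poly G y - poly (pderiv G) y * h) + h * (poly G x - poly G y)"
      by (simp add: pderiv_pCons h_def algebra_simps)
    moreover have "v (h * (poly G x - poly G y)) \<le> g * v h ^ 2"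
      using mult_left_mono[OF IH(2) nonneg[of h]] by (simp add: mult power2_eq_square mult_ac)
    ultimately have "v (poly (pCons c G) x - poly (pCons c G) y - poly (pderiv (pCons c G)) y * h) \<le> g * v h ^ 2"
      using ultrametric[of "y * (poly G x - poly G y - poly (pderiv G) y * h)" "h * (poly G x - poly G y)"]
        le[OF y IH(3)] by simp
    then have 3: "v (poly (pCons c G) x - poly (pCons c G) y - poly (pderiv (pCons c G)) y * h)
        \<le> gauss 1 (pCons c G) * v h ^ 2"
      using mult_right_mono[OF g(1), of "v h ^ 2"] by simp
    show ?case using 1 2 3 by (simp add: h_def)
  qed
  then show "v (poly F y) \<le> gauss 1 F" "v (poly F x - poly F y) \<le> gauss 1 F * v (x - y)"
    "v (poly F x - poly F y - poly (pderiv F) y * (x - y)) \<le> gauss 1 F * v (x - y) ^ 2" by auto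
qed

text \<open>The spherical derivative on the unit disc. Being homogeneous in numerator and
  denominator, it makes sense at poles too.\<close>

definition disc_deriv :: "'a ratfun \<Rightarrow> 'a \<Rightarrow> real" where
  "disc_deriv R a = v (poly (rat_deriv_num R) a) / vnorm (poly (rnum R) a) (poly (rden R) a) ^ 2"

text \<open>A Bezout identity \<open>A P + B Q = 1\<close> prevents both values from being small. It
  replaces compactness, which the unit disc lacks.\<close>

lemma vnorm_lower_bound:
  assumes "rational_map R"
  shows "\<exists>c>0. \<forall>a. v a \<le> 1 \<longrightarrow> c \<le> vnorm (poly (rnum R) a) (poly (rden R) a)"
proof -
  obtain A B where AB: "A * rnum R + B * rden R = 1"
    using coprime_poly_bezout assms unfolding rational_map_def by blast
  define m where "m = max 1 (max (gauss 1 A) (gauss 1 B))"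
  have "1 / m \<le> vnorm (poly (rnum R) a) (poly (rden R) a)" if a: "v a \<le> 1" for a
  proof -
    let ?n = "vnorm (poly (rnum R) a) (poly (rden R) a)"
    have "v (poly A a) \<le> m" "v (poly B a) \<le> m"
      using poly_lipschitz(1)[OF a a, of A] poly_lipschitz(1)[OF a a, of B] by (auto simp: m_def)
    then have "v (poly A a * poly (rnum R) a) \<le> m * ?n" "v (poly B a * poly (rden R) a) \<le> m * ?n"
      unfolding mult using nonneg by (auto intro!: mult_mono simp: vnorm_def m_def)
    moreover have "poly A a * poly (rnum R) a + poly B a * poly (rden R) a = 1"
      using arg_cong[OF AB, of "\<lambda>F. poly F a"] by simp
    ultimately have "1 \<le> m * ?n"
      using ultrametric[of "poly A a * poly (rnum R) a" "poly B a * poly (rden R) a"] by simp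
    then show ?thesis by (simp add: m_def field_simps)
  qed
  moreover have "1 / m > 0" by (simp add: m_def)
  ultimately show ?thesis by blast
qed

text \<open>Taylor expansion of the minor \<open>P(x) Q(y) - P(y) Q(x)\<close>: the linear
  coefficient is the Wronskian and the rest is quadratic in \<open>x - y\<close>. All larger
  \<open>C\<close> are included so that the two charts can share one constant.\<close>

lemma disc_estimate:
  assumes R: "rational_map R"
  shows "\<exists>r0>0. \<exists>C0\<ge>0. \<forall>C\<ge>C0. \<forall>x y. v x \<le> 1 \<longrightarrow> v y \<le> 1 \<longrightarrow> v (x - y) < r0 \<longrightarrow>
    pdist (rat_eval R (proj x 1)) (rat_eval R (proj y 1)) \<le> max (disc_deriv R y) (C * v (x - y)) * v (x - y) \<and>
    disc_deriv R x \<le> max (disc_deriv R y) (C * v (x - y)) \<and>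
    (C * v (x - y) < disc_deriv R y \<longrightarrow>
      pdist (rat_eval R (proj x 1)) (rat_eval R (proj y 1)) = disc_deriv R y * v (x - y))"
proof -
  define P Q W where "P = rnum R" "Q = rden R" "W = rat_deriv_num R"
  obtain c where c: "c > 0" "\<And>a. v a \<le> 1 \<Longrightarrow> c \<le> vnorm (poly P a) (poly Q a)"
    using vnorm_lower_bound[OF R] by (auto simp: P_Q_W_def)
  define m where "m = max 1 (max (gauss 1 W) (max (gauss 1 P) (gauss 1 Q)))"
  have m: "m \<ge> 1" "gauss 1 P \<le> m" "gauss 1 Q \<le> m" "gauss 1 W \<le> m" by (auto simp: m_def)
  define C0 where "C0 = m ^ 2 / c ^ 2"
  \<comment> \<open>Within this distance \<open>P\<close> and \<open>Q\<close> vary by less than the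
    lower bound \<open>c\<close> of their norm, so that norm is the same at \<open>x\<close> and
    \<open>y\<close>.\<close>
  define r0 where "r0 = c / m"
  have mm: "m \<le> m ^ 2" using m(1) by (simp add: power2_eq_square)
  have "pdist (rat_eval R (proj x 1)) (rat_eval R (proj y 1)) \<le> max (disc_deriv R y) (C * v (x - y)) * v (x - y) \<and>
    disc_deriv R x \<le> max (disc_deriv R y) (C * v (x - y)) \<and>
    (C * v (x - y) < disc_deriv R y \<longrightarrow>
      pdist (rat_eval R (proj x 1)) (rat_eval R (proj y 1)) = disc_deriv R y * v (x - y))"
    if x: "v x \<le> 1" and y: "v y \<le> 1" and xy: "v (x - y) < r0" and CC: "C \<ge> C0" for C x y
  proof -
    have "C0 \<ge> 0" by (simp add: C0_def)
    then have C: "C \<ge> 0" using CC by linarith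
    define h where "h = x - y"
    define n where "n = vnorm (poly P y) (poly Q y)"
    have n: "n \<ge> c" using c(2)[OF y] by (simp add: n_def)
    have n0: "n > 0" using n c by simp
    have "m * v h < c" using xy m(1) by (simp add: r0_def h_def field_simps)
    then have small: "v (poly F x - poly F y) < c" if "gauss 1 F \<le> m" for F
      using poly_lipschitz(2)[OF x y, of F] mult_right_mono[OF that nonneg[of h]] by (simp add: h_def)
    have nx: "vnorm (poly P x) (poly Q x) = n"
    proof -
      have le: "vnorm (poly P x) (poly Q x) \<le> max (vnorm (poly P y) (poly Q y)) (max (v (poly P x - poly P y)) (v (poly Q x - poly Q y)))" for x y
        using ultrametric[of "poly P x - poly P y" "poly P y"] ultrametric[of "poly Q x - poly Q y" "poly Q y"]
        unfolding vnorm_def by simp linarith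
      have s: "max (v (poly P x - poly P y)) (v (poly Q x - poly Q y)) < c" using small m by simp
      then have s': "max (v (poly P y - poly P x)) (v (poly Q y - poly Q x)) < c" using v_minus_commute by metis
      show ?thesis
        using le[of x y] le[of y x] s s' n c(2)[OF x] unfolding n_def by linarith
    qed
    define T where "T = poly P x * poly Q y - poly P y * poly Q x"
    define p where "p = poly P x - poly P y - poly (pderiv P) y * h"
    define q where "q = poly Q x - poly Q y - poly (pderiv Q) y * h"
    define E where "E = p * poly Q y - poly P y * q"
    have T: "T = E + poly W y * h"
      by (simp add: T_def E_def p_def q_def P_Q_W_def rat_deriv_num_def algebra_simps)
    have "v p \<le> m * v h ^ 2" "v q \<le> m * v h ^ 2"
      using poly_lipschitz(3)[OF x y, of P] poly_lipschitz(3)[OF x y, of Q] m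
        mult_right_mono[OF m(2), of "v h ^ 2"] mult_right_mono[OF m(3), of "v h ^ 2"]
      by (auto simp: p_def q_def h_def)
    moreover have "v (poly P y) \<le> m" "v (poly Q y) \<le> m"
      using poly_lipschitz(1)[OF y y, of P] poly_lipschitz(1)[OF y y, of Q] m by auto
    ultimately have "v (p * poly Q y) \<le> (m * v h ^ 2) * m" "v (poly P y * q) \<le> m * (m * v h ^ 2)"
      unfolding mult using nonneg m(1) by (auto intro!: mult_mono)
    then have "v E \<le> m ^ 2 * v h ^ 2"
      using v_diff_le[of "p * poly Q y" "poly P y * q"] by (simp add: E_def power2_eq_square mult_ac)
    also have "m ^ 2 = C0 * c ^ 2" using c by (simp add: C0_def)
    also have "C0 * c ^ 2 * v h ^ 2 \<le> C * n ^ 2 * v h ^ 2"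
      using CC C n c by (intro mult_right_mono mult_mono power_mono) (auto simp: C0_def)
    finally have E: "v E / n ^ 2 \<le> C * v h * v h"
      using n0 by (simp add: field_simps power2_eq_square)
    have dist: "pdist (rat_eval R (proj x 1)) (rat_eval R (proj y 1)) = v T / n ^ 2"
    proof -
      have "poly P a \<noteq> 0 \<or> poly Q a \<noteq> 0" for a
        using rational_map_no_common_root[OF R] by (simp add: P_Q_W_def)
      moreover have "rat_eval R (proj a 1) = proj (poly P a) (poly Q a)" for a
        using rat_eval_proj[OF R, of a 1] by (simp add: hom_eval_1 rat_degree_def P_Q_W_def)
      ultimately show ?thesis
        by (simp add: pdist_proj nx n_def[symmetric] power2_eq_square T_def)
    qed
    have g: "disc_deriv R y = v (poly W y) / n ^ 2" by (simp add: disc_deriv_def n_def P_Q_W_def)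
    have Wh: "v (poly W y * h) / n ^ 2 = disc_deriv R y * v h" by (simp add: g mult)
    have "v T / n ^ 2 \<le> max (v E) (v (poly W y * h)) / n ^ 2"
      unfolding T using ultrametric by (intro divide_right_mono) auto
    also have "\<dots> = max (v E / n ^ 2) (disc_deriv R y * v h)"
      using Wh by (simp add: max_divide_distrib_right)
    also have "\<dots> \<le> max (C * v h * v h) (disc_deriv R y * v h)" using E by (intro max.mono) auto
    also have "\<dots> = max (disc_deriv R y) (C * v h) * v h"
      using nonneg[of h] by (simp add: max_mult_distrib_right max.commute)
    finally have 1: "v T / n ^ 2 \<le> max (disc_deriv R y) (C * v h) * v h" .
    have "v (poly W x - poly W y) \<le> gauss 1 W * v h"
      using poly_lipschitz(2)[OF x y] by (simp add: h_def)
    also have "\<dots> \<le> m ^ 2 * v h" using m mm nonneg[of h] by (intro mult_right_mono) auto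
    also have "m ^ 2 = C0 * c ^ 2" using c by (simp add: C0_def)
    also have "C0 * c ^ 2 * v h \<le> C * n ^ 2 * v h"
      using CC C n c nonneg[of h] by (intro mult_right_mono mult_mono power_mono) (auto simp: C0_def)
    finally have "v (poly W x - poly W y) / n ^ 2 \<le> C * v h" using n0 by (simp add: field_simps)
    moreover have "disc_deriv R x \<le> max (v (poly W x - poly W y)) (v (poly W y)) / n ^ 2"
      unfolding disc_deriv_def using nx ultrametric[of "poly W x - poly W y" "poly W y"]
      by (simp add: P_Q_W_def divide_right_mono)
    ultimately have 2: "disc_deriv R x \<le> max (disc_deriv R y) (C * v h)"
      unfolding g by (simp add: max_divide_distrib_right)
    have 3: "v T / n ^ 2 = disc_deriv R y * v h" if lt: "C * v h < disc_deriv R y"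
    proof (cases "h = 0")
      case True
      then show ?thesis by (simp add: T_def h_def)
    next
      case False
      then have "C * v h * v h < disc_deriv R y * v h" using lt v_pos by simp
      then have "v E / n ^ 2 < v (poly W y * h) / n ^ 2" using E Wh by linarith
      then have "v E < v (poly W y * h)" using n0 by (simp add: divide_less_cancel)
      then have "v T = v (poly W y * h)" unfolding T by (rule v_isosceles)
      then show ?thesis using Wh by simp
    qed
    show ?thesis using 1 2 3 unfolding dist h_def by blast
  qed
  moreover have "r0 > 0" "C0 \<ge> 0" using c m by (auto simp: r0_def C0_def)
  ultimately show ?thesis by blast
qed

definition sphder :: "'a ratfun \<Rightarrow> 'a option \<Rightarrow> real" where
  "sphder R z = (case z of
     None \<Rightarrow> disc_deriv (at_infinity_chart R) 0
   | Some a \<Rightarrow> disc_deriv R a * (max 1 (v a)) ^ 2)"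

lemma sphder_chart_0: "v a \<le> 1 \<Longrightarrow> sphder R (proj a 1) = disc_deriv R a"
  by (simp add: sphder_def proj_def max_def)

text \<open>Independence of the chart: the power \<open>2 * d - 2\<close> from the Wronskian, the
  powers from the denominators and the square of \<open>max 1 (v (1 / a))\<close> cancel.\<close>

lemma sphder_chart_infinity:
  assumes d: "rat_degree R \<ge> 1" and a: "v a \<le> 1"
  shows "sphder R (proj 1 a) = disc_deriv (at_infinity_chart R) a"
proof (cases "a = 0")
  case True
  then show ?thesis by (simp add: sphder_def proj_def)
next
  case False
  define d where "d = rat_degree R"
  have va: "v a > 0" using v_pos[OF False] .
  have deg: "degree (rnum R) \<le> d" "degree (rden R) \<le> d" by (auto simp: d_def rat_degree_def)
  have m: "max 1 (v (1 / a)) = 1 / v a" using a va by (simp add: v_divide max_def field_simps)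
  have "vnorm (poly (rnum (at_infinity_chart R)) a) (poly (rden (at_infinity_chart R)) a)
      = v a ^ d * vnorm (poly (rnum R) (1 / a)) (poly (rden R) (1 / a))"
    using poly_homog_subst_inversion[OF deg(1) False] poly_homog_subst_inversion[OF deg(2) False]
    by (simp add: rat_comp_def d_def[symmetric] vnorm_scale v_power)
  moreover have "v (poly (rat_deriv_num (at_infinity_chart R)) a) = v a ^ (2 * d - 2) * v (poly (rat_deriv_num R) (1 / a))"
    using poly_deriv_num_at_infinity[OF False, of R d] d by (simp add: d_def mult v_power)
  moreover have "v a ^ (2 * d - 2) = (v a ^ d) ^ 2 * (1 / v a) ^ 2"
  proof -
    obtain k where "d = Suc k" using d by (cases d) (auto simp: d_def)
    then show ?thesis using va by (simp add: power2_eq_square power_add mult_2)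
  qed
  ultimately show ?thesis
    using False va by (simp add: sphder_def proj_def disc_deriv_def m power_mult_distrib)
qed

text \<open>The first two estimates serve the contraction argument, where errors below the
  truncation level are absorbed. The exact third one compares the multiplier of a cycle with its
  rate of contraction.\<close>

lemma sphere_estimate:
  assumes R: "rational_map R" "rat_degree R \<ge> 1"
  shows "\<exists>r0>0. \<exists>C\<ge>0. \<forall>z w. pdist z w < r0 \<longrightarrow>
    pdist (rat_eval R z) (rat_eval R w) \<le> max (sphder R w) (C * pdist z w) * pdist z w \<and>
    sphder R z \<le> max (sphder R w) (C * pdist z w) \<and>
    (C * pdist z w < sphder R w \<longrightarrow> pdist (rat_eval R z) (rat_eval R w) = sphder R w * pdist z w)"
    (is "\<exists>r0>0. \<exists>C\<ge>0. \<forall>z w. pdist z w < r0 \<longrightarrow> ?P C z w")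
proof -
  let ?R = "at_infinity_chart R"
  have R': "rational_map ?R" using rat_comp(1)[OF R rat_inversion(1)] by (simp add: rat_inversion(2))
  obtain r1 C1 where est1: "r1 > 0" "C1 \<ge> 0" "\<And>C x y. C \<ge> C1 \<Longrightarrow> v x \<le> 1 \<Longrightarrow> v y \<le> 1 \<Longrightarrow> v (x - y) < r1 \<Longrightarrow>
    pdist (rat_eval R (proj x 1)) (rat_eval R (proj y 1)) \<le> max (disc_deriv R y) (C * v (x - y)) * v (x - y) \<and>
    disc_deriv R x \<le> max (disc_deriv R y) (C * v (x - y)) \<and>
    (C * v (x - y) < disc_deriv R y \<longrightarrow>
      pdist (rat_eval R (proj x 1)) (rat_eval R (proj y 1)) = disc_deriv R y * v (x - y))"
    using disc_estimate[OF R(1)] by blast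
  obtain r2 C2 where est2: "r2 > 0" "C2 \<ge> 0" "\<And>C x y. C \<ge> C2 \<Longrightarrow> v x \<le> 1 \<Longrightarrow> v y \<le> 1 \<Longrightarrow> v (x - y) < r2 \<Longrightarrow>
    pdist (rat_eval ?R (proj x 1)) (rat_eval ?R (proj y 1)) \<le> max (disc_deriv ?R y) (C * v (x - y)) * v (x - y) \<and>
    disc_deriv ?R x \<le> max (disc_deriv ?R y) (C * v (x - y)) \<and>
    (C * v (x - y) < disc_deriv ?R y \<longrightarrow>
      pdist (rat_eval ?R (proj x 1)) (rat_eval ?R (proj y 1)) = disc_deriv ?R y * v (x - y))"
    using disc_estimate[OF R'] by blast
  have ev: "rat_eval ?R (proj x 1) = rat_eval R (proj 1 x)" for x
    using rat_eval_at_infinity_chart[OF R, of x] by (simp add: proj_def)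
  define r0 where "r0 = min 1 (min r1 r2)"
  define C where "C = max C1 C2"
  have "?P C z w" if zw: "pdist z w < r0" for z w
  proof -
    have "pdist z w < 1" using zw by (simp add: r0_def)
    from pdist_less_1[OF this] consider
      a b where "v a \<le> 1" "v b \<le> 1" "z = proj a 1" "w = proj b 1" |
      a b where "v a \<le> 1" "v b \<le> 1" "z = proj 1 a" "w = proj 1 b" by blast
    then show ?thesis
    proof cases
      case (1 a b)
      then have "pdist z w = v (a - b)" using pdist_charts(1) by simp
      then show ?thesis
        using est1(3)[of C a b] zw 1 sphder_chart_0[of a R] sphder_chart_0[of b R] by (simp add: r0_def C_def)
    next
      case (2 a b)
      then have "pdist z w = v (a - b)" using pdist_charts(2) by simp
      then show ?thesis
        using est2(3)[of C a b] zw 2 sphder_chart_infinity[OF R(2)] by (simp add: r0_def C_def ev)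
    qed
  qed
  moreover have "r0 > 0" "C \<ge> 0" using est1(1,2) est2(1,2) by (auto simp: r0_def C_def)
  ultimately show ?thesis by blast
qed

text \<open>If \<open>sphder S z\<close> is positive, distances to \<open>z\<close> are multiplied
  by exactly this number near \<open>z\<close>. Nontriviality of the valuation supplies points close
  enough to test it.\<close>

lemma sphder_le_contraction:
  assumes S: "rational_map S" "rat_degree S \<ge> 1" and r: "r > 0"
    and contr: "\<And>w. pdist z w < r \<Longrightarrow> pdist (rat_eval S z) (rat_eval S w) \<le> c * pdist z w"
  shows "sphder S z \<le> max 0 c"
proof (rule ccontr)
  assume not: "\<not> ?thesis"
  obtain r0 C where *: "r0 > 0" "C \<ge> 0" "\<And>z w. pdist z w < r0 \<Longrightarrow> C * pdist z w < sphder S w \<Longrightarrow>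
      pdist (rat_eval S z) (rat_eval S w) = sphder S w * pdist z w"
    using sphere_estimate[OF S] by blast
  define e where "e = min (min r r0) (sphder S z / (C + 1))"
  have "e > 0" using * r not by (simp add: e_def)
  then obtain w where w: "0 < pdist z w" "pdist z w < e" using ex_close by blast
  have "C * pdist z w \<le> (C + 1) * pdist z w" using w by simp
  also have "\<dots> < sphder S z" using w(2) *(2) by (simp add: e_def field_simps)
  finally have "pdist (rat_eval S w) (rat_eval S z) = sphder S z * pdist w z"
    using *(3)[of w z] w(2) by (simp add: e_def pdist_sym)
  then have "sphder S z * pdist z w \<le> c * pdist z w"
    using contr[of w] w(2) by (simp add: e_def pdist_sym)
  then show False using w(1) not by simp
qed

text \<open>At a fixed point the spherical factors of source and target cancel. For infinity,
  conjugating by \<open>1 / T\<close> exchanges numerator and denominator of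
  \<open>at_infinity_chart S\<close>, which changes the Wronskian only by a sign.\<close>

lemma multiplier_eq_sphder:
  assumes S: "rational_map S" "rat_degree S \<ge> 1" and z: "rat_eval S z = z"
  shows "v (fixed_point_multiplier S z) = sphder S z"
proof (cases z)
  case (Some a)
  then have Q: "poly (rden S) a \<noteq> 0" and P: "poly (rnum S) a = a * poly (rden S) a"
    using z by (auto simp: rat_eval_def field_simps split: if_splits)
  have vQ: "v (poly (rden S) a) > 0" using v_pos[OF Q] .
  have "vnorm (poly (rnum S) a) (poly (rden S) a) = v (poly (rden S) a) * max 1 (v a)"
    using vnorm_scale[of "poly (rden S) a" a 1] by (simp add: P vnorm_def mult.commute max.commute)
  moreover have "max 1 (v a) > 0" by linarith
  ultimately show ?thesis
    using Some vQ by (simp add: fixed_point_multiplier_def rat_deriv_at_def sphder_def disc_deriv_def v_divide v_power power_mult_distrib)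
next
  case None
  let ?X = "at_infinity_chart S"
  have "rat_eval ?X (Some 0) = None"
    using rat_eval_at_infinity_chart[OF S, of 0] z None by (simp add: proj_def)
  then have 0: "poly (rden ?X) 0 = 0" by (auto simp: rat_eval_def split: if_splits)
  have "rat_comp rat_inversion ?X = (rden ?X, rnum ?X)"
    by (simp add: rat_comp_def[of rat_inversion] rat_inversion(2)) (simp add: rat_inversion_def homog_subst_def)
  then have "fixed_point_multiplier S z = (poly (pderiv (rden ?X)) 0 * poly (rnum ?X) 0 - poly (rden ?X) 0 * poly (pderiv (rnum ?X)) 0) / (poly (rnum ?X) 0)\<^sup>2"
    using None by (simp add: fixed_point_multiplier_def rat_deriv_at_def rat_deriv_num_def rat_inversion_def[symmetric] Let_def)
  then have "v (fixed_point_multiplier S z) = v (poly (rat_deriv_num ?X) 0) / (v (poly (rnum ?X) 0))\<^sup>2"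
    using v_minus_commute[of "poly (pderiv (rden ?X)) 0 * poly (rnum ?X) 0"] 0
    by (simp add: v_divide v_power rat_deriv_num_def mult_ac)
  then show ?thesis
    using None 0 nonneg by (simp add: sphder_def disc_deriv_def vnorm_def)
qed

lemma infinite_UNIV: "infinite (UNIV :: 'a set)"
proof
  assume fin: "finite (UNIV :: 'a set)"
  obtain h where h: "0 < v h" "v h < 1" using ex_small[of 1] by auto
  define m where "m = Min (v ` (UNIV - {0}))"
  have "h \<in> UNIV - {0}" using h by auto
  then have "v ` (UNIV - {0::'a}) \<noteq> {}" by blast
  then have "m \<in> v ` (UNIV - {0})" unfolding m_def using fin by (intro Min_in) auto
  then obtain y where "y \<noteq> 0" "m = v y" by blast
  then have "m > 0" using v_pos by simp
  then obtain h' where h': "0 < v h'" "v h' < m" using ex_small by blast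
  then have "h' \<in> UNIV - {0}" by auto
  then have "v h' \<in> v ` (UNIV - {0})" by (rule imageI)
  then have "m \<le> v h'" unfolding m_def using fin by (intro Min_le) auto
  then show False using h' by simp
qed

text \<open>The Wronskians in the two charts determine each other at all nonzero points, and over an
  infinite field this becomes a polynomial identity. It gives the degree bound and identifies the
  top coefficient as the value at infinity.\<close>

lemma deriv_num_degree:
  fixes R :: "'a ratfun"
  assumes d: "rat_degree R = d" "d \<ge> 1"
  shows "degree (rat_deriv_num R) \<le> 2 * d - 2"
    and "coeff (rat_deriv_num R) (2 * d - 2) = - poly (rat_deriv_num (at_infinity_chart R)) 0"
proof -
  define W where "W = rat_deriv_num R"
  define W1 where "W1 = rat_deriv_num (at_infinity_chart R)"
  define n where "n = degree W1"
  define V where "V = homog_subst n W1 rat_inversion"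
  have V: "V = (\<Sum>i\<le>n. monom (coeff W1 i) (n - i))" by (simp add: V_def homog_subst_inversion)
  have degV: "degree V \<le> n" unfolding V by (intro degree_sum_le) (auto intro: order_trans[OF degree_monom_le])
  have cV: "coeff V n = poly W1 0"
  proof -
    have "coeff V n = (\<Sum>i\<le>n. if i = 0 then coeff W1 0 else 0)"
      unfolding V coeff_sum by (rule sum.cong) auto
    then show ?thesis by (simp add: poly_0_coeff_0)
  qed
  have "monom 1 n * W + monom 1 (2 * d - 2) * V = 0"
  proof (rule ccontr)
    assume "monom 1 n * W + monom 1 (2 * d - 2) * V \<noteq> 0"
    then have "finite {x. poly (monom 1 n * W + monom 1 (2 * d - 2) * V) x = 0}" by (rule poly_roots_finite)
    moreover have "UNIV - {0} \<subseteq> {x. poly (monom 1 n * W + monom 1 (2 * d - 2) * V) x = 0}"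
    proof
      fix x :: 'a assume "x \<in> UNIV - {0}"
      then have x: "x \<noteq> 0" "1 / x \<noteq> 0" by auto
      have "poly V x = x ^ n * poly W1 (1 / x)"
        unfolding V_def using x by (intro poly_homog_subst_inversion) (auto simp: n_def)
      also have "poly W1 (1 / x) = - ((1 / x) ^ (2 * d - 2) * poly W x)"
        using poly_deriv_num_at_infinity[OF x(2) d] by (simp add: W1_def W_def)
      finally show "x \<in> {x. poly (monom 1 n * W + monom 1 (2 * d - 2) * V) x = 0}"
        using x by (simp add: poly_monom power_one_over)
    qed
    ultimately show False using infinite_UNIV by (metis finite.emptyI finite_insert finite_Diff2 finite_subset)
  qed
  then have eq: "monom 1 n * W = - (monom 1 (2 * d - 2) * V)" by (simp add: eq_neg_iff_add_eq_0)
  have co: "coeff W k = - coeff V (n + k - (2 * d - 2))" if "k \<ge> 2 * d - 2" for k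
    using arg_cong[OF eq, of "\<lambda>F. coeff F (n + k)"] that by (simp add: coeff_monom_mult)
  show "degree (rat_deriv_num R) \<le> 2 * d - 2"
  proof (rule degree_le, intro allI impI)
    fix k assume k: "2 * d - 2 < k"
    then have "coeff V (n + k - (2 * d - 2)) = 0" using degV by (intro coeff_eq_0) auto
    then show "coeff (rat_deriv_num R) k = 0" using co[of k] k by (simp add: W_def)
  qed
  show "coeff (rat_deriv_num R) (2 * d - 2) = - poly (rat_deriv_num (at_infinity_chart R)) 0"
    using co[of "2 * d - 2"] cV by (simp add: W_def W1_def)
qed

end

section \<open>Dynamics on the Berkovich line\<close>

context complete_nonarch_field
begin

subsection \<open>The Berkovich line as a measurable space\<close>

abbreviation X_coord :: "'a poly" where "X_coord \<equiv> [:0, 1:]"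

lemma berk_A1_eq: "berk_A1 v = top_of_set (mult_seminorms v)"
  by (simp add: berk_A1_def euclidean_product_topology)

lemma topspace_berk_P1: "topspace (berk_P1 v) = insert None (Some ` mult_seminorms v)"
  by (simp add: berk_P1_def berk_A1_eq)

lemma openin_berk_P1_Some: "open U \<Longrightarrow> openin (berk_P1 v) (Some ` (U \<inter> mult_seminorms v))"
  using openin_open_Int[of U "mult_seminorms v"] by (simp add: berk_P1_def berk_A1_eq Int_commute)

lemma continuous_seminorm: "continuous_on S (\<lambda>s. s F)" for F :: "'a poly" and S :: "('a poly \<Rightarrow> real) set"
  by (rule continuous_on_subset[OF continuous_on_product_coordinates]) simp

lemma classical_simps:
  "classical v None = None" "classical v (Some a) = Some (\<lambda>F. v (poly F a))"
  by (simp_all add: classical_def)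

lemma eval_seminorm: "(\<lambda>F. v (poly F a)) \<in> mult_seminorms v"
proof -
  have "v (poly F a + poly G a) \<le> v (poly F a) + v (poly G a)" for F G
    using ultrametric[of "poly F a" "poly G a"] nonneg[of "poly F a"] nonneg[of "poly G a"] by linarith
  then show ?thesis by (simp add: mult_seminorms_def nonneg mult)
qed

lemma classical_in_space: "classical v z \<in> topspace (berk_P1 v)"
  by (cases z) (auto simp: classical_simps topspace_berk_P1 eval_seminorm)

lemma classical_inj: "classical v z = classical v w \<longleftrightarrow> z = w"
proof
  assume eq: "classical v z = classical v w"
  show "z = w"
  proof (cases z; cases w)
    fix a b assume ab: "z = Some a" "w = Some b"
    then have "(\<lambda>F. v (poly F a)) = (\<lambda>F. v (poly F b))" using eq by (simp add: classical_simps)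
    from fun_cong[OF this, of "[:- a, 1:]"] have "v (b - a) = 0" by simp
    then show "z = w" using ab eq_0_iff[of "b - a"] by simp
  qed (use eq in \<open>auto simp: classical_simps\<close>)
qed simp

lemma radius_eval: "radius (\<lambda>F. v (poly F a)) = 0"
  using radius_le[OF eval_seminorm[of a], of a] radius_nonneg[OF eval_seminorm[of a]] by simp

lemma radius_0_iff:
  assumes "s \<in> mult_seminorms v"
  shows "radius s = 0 \<longleftrightarrow> (\<exists>a. Some s = classical v (Some a))"
proof
  assume "radius s = 0"
  then obtain a where "s [:- a, 1:] = 0" using radius_0_imp_classical[OF assms] by blast
  then have "s = (\<lambda>F. v (poly F a))" using seminorm_classical[OF assms] by blast
  then show "\<exists>a. Some s = classical v (Some a)" by (auto simp: classical_simps)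
qed (auto simp: classical_simps radius_eval)

lemma seminorm_le_gauss: "s \<in> mult_seminorms v \<Longrightarrow> s F \<le> gauss (s X_coord) F"
  using seminorm_pcompose_le[of s F X_coord] by simp

lemma closed_mult_seminorms: "closed (mult_seminorms v)"
proof -
  have "mult_seminorms v = {s. \<forall>F G c. s F \<ge> 0 \<and> s (F + G) \<le> s F + s G \<and> s (F * G) = s F * s G \<and> s [:c:] = v c}"
    by (auto simp: mult_seminorms_def)
  moreover have "closed \<dots>"
    by (intro closed_Collect_all closed_Collect_conj closed_Collect_le closed_Collect_eq
        continuous_intros continuous_seminorm)
  ultimately show ?thesis by simp
qed

text \<open>The complement is compact by Tychonoff's theorem: a bound for \<open>s\<close> on
  \<open>T\<close> bounds \<open>s\<close> on every \<open>F\<close> by a Gauss norm, and the axioms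
  of a multiplicative seminorm are closed conditions.\<close>

lemma openin_infinity: "openin (berk_P1 v) (insert None (Some ` {s \<in> mult_seminorms v. B < s X_coord}))"
proof -
  define C where "C = {s \<in> mult_seminorms v. s X_coord \<le> B}"
  have closed: "closed C"
    unfolding C_def by (intro closed_Collect_conj closed_Collect_le continuous_intros continuous_seminorm)
      (simp add: closed_mult_seminorms)
  define K where "K = PiE UNIV (\<lambda>F. {0..gauss (max B 0) F})"
  have "compactin (product_topology (\<lambda>_. euclideanreal) UNIV) K"
    unfolding K_def by (simp add: compactin_PiE)
  then have K: "compact K" by (simp add: euclidean_product_topology)
  have "C \<subseteq> K"
  proof
    fix s assume s: "s \<in> C"
    then have ms: "s \<in> mult_seminorms v" by (simp add: C_def)
    have "s F \<le> gauss (max B 0) F" for F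
    proof -
      have "s F \<le> gauss (s X_coord) F" using ms by (rule seminorm_le_gauss)
      also have "\<dots> \<le> gauss (max B 0) F"
        using s seminorm_nonneg[OF ms] by (intro gauss_mono) (auto simp: C_def)
      finally show ?thesis .
    qed
    then show "s \<in> K" using seminorm_nonneg[OF ms] by (auto simp: K_def)
  qed
  then have "compact C" using compact_Int_closed[OF K closed] by (simp add: Int_absorb1)
  moreover have "C \<subseteq> mult_seminorms v" by (auto simp: C_def)
  ultimately have "compactin (berk_A1 v) C" "closedin (berk_A1 v) C"
    using closed by (auto simp: berk_A1_eq compactin_subtopology intro: closed_subset)
  moreover have "{s \<in> mult_seminorms v. B < s X_coord} = topspace (berk_A1 v) - C"
    by (auto simp: C_def berk_A1_eq)
  ultimately show ?thesis
    unfolding berk_P1_def openin_Alexandroff_compactification by metis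
qed

subsection \<open>The spherical derivative at classical points\<close>

lemma v_poly_tendsto:
  assumes "(\<lambda>n. v (h n)) \<longlonglongrightarrow> 0"
  shows "(\<lambda>n. v (poly F (a + h n))) \<longlonglongrightarrow> v (poly F a)"
proof (rule LIM_zero_cancel, rule Lim_null_comparison)
  define G where "G = pcompose F [:a, 1:]"
  have G: "poly F (a + x) = poly G x" for x by (simp add: G_def poly_pcompose)
  have "eventually (\<lambda>n. v (h n) < 1) sequentially" using order_tendstoD(2)[OF assms] by simp
  then show "\<forall>\<^sub>F n in sequentially. norm (v (poly F (a + h n)) - v (poly F a)) \<le> gauss 1 G * v (h n)"
  proof eventually_elim
    case (elim n)
    have "v (poly G (h n) - poly G 0) \<le> gauss 1 G * v (h n)"
      using poly_lipschitz(2)[of "h n" 0 G] elim by simp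
    moreover have "poly G 0 = poly F a" using G[of 0] by simp
    ultimately have "v (poly F (a + h n) - poly F a) \<le> gauss 1 G * v (h n)" by (simp add: G)
    moreover have "\<bar>v x - v y\<bar> \<le> v (x - y)" for x y
      using ultrametric[of "x - y" y] ultrametric[of "y - x" x] v_minus_commute[of x y] nonneg[of x] nonneg[of y] nonneg[of "x - y"]
      by simp
    ultimately show ?case by (metis order_trans real_norm_def)
  qed
  show "(\<lambda>n. gauss 1 G * v (h n)) \<longlonglongrightarrow> 0" using tendsto_mult_right_zero[OF assms] .
qed

lemma infinite_range_tail:
  assumes "0 < v h" "v h < 1"
  shows "infinite ((\<lambda>n. a + h ^ n) ` {N..})" "infinite ((\<lambda>n. (1 / h) ^ n) ` {N..})"
proof -
  have "inj (\<lambda>n. h ^ n)"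
  proof (rule injI)
    fix m n assume "h ^ m = h ^ n"
    then have "v h ^ m = v h ^ n" by (metis v_power)
    then show "m = n" using assms power_strict_decreasing[of m n "v h"] power_strict_decreasing[of n m "v h"]
      by (cases m n rule: linorder_cases) auto
  qed
  then have "inj_on (\<lambda>n. a + h ^ n) {N..}" "inj_on (\<lambda>n. (1 / h) ^ n) {N..}"
    using assms by (auto simp: inj_on_def inj_def power_one_over)
  then show "infinite ((\<lambda>n. a + h ^ n) ` {N..})" "infinite ((\<lambda>n. (1 / h) ^ n) ` {N..})"
    using infinite_Ici[of N] by (auto dest: finite_imageD)
qed

text \<open>The witnesses are \<open>a + h ^ n\<close>, or \<open>(1 / h) ^ n\<close> at infinity,
  for a fixed small \<open>h\<close>. Since classical points accumulate, the limit that defines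
  \<open>sph_deriv\<close> at poles and at infinity is unique.\<close>

lemma infinite_classical_near:
  assumes T: "openin (berk_P1 v) T" and z: "classical v z \<in> T"
  shows "infinite {b. classical v (Some b) \<in> T}"
proof -
  obtain h where h: "0 < v h" "v h < 1" using ex_small[of 1] by auto
  have h0: "(\<lambda>n. v (h ^ n)) \<longlonglongrightarrow> 0" using h by (simp add: v_power LIMSEQ_power_zero)
  show ?thesis
  proof (cases z)
    case (Some a)
    have "openin (berk_A1 v) {s \<in> topspace (berk_A1 v). Some s \<in> T}"
      using openin_continuous_map_preimage[OF continuous_map_Some T[unfolded berk_P1_def]] .
    then obtain V where V: "open V" "{s \<in> mult_seminorms v. Some s \<in> T} = mult_seminorms v \<inter> V"
      by (auto simp: berk_A1_eq openin_open)
    define e where "e n = (\<lambda>F. v (poly F (a + h ^ n)))" for n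
    have "limitin (product_topology (\<lambda>_. euclideanreal) UNIV) e (\<lambda>F. v (poly F a)) sequentially"
      unfolding limitin_componentwise using v_poly_tendsto[OF h0] by (simp add: e_def)
    then have lim: "(e \<longlongrightarrow> (\<lambda>F. v (poly F a))) sequentially" by (simp add: euclidean_product_topology)
    have "(\<lambda>F. v (poly F a)) \<in> V"
      using z Some V(2) eval_seminorm[of a] by (auto simp: classical_simps)
    then have "eventually (\<lambda>n. e n \<in> V) sequentially" using lim V(1) by (simp add: tendsto_def)
    then obtain N where N: "\<And>n. n \<ge> N \<Longrightarrow> e n \<in> V" unfolding eventually_sequentially by blast
    have "classical v (Some (a + h ^ n)) \<in> T" if "n \<ge> N" for n
      using N[OF that] V(2) eval_seminorm[of "a + h ^ n"] by (auto simp: classical_simps e_def)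
    then have "(\<lambda>n. a + h ^ n) ` {N..} \<subseteq> {b. classical v (Some b) \<in> T}" by auto
    then show ?thesis using infinite_range_tail(1)[OF h] infinite_super by blast
  next
    case None
    then have "None \<in> T" using z by (simp add: classical_simps)
    then obtain C where C: "compactin (berk_A1 v) C" "T = insert None (Some ` (mult_seminorms v - C))"
      using T by (auto simp: berk_P1_def openin_Alexandroff_compactification berk_A1_eq)
    have "compact C" using C(1) by (simp add: berk_A1_eq compactin_subtopology)
    then have "compact ((\<lambda>s. s X_coord) ` C)" by (intro compact_continuous_image continuous_seminorm)
    then have "bdd_above ((\<lambda>s. s X_coord) ` C)"
      by (intro bounded_imp_bdd_above compact_imp_bounded)
    then obtain B where B: "\<And>s. s \<in> C \<Longrightarrow> s X_coord \<le> B"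
      unfolding bdd_above_def by blast
    have lim: "(\<lambda>n. v h ^ n) \<longlonglongrightarrow> 0" using h0 by (simp add: v_power)
    have "0 < 1 / (\<bar>B\<bar> + 1)" by simp
    from order_tendstoD(2)[OF lim this] obtain N where N: "\<And>n. n \<ge> N \<Longrightarrow> v h ^ n < 1 / (\<bar>B\<bar> + 1)"
      unfolding eventually_sequentially by blast
    have "classical v (Some ((1 / h) ^ n)) \<in> T" if "n \<ge> N" for n
    proof -
      have "v ((1 / h) ^ n) = 1 / v h ^ n" by (simp add: v_power v_divide power_one_over)
      moreover have "\<bar>B\<bar> + 1 < 1 / v h ^ n" using N[OF that] h by (simp add: field_simps)
      ultimately have "\<not> v (poly X_coord ((1 / h) ^ n)) \<le> B" by simp
      then have "(\<lambda>F. v (poly F ((1 / h) ^ n))) \<notin> C" using B by fastforce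
      then show ?thesis using C(2) eval_seminorm by (auto simp: classical_simps)
    qed
    then have "(\<lambda>n. (1 / h) ^ n) ` {N..} \<subseteq> {b. classical v (Some b) \<in> T}" by auto
    then show ?thesis using infinite_range_tail(2)[OF h] infinite_super by blast
  qed
qed

lemma sph_deriv_domain_not_isolated:
  assumes Q: "rden R \<noteq> 0"
  shows "atin_within (berk_P1 v) (classical v z) (sph_deriv_domain v R) \<noteq> bot"
proof
  assume "atin_within (berk_P1 v) (classical v z) (sph_deriv_domain v R) = bot"
  then have "eventually (\<lambda>_. False) (atin_within (berk_P1 v) (classical v z) (sph_deriv_domain v R))"
    by (simp add: trivial_limit_def)
  then obtain T where T: "openin (berk_P1 v) T" "classical v z \<in> T"
    "\<And>x. x \<in> T \<Longrightarrow> x \<in> sph_deriv_domain v R \<Longrightarrow> x = classical v z"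
    unfolding eventually_atin_within using classical_in_space[of z] by blast
  have "finite ({b. poly (rden R) b = 0} \<union> {b. z = Some b})"
    using poly_roots_finite[OF Q] by (cases z) auto
  then have "\<not> {b. classical v (Some b) \<in> T} \<subseteq> {b. poly (rden R) b = 0} \<union> {b. z = Some b}"
    using infinite_classical_near[OF T(1,2)] finite_subset by blast
  then obtain b where b: "classical v (Some b) \<in> T" "poly (rden R) b \<noteq> 0" "z \<noteq> Some b" by auto
  then have "classical v (Some b) \<in> sph_deriv_domain v R"
    using eval_seminorm[of b] by (auto simp: sph_deriv_domain_def classical_simps eq_0_iff)
  then show False using T(3)[OF b(1)] b(3) classical_inj by metis
qed

text \<open>\<open>sph_deriv_formula\<close> with the denominators cleared, so that it is continuous
  at poles as well.\<close>

definition hom_sph_deriv :: "'a ratfun \<Rightarrow> ('a poly \<Rightarrow> real) \<Rightarrow> real" where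
  "hom_sph_deriv R s = s (rat_deriv_num R) * (max 1 (s X_coord))\<^sup>2 / (max (s (rnum R)) (s (rden R)))\<^sup>2"

lemma sph_deriv_formula_eq:
  assumes "s \<in> mult_seminorms v" "s (rden R) \<noteq> 0"
  shows "sph_deriv_formula R (Some s) = hom_sph_deriv R s"
proof -
  have Q: "s (rden R) > 0" using seminorm_nonneg[OF assms(1), of "rden R"] assms(2) by linarith
  have "max 1 (s (rnum R) / s (rden R)) = max (s (rden R) / s (rden R)) (s (rnum R) / s (rden R))"
    using Q by simp
  also have "\<dots> = max (s (rnum R)) (s (rden R)) / s (rden R)"
    using Q by (simp only: max_divide_distrib_right max.commute) simp
  finally show ?thesis
    using Q by (simp add: sph_deriv_formula_def hom_sph_deriv_def Let_def power_divide)
qed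

lemma sph_deriv_limit:
  assumes Q: "rden R \<noteq> 0" and x: "classical v z \<notin> sph_deriv_domain v R"
    and lim: "\<And>U. open U \<Longrightarrow> l \<in> U \<Longrightarrow> \<exists>T. openin (berk_P1 v) T \<and> classical v z \<in> T \<and>
        (\<forall>s. Some s \<in> T \<longrightarrow> s \<in> mult_seminorms v \<longrightarrow> hom_sph_deriv R s \<in> U)"
  shows "sph_deriv v R (classical v z) = l"
proof -
  let ?F = "atin_within (berk_P1 v) (classical v z) (sph_deriv_domain v R)"
  have "(sph_deriv_formula R \<longlongrightarrow> l) ?F"
    unfolding tendsto_def
  proof (intro allI impI)
    fix U :: "real set" assume "open U" "l \<in> U"
    then obtain T where T: "openin (berk_P1 v) T" "classical v z \<in> T"
      "\<And>s. Some s \<in> T \<Longrightarrow> s \<in> mult_seminorms v \<Longrightarrow> hom_sph_deriv R s \<in> U" using lim by blast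
    have "sph_deriv_formula R x \<in> U" if x: "x \<in> T" "x \<in> sph_deriv_domain v R" for x
    proof -
      obtain s where s: "x = Some s" "s \<in> mult_seminorms v" "s (rden R) \<noteq> 0"
        using x(2) by (auto simp: sph_deriv_domain_def)
      then show ?thesis using T(3)[of s] x(1) sph_deriv_formula_eq[of s R] by simp
    qed
    then show "\<forall>\<^sub>F x in ?F. sph_deriv_formula R x \<in> U"
      unfolding eventually_atin_within using T(1,2) by blast
  qed
  moreover have "l' = l" if "(sph_deriv_formula R \<longlongrightarrow> l') ?F" for l'
    using tendsto_unique[OF sph_deriv_domain_not_isolated[OF Q] that] calculation by blast
  ultimately have "(THE l. (sph_deriv_formula R \<longlongrightarrow> l) ?F) = l" by (rule the_equality)
  then show ?thesis using x by (simp add: sph_deriv_def)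
qed

text \<open>The top monomial dominates: the remainder \<open>G\<close> has degree below
  \<open>n\<close>, so \<open>s G\<close> is smaller than \<open>s X_coord ^ n\<close> by a factor
  of order \<open>s X_coord\<close>. The filter is that of the punctured neighbourhoods of
  infinity.\<close>

lemma seminorm_near_infinity:
  assumes F: "degree F \<le> n"
  shows "((\<lambda>s. s F / s X_coord ^ n) \<longlongrightarrow> v (coeff F n))
    (inf (filtercomap (\<lambda>s. s X_coord) at_top) (principal (mult_seminorms v)))" (is "(_ \<longlongrightarrow> _) ?F")
proof (rule LIM_zero_cancel, rule Lim_null_comparison)
  define G where "G = F - monom (coeff F n) n"
  have t: "filterlim (\<lambda>s. s X_coord) at_top ?F"
    by (rule filterlim_mono[OF filterlim_filtercomap]) auto
  show "((\<lambda>s. gauss 1 G / s X_coord) \<longlongrightarrow> 0) ?F"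
    by (rule tendsto_divide_0[OF tendsto_const filterlim_at_top_imp_at_infinity[OF t]])
  have "eventually (\<lambda>s. s X_coord \<ge> 1) ?F" using t by (simp add: filterlim_at_top)
  moreover have "eventually (\<lambda>s. s \<in> mult_seminorms v) ?F"
    by (simp add: eventually_inf_principal)
  ultimately show "eventually (\<lambda>s. norm (s F / s X_coord ^ n - v (coeff F n)) \<le> gauss 1 G / s X_coord) ?F"
  proof eventually_elim
    case (elim s)
    define t where "t = s X_coord"
    have t: "t \<ge> 1" using elim by (simp add: t_def)
    have ms: "s \<in> mult_seminorms v" using elim by simp
    have sm: "s (monom (coeff F n) n) = v (coeff F n) * t ^ n"
      by (simp add: monom_altdef seminorm_smult[OF ms] seminorm_power[OF ms] t_def)
    have G0: "s G * t \<le> gauss 1 G * t ^ n"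
    proof (cases "G = 0")
      case True
      then show ?thesis using t gauss_nonneg[of 1 G] by (simp add: seminorm_0[OF ms])
    next
      case False
      have "degree G \<le> n" using F by (simp add: G_def degree_diff_le degree_monom_le)
      moreover have "degree G \<noteq> n"
      proof
        assume "degree G = n"
        then have "lead_coeff G = 0" by (simp add: G_def)
        then show False using False by simp
      qed
      ultimately have dG: "Suc (degree G) \<le> n" by simp
      have "s G \<le> gauss t G" unfolding t_def by (rule seminorm_le_gauss[OF ms])
      also have "\<dots> \<le> t ^ degree G * gauss 1 G" using gauss_scale_le[of 1 t t G] t by simp
      finally have "s G * t \<le> t ^ Suc (degree G) * gauss 1 G"
        using t mult_right_mono[of "s G" _ t] by (simp add: mult_ac)
      also have "\<dots> \<le> t ^ n * gauss 1 G"
        using dG t gauss_nonneg[of 1 G] by (intro mult_right_mono power_increasing) auto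
      finally show ?thesis by (simp add: mult.commute)
    qed
    have "\<bar>s F - v (coeff F n) * t ^ n\<bar> \<le> s G"
    proof -
      have "s F \<le> s G + s (monom (coeff F n) n)"
        using seminorm_triangle[OF ms, of G "monom (coeff F n) n"] by (simp add: G_def)
      moreover have "s (monom (coeff F n) n) \<le> s F + s G"
        using seminorm_triangle[OF ms, of F "- G"] seminorm_minus[OF ms, of G] by (simp add: G_def)
      ultimately show ?thesis unfolding sm by linarith
    qed
    also have "s G \<le> gauss 1 G * t ^ n / t" using G0 t by (simp add: field_simps)
    finally have "\<bar>s F - v (coeff F n) * t ^ n\<bar> / t ^ n \<le> (gauss 1 G * t ^ n / t) / t ^ n"
      using t by (intro divide_right_mono) auto
    moreover have "\<bar>s F / t ^ n - v (coeff F n)\<bar> = \<bar>s F - v (coeff F n) * t ^ n\<bar> / t ^ n"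
    proof -
      have "s F / t ^ n - v (coeff F n) = (s F - v (coeff F n) * t ^ n) / t ^ n"
        using t by (simp add: field_simps)
      then show ?thesis using t by simp
    qed
    ultimately show ?case using t by (simp add: t_def[symmetric])
  qed
qed

text \<open>At a pole \<open>hom_sph_deriv\<close> is continuous. At infinity, dividing by powers of
  \<open>s X_coord\<close> leaves only top coefficients in the limit, and these are the values at 0
  in the chart at infinity.\<close>

lemma sph_deriv_classical:
  assumes R: "rational_map R" "rat_degree R \<ge> 1"
  shows "sph_deriv v R (classical v z) = sphder R z"
proof (cases z)
  case (Some a)
  define s0 where "s0 = (\<lambda>F. v (poly F a))"
  have ms: "s0 \<in> mult_seminorms v" unfolding s0_def by (rule eval_seminorm)
  have z: "classical v z = Some s0" using Some by (simp add: classical_simps s0_def)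
  have val: "hom_sph_deriv R s0 = sphder R z"
    using Some by (simp add: hom_sph_deriv_def sphder_def disc_deriv_def vnorm_def s0_def)
  show ?thesis
  proof (cases "s0 (rden R) = 0")
    case False
    then have "classical v z \<in> sph_deriv_domain v R" using ms z by (auto simp: sph_deriv_domain_def)
    then show ?thesis
      using sph_deriv_formula_eq[OF ms False] z val by (simp add: sph_deriv_def)
  next
    case True
    show ?thesis
    proof (rule sph_deriv_limit)
      show "rden R \<noteq> 0" using R by (simp add: rational_map_def)
      show "classical v z \<notin> sph_deriv_domain v R" using True z by (auto simp: sph_deriv_domain_def)
      fix U :: "real set" assume U: "open U" "sphder R z \<in> U"
      have "max (s0 (rnum R)) (s0 (rden R)) > 0"
        using vnorm_pos[of "poly (rnum R) a" "poly (rden R) a"] rational_map_no_common_root[OF R(1), of a]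
        by (simp add: s0_def vnorm_def)
      then have ne: "(max (s0 (rnum R)) (s0 (rden R)))\<^sup>2 \<noteq> 0" by simp
      have co: "((\<lambda>s::'a poly \<Rightarrow> real. s F) \<longlongrightarrow> s0 F) (nhds s0)" for F
      proof -
        have "open ((\<lambda>s::'a poly \<Rightarrow> real. s F) -` S)" if "open S" for S
          using open_vimage[OF that continuous_on_product_coordinates] .
        then show ?thesis unfolding tendsto_def eventually_nhds by (metis vimage_eq)
      qed
      have "(hom_sph_deriv R \<longlongrightarrow> hom_sph_deriv R s0) (nhds s0)"
        unfolding hom_sph_deriv_def by (intro tendsto_intros co tendsto_max ne)
      then have "eventually (\<lambda>s. hom_sph_deriv R s \<in> U) (nhds s0)"
        using U val by (simp add: tendsto_def)
      then obtain V where V: "open V" "s0 \<in> V" "\<And>s. s \<in> V \<Longrightarrow> hom_sph_deriv R s \<in> U"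
        unfolding eventually_nhds by blast
      then show "\<exists>T. openin (berk_P1 v) T \<and> classical v z \<in> T \<and>
          (\<forall>s. Some s \<in> T \<longrightarrow> s \<in> mult_seminorms v \<longrightarrow> hom_sph_deriv R s \<in> U)"
        using openin_berk_P1_Some[OF V(1)] ms z by (intro exI[of _ "Some ` (V \<inter> mult_seminorms v)"]) auto
    qed
  qed
next
  case None
  define d where "d = rat_degree R"
  have d: "d \<ge> 1" "rat_degree R = d" using R by (auto simp: d_def)
  have deg: "degree (rnum R) \<le> d" "degree (rden R) \<le> d" by (auto simp: d_def rat_degree_def)
  have "hom_eval d (rnum R) 1 0 \<noteq> 0 \<or> hom_eval d (rden R) 1 0 \<noteq> 0"
    unfolding d_def by (rule rational_map_hom_eval[OF R(1)]) simp
  then have lc: "coeff (rnum R) d \<noteq> 0 \<or> coeff (rden R) d \<noteq> 0" by (simp add: hom_eval_infinity)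
  let ?m = "max (v (coeff (rnum R) d)) (v (coeff (rden R) d))"
  have m0: "?m > 0" using vnorm_pos[OF lc] by (simp add: vnorm_def)
  have c0: "poly (homog_subst d F rat_inversion) 0 = coeff F d" for F :: "'a poly"
    by (simp add: poly_homog_subst) (simp add: rat_inversion_def hom_eval_infinity)
  have val: "sphder R z = v (coeff (rat_deriv_num R) (2 * d - 2)) / ?m\<^sup>2"
  proof -
    have "v (poly (rat_deriv_num (at_infinity_chart R)) 0) = v (coeff (rat_deriv_num R) (2 * d - 2))"
      using deriv_num_degree(2)[OF d(2,1)] by simp
    moreover have "poly (rnum (at_infinity_chart R)) 0 = coeff (rnum R) d"
      "poly (rden (at_infinity_chart R)) 0 = coeff (rden R) d"
      using c0 by (simp_all add: rat_comp_def d)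
    ultimately show ?thesis using None by (simp add: sphder_def disc_deriv_def vnorm_def)
  qed
  let ?F = "inf (filtercomap (\<lambda>s::'a poly \<Rightarrow> real. s X_coord) at_top) (principal (mult_seminorms v))"
  define k where "k s = s (rat_deriv_num R) / s X_coord ^ (2 * d - 2) /
      (max (s (rnum R) / s X_coord ^ d) (s (rden R) / s X_coord ^ d))\<^sup>2" for s :: "'a poly \<Rightarrow> real"
  have "(k \<longlongrightarrow> sphder R z) ?F"
    unfolding k_def val using m0
    by (intro tendsto_intros tendsto_max seminorm_near_infinity deg deriv_num_degree(1)[OF d(2,1)]) simp
  moreover have "eventually (\<lambda>s. s X_coord \<ge> 1) ?F"
    using filterlim_mono[OF filterlim_filtercomap[of "\<lambda>s::'a poly \<Rightarrow> real. s X_coord" at_top], of at_top ?F]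
    by (simp add: filterlim_at_top)
  then have "eventually (\<lambda>s. k s = hom_sph_deriv R s) ?F"
  proof eventually_elim
    case (elim s)
    define t where "t = s X_coord"
    have t: "t \<ge> 1" "max 1 t = t" using elim by (auto simp: t_def)
    obtain j where j: "d = Suc j" using d(1) by (cases d) auto
    have "max (s (rnum R) / t ^ d) (s (rden R) / t ^ d) = max (s (rnum R)) (s (rden R)) / t ^ d"
      using t by (simp add: max_divide_distrib_right)
    moreover have "(t ^ d)\<^sup>2 = t ^ (2 * d - 2) * t\<^sup>2"
      by (simp add: j power2_eq_square power_add mult_2)
    ultimately show ?case
      using t by (simp add: k_def hom_sph_deriv_def t_def[symmetric] power_divide)
  qed
  ultimately have lim: "(hom_sph_deriv R \<longlongrightarrow> sphder R z) ?F"
    by (rule Lim_transform_eventually)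
  show ?thesis
  proof (rule sph_deriv_limit)
    show "rden R \<noteq> 0" using R by (simp add: rational_map_def)
    show "classical v z \<notin> sph_deriv_domain v R" using None by (auto simp: sph_deriv_domain_def classical_simps)
    fix U :: "real set" assume U: "open U" "sphder R z \<in> U"
    then have "eventually (\<lambda>s. hom_sph_deriv R s \<in> U) ?F" using lim by (simp add: tendsto_def)
    then obtain B where B: "\<And>s. B < s X_coord \<Longrightarrow> s \<in> mult_seminorms v \<Longrightarrow> hom_sph_deriv R s \<in> U"
      unfolding eventually_inf_principal eventually_filtercomap_at_top_dense by blast
    then show "\<exists>T. openin (berk_P1 v) T \<and> classical v z \<in> T \<and>
        (\<forall>s. Some s \<in> T \<longrightarrow> s \<in> mult_seminorms v \<longrightarrow> hom_sph_deriv R s \<in> U)"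
      using openin_infinity[of B] None
      by (intro exI[of _ "insert None (Some ` {s \<in> mult_seminorms v. B < s X_coord})"]) (auto simp: classical_simps)
  qed
qed

end

section \<open>Integrals of logarithms\<close>

lemma enn2ereal_positive_negative_part:
  fixes \<phi> :: "'b \<Rightarrow> real"
  assumes i: "integrable M \<phi>"
  shows "enn2ereal (\<integral>\<^sup>+x. ennreal (\<phi> x) \<partial>M) - enn2ereal (\<integral>\<^sup>+x. ennreal (- \<phi> x) \<partial>M) = ereal (\<integral>x. \<phi> x \<partial>M)"
    (is "enn2ereal ?A - enn2ereal ?B = _")
proof -
  have "?A < \<infinity>" "?B < \<infinity>"
    using real_integrable_def[THEN iffD1, OF i] by (auto simp: less_top)
  then show ?thesis
    using real_lebesgue_integral_def[OF i] by (cases ?A; cases ?B) (auto simp: enn2ereal_ennreal)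
qed

text \<open>The negative part of \<open>\<phi> - k\<close> is controlled by that of a coboundary,
  hence by the positive part of the coboundary, hence by the positive part of
  \<open>\<phi> - k\<close>. If the latter has finite integral, integrability of
  \<open>\<phi>\<close> comes out as a by-product.\<close>

lemma (in prob_space) integral_ge_coboundary:
  fixes \<phi> u :: "'a \<Rightarrow> real"
  assumes T[measurable]: "T \<in> measurable M M" and inv: "distr M M T = M"
    and \<phi>[measurable]: "\<phi> \<in> borel_measurable M" and u[measurable]: "u \<in> borel_measurable M"
    and ge: "AE x in M. \<phi> x \<ge> k + (u (T x) - u x)" and k: "k \<le> 0"
  shows "enn2ereal (\<integral>\<^sup>+x. ennreal (\<phi> x) \<partial>M) - enn2ereal (\<integral>\<^sup>+x. ennreal (- \<phi> x) \<partial>M) \<ge> ereal k"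
proof (cases "(\<integral>\<^sup>+x. ennreal (\<phi> x) \<partial>M) = \<infinity>")
  \<comment> \<open>In \<open>ereal\<close> the difference \<infinity> - x is \<infinity> for every
    x, also for x = \<infinity>.\<close>
  case True
  then show ?thesis by (simp add: enn2ereal_top)
next
  case False
  define a where "a x = \<phi> x - k" for x
  have [measurable]: "a \<in> borel_measurable M" unfolding a_def[abs_def] by measurable
  have "(\<integral>\<^sup>+x. ennreal (- a x) \<partial>M) \<le> (\<integral>\<^sup>+x. ennreal (u x - u (T x)) \<partial>M)"
    using ge by (intro nn_integral_mono_AE) (auto simp: a_def intro!: ennreal_leI)
  also have "\<dots> \<le> (\<integral>\<^sup>+x. ennreal (u (T x) - u x) \<partial>M)"
    by (rule nn_integral_coboundary_le[OF T inv u])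
  also have "\<dots> \<le> (\<integral>\<^sup>+x. ennreal (a x) \<partial>M)"
    using ge by (intro nn_integral_mono_AE) (auto simp: a_def intro!: ennreal_leI)
  finally have le: "(\<integral>\<^sup>+x. ennreal (- a x) \<partial>M) \<le> (\<integral>\<^sup>+x. ennreal (a x) \<partial>M)" .
  have "(\<integral>\<^sup>+x. ennreal (a x) \<partial>M) \<le> (\<integral>\<^sup>+x. ennreal (\<phi> x) + ennreal (- k) \<partial>M)"
  proof (rule nn_integral_mono)
    fix x
    show "ennreal (a x) \<le> ennreal (\<phi> x) + ennreal (- k)"
    proof (cases "0 \<le> \<phi> x")
      case True
      then show ?thesis using k ennreal_plus[of "\<phi> x" "- k"] by (simp add: a_def)
    next
      case False
      then show ?thesis by (simp add: a_def ennreal_neg ennreal_leI)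
    qed
  qed
  also have "\<dots> = (\<integral>\<^sup>+x. ennreal (\<phi> x) \<partial>M) + ennreal (- k)"
    by (subst nn_integral_add) (auto simp: emeasure_space_1)
  also have "\<dots> < \<infinity>" using False by (simp add: less_top)
  finally have fin: "(\<integral>\<^sup>+x. ennreal (a x) \<partial>M) < \<infinity>" .
  with le have ia: "integrable M a"
    unfolding real_integrable_def by (auto simp: less_top[symmetric] top_unique)
  have "0 \<le> (\<integral>x. a x \<partial>M)"
    unfolding real_lebesgue_integral_def[OF ia] using le fin by (simp add: enn2real_mono)
  moreover have "\<phi> = (\<lambda>x. a x + k)" by (simp add: a_def)
  then have "integrable M \<phi>" "(\<integral>x. \<phi> x \<partial>M) = (\<integral>x. a x \<partial>M) + k"
    using ia prob_space by simp_all
  ultimately show ?thesis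
    by (simp add: enn2ereal_positive_negative_part)
qed

text \<open>The truncated negative parts increase to the full one, so by monotone convergence some
  level already outweighs the positive part. At that level the negative part is bounded, and the
  positive part has a smaller integral, hence a finite one.\<close>

lemma (in prob_space) ex_truncated_log_integral_neg:
  fixes g :: "'a \<Rightarrow> real"
  assumes g[measurable]: "g \<in> borel_measurable M"
    and neg: "enn2ereal (\<integral>\<^sup>+x. e2ennreal (log_ereal (g x)) \<partial>M) - enn2ereal (\<integral>\<^sup>+x. e2ennreal (- log_ereal (g x)) \<partial>M) < 0"
  shows "\<exists>\<epsilon>>0. integrable M (\<lambda>x. ln (max (g x) \<epsilon>)) \<and> (\<integral>x. ln (max (g x) \<epsilon>) \<partial>M) < 0"
proof -
  \<comment> \<open>Starting at 1/2 keeps every level below 1, so the truncation leaves the positive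
    part of the logarithm unchanged.\<close>
  define e where "e n = 1 / real (n + 2)" for n
  have e: "0 < e n" "e n < 1" for n by (auto simp: e_def)
  have pos: "e2ennreal (log_ereal (g x)) = ennreal (ln (max (g x) (e n)))" for x n
  proof (cases "g x \<le> e n")
    case True
    then have "ln (max (g x) (e n)) \<le> 0" using e[of n] by (simp add: max_def)
    moreover have "log_ereal (g x) \<le> 0" using True e[of n] by (simp add: log_ereal_def)
    ultimately show ?thesis by (simp add: ennreal_neg e2ennreal_neg)
  next
    case False
    then show ?thesis using e(1)[of n] by (simp add: log_ereal_def max_def)
  qed
  define I where "I n = (\<integral>\<^sup>+x. ennreal (- ln (max (g x) (e n))) \<partial>M)" for n
  have sup: "(\<integral>\<^sup>+x. e2ennreal (- log_ereal (g x)) \<partial>M) = (SUP n. I n)"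
  proof -
    have inc: "incseq (\<lambda>n x. ennreal (- ln (max (g x) (e n))))"
    proof (rule incseq_SucI, rule le_funI, rule ennreal_leI)
      fix n x
      have "e (Suc n) \<le> e n" by (simp add: e_def frac_le)
      then have "max (g x) (e (Suc n)) \<le> max (g x) (e n)" by auto
      then show "- ln (max (g x) (e n)) \<le> - ln (max (g x) (e (Suc n)))"
        using e(1)[of "Suc n"] by (simp add: max.strict_coboundedI2)
    qed
    have "e2ennreal (- log_ereal (g x)) = (SUP n. ennreal (- ln (max (g x) (e n))))" for x
    proof (rule LIMSEQ_unique[OF _ LIMSEQ_SUP])
      show "incseq (\<lambda>n. ennreal (- ln (max (g x) (e n))))" using inc by (simp add: incseq_def le_fun_def)
      have e0: "e \<longlonglongrightarrow> 0" unfolding e_def by (rule LIMSEQ_ignore_initial_segment[OF lim_1_over_n])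
      show "(\<lambda>n. ennreal (- ln (max (g x) (e n)))) \<longlonglongrightarrow> e2ennreal (- log_ereal (g x))"
      proof (cases "g x \<le> 0")
        case True
        have "filterlim e (at_right 0) sequentially"
          using e0 e(1) less_imp_neq[OF e(1)] by (auto simp: filterlim_at)
        from filterlim_compose[OF ln_at_0 this] have "filterlim (\<lambda>n. - ln (e n)) at_top sequentially"
          by (simp add: filterlim_uminus_at_top)
        then have "(\<lambda>n. ennreal (- ln (e n))) \<longlonglongrightarrow> \<infinity>"
          by (simp add: ennreal_tendsto_top_eq_at_top)
        moreover have "max (g x) (e n) = e n" for n using True e(1)[of n] by simp
        ultimately show ?thesis using True by (simp add: log_ereal_def)
      next
        case False
        have "(\<lambda>n. ennreal (- ln (max (g x) (e n)))) \<longlonglongrightarrow> ennreal (- ln (max (g x) 0))"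
          by (intro tendsto_ennrealI tendsto_minus tendsto_ln tendsto_max tendsto_const e0) (use False in simp)
        then show ?thesis using False by (simp add: log_ereal_def max_def)
      qed
    qed
    then show ?thesis
      unfolding I_def using inc by (subst nn_integral_monotone_convergence_SUP[symmetric]) auto
  qed
  define A where "A = (\<integral>\<^sup>+x. e2ennreal (log_ereal (g x)) \<partial>M)"
  have "A < (SUP n. I n)"
  proof (rule ccontr)
    assume "\<not> A < (SUP n. I n)"
    then have "enn2ereal (SUP n. I n) \<le> enn2ereal A" by (simp add: less_eq_ennreal.rep_eq[symmetric])
    \<comment> \<open>This includes \<infinity> - \<infinity>, which is \<infinity> in
      \<open>ereal\<close>.\<close>
    then have "0 \<le> enn2ereal A - enn2ereal (SUP n. I n)"
      by (cases "enn2ereal A"; cases "enn2ereal (SUP n. I n)") auto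
    then show False using neg by (simp add: sup A_def[symmetric])
  qed
  then obtain n where n: "A < I n" by (auto simp: less_SUP_iff)
  define \<phi> where "\<phi> x = ln (max (g x) (e n))" for x
  have [measurable]: "\<phi> \<in> borel_measurable M" unfolding \<phi>_def[abs_def] by measurable
  have A: "A = (\<integral>\<^sup>+x. ennreal (\<phi> x) \<partial>M)" by (simp add: A_def \<phi>_def pos[of _ n])
  have "I n \<le> (\<integral>\<^sup>+x. ennreal (- ln (e n)) \<partial>M)"
    unfolding I_def using e[of n] by (intro nn_integral_mono ennreal_leI) (simp add: ln_mono max.strict_coboundedI2)
  also have "\<dots> = ennreal (- ln (e n))" by (simp add: emeasure_space_1)
  finally have "I n < \<infinity>" by (simp add: order_le_less_trans)
  then have i: "integrable M \<phi>"
    unfolding real_integrable_def using n by (auto simp: A I_def \<phi>_def[symmetric] less_top)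
  have "ereal (\<integral>x. \<phi> x \<partial>M) = enn2ereal A - enn2ereal (I n)"
    using enn2ereal_positive_negative_part[OF i] by (simp add: A I_def \<phi>_def)
  also have "\<dots> < 0"
    using n \<open>I n < \<infinity>\<close> by (cases A; cases "I n") (auto simp: enn2ereal_ennreal ennreal_less_iff)
  finally have "(\<integral>x. \<phi> x \<partial>M) < 0" by simp
  then show ?thesis using i e(1)[of n] unfolding \<phi>_def by blast
qed

context complete_nonarch_field
begin

section \<open>The action on classical and nonclassical points\<close>

lemma berk_map_classical: "berk_map v R (classical v z) = classical v (rat_eval R z)"
proof (cases z)
  case None
  then show ?thesis by (simp add: berk_map_def classical_simps)
next
  case (Some a)
  show ?thesis
  proof (cases "poly (rden R) a = 0")
    case True
    then show ?thesis using Some by (simp add: berk_map_def classical_simps rat_eval_def)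
  next
    case False
    have "v (poly (homog_subst (degree F) F R) a) / v (poly (rden R) a) ^ degree F = v (poly F (poly (rnum R) a / poly (rden R) a))" for F
      using hom_eval_affine[of F "degree F" "poly (rden R) a" "poly (rnum R) a"] False v_pos[OF False]
      by (simp add: poly_homog_subst mult v_power)
    then show ?thesis using Some False by (simp add: berk_map_def classical_simps rat_eval_def eq_0_iff)
  qed
qed

text \<open>This turns the infimum over \<open>b\<close> in \<open>radius_expansion\<close> into the
  radius of the image point.\<close>

lemma berk_map_linear:
  assumes "berk_map v R (Some s) = Some s'"
  shows "s (rden R) \<noteq> 0" "s' [:- b, 1:] = s (rnum R - smult b (rden R)) / s (rden R)"
proof -
  show "s (rden R) \<noteq> 0" using assms by (auto simp: berk_map_def)
  have "homog_subst 1 [:- b, 1:] R = rnum R - smult b (rden R)"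
    by (simp add: homog_subst_def)
  then show "s' [:- b, 1:] = s (rnum R - smult b (rden R)) / s (rden R)"
    using assms by (auto simp: berk_map_def split: if_splits)
qed

lemma nonclassicalE:
  assumes "x \<in> topspace (berk_P1 v)" "x \<notin> range (classical v)"
  obtains s where "x = Some s" "s \<in> mult_seminorms v" "radius s > 0"
proof -
  have "x \<noteq> None" using assms(2) classical_simps(1) by (metis rangeI)
  then obtain s where s: "x = Some s" "s \<in> mult_seminorms v" using assms(1) by (auto simp: topspace_berk_P1)
  have "radius s \<noteq> 0" using radius_0_iff[OF s(2)] assms(2) s(1) by auto
  then show ?thesis using that s radius_nonneg[OF s(2)] by (simp add: less_eq_real_def)
qed

text \<open>A nonclassical seminorm is positive on nonzero polynomials: image infinity would force
  \<open>Q = 0\<close>, and image \<open>b\<close> would force \<open>P = b Q\<close>, a constant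
  map. Together with \<open>berk_map_classical\<close> the set of classical points equals its
  preimage, so ergodicity applies to it.\<close>

lemma classical_preimage:
  assumes R: "rational_map R" "rat_degree R \<ge> 1" and x: "x \<in> topspace (berk_P1 v)"
    and c: "berk_map v R x \<in> range (classical v)"
  shows "x \<in> range (classical v)"
proof (rule ccontr)
  assume "x \<notin> range (classical v)"
  then obtain s where s: "x = Some s" "s \<in> mult_seminorms v" "radius s > 0" using nonclassicalE[OF x] by blast
  have Q: "rden R \<noteq> 0" using R by (simp add: rational_map_def)
  then have "s (rden R) > 0" using seminorm_pos[OF s(2,3)] by simp
  then obtain s' where s': "berk_map v R (Some s) = Some s'" by (auto simp: berk_map_def)
  then obtain b where b: "s' = (\<lambda>F. v (poly F b))"
    using c s(1) by (auto simp: classical_def split: option.splits)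
  then have "s (rnum R - smult b (rden R)) = 0"
    using berk_map_linear(1)[OF s'] berk_map_linear(2)[OF s', of b] by simp
  then have "rnum R - smult b (rden R) = 0"
    using seminorm_pos[OF s(2,3), of "rnum R - smult b (rden R)"] by (metis less_irrefl)
  then have eq: "rnum R = smult b (rden R)" by simp
  then have "poly (rden R) a \<noteq> 0" for a using rational_map_no_common_root[OF R(1), of a] by auto
  then have "degree (rden R) = 0" using alg_closed_imp_poly_has_root[of "rden R"] by auto
  then show False using eq R(2) degree_smult_le[of b "rden R"] by (simp add: rat_degree_def)
qed

text \<open>\<open>radius_expansion\<close> in spherical terms: dividing by the square of
  \<open>max (s P) (s Q)\<close> turns both radii into spherical diameters
  \<open>radius s / (max 1 (s X_coord))\<^sup>2\<close>.\<close>

lemma sph_deriv_nonclassical: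
  assumes s: "s \<in> mult_seminorms v" "radius s > 0" and W: "separable R"
    and R: "berk_map v R (Some s) = Some s'"
    and s': "s' \<in> mult_seminorms v"
    and c0: "c \<ge> 0" and c: "\<And>l. 1 \<le> l \<Longrightarrow> l \<le> rat_degree R \<Longrightarrow> c \<le> v (of_nat l)"
  shows "sph_deriv v R (Some s) = hom_sph_deriv R s"
    and "c * (radius s' / (max 1 (s' X_coord))\<^sup>2) \<le> hom_sph_deriv R s * (radius s / (max 1 (s X_coord))\<^sup>2)"
proof -
  have q0: "s (rden R) \<noteq> 0" using berk_map_linear(1)[OF R] .
  define q where "q = s (rden R)"
  have q: "q > 0" using q0 seminorm_nonneg[OF s(1), of "rden R"] by (simp add: q_def)
  define p where "p = s (rnum R)"
  define w where "w = s (rat_deriv_num R)"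
  define m where "m = max 1 (s X_coord)"
  have m: "m > 0" by (simp add: m_def)
  have dom: "Some s \<in> sph_deriv_domain v R" using s q0 by (auto simp: sph_deriv_domain_def)
  then show eq: "sph_deriv v R (Some s) = hom_sph_deriv R s"
    using sph_deriv_formula_eq[OF s(1) q0] by (simp add: sph_deriv_def)
  have "radius s' * q \<le> (INF b. s (rnum R - smult b (rden R)))"
  proof (rule cINF_greatest)
    fix b
    show "radius s' * q \<le> s (rnum R - smult b (rden R))"
      using radius_le[OF s', of b] berk_map_linear(2)[OF R, of b] q by (simp add: q_def field_simps)
  qed simp
  then have "c * q * (radius s' * q) \<le> c * q * (INF b. s (rnum R - smult b (rden R)))"
    using c0 q by (intro mult_left_mono) auto
  also have "\<dots> \<le> w * radius s"
    unfolding q_def w_def rat_deriv_num_def using W c0 c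
    by (intro radius_expansion[where d="rat_degree R"] s) (auto simp: separable_def rat_deriv_num_def rat_degree_def)
  finally have key: "c * q * (radius s' * q) \<le> w * radius s" .
  have "s' X_coord = p / q" using berk_map_linear(2)[OF R, of 0] by (simp add: p_def q_def)
  then have "max 1 (s' X_coord) = max (q / q) (p / q)" using q by simp
  also have "\<dots> = max p q / q" using q by (simp only: max_divide_distrib_right max.commute) simp
  finally have M: "max 1 (s' X_coord) = max p q / q" .
  have mx: "max p q > 0" using q by simp
  have "c * (radius s' / (max p q / q)\<^sup>2) = (c * q * (radius s' * q)) / (max p q)\<^sup>2"
    using q by (simp add: power_divide power2_eq_square mult_ac)
  also have "\<dots> \<le> (w * radius s) / (max p q)\<^sup>2" using key by (intro divide_right_mono) auto
  also have "\<dots> = (w * m\<^sup>2 / (max p q)\<^sup>2) * (radius s / m\<^sup>2)" using m by simp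
  finally show "c * (radius s' / (max 1 (s' X_coord))\<^sup>2) \<le> hom_sph_deriv R s * (radius s / (max 1 (s X_coord))\<^sup>2)"
    unfolding M by (simp add: hom_sph_deriv_def w_def m_def p_def q_def)
qed

section \<open>Borel sets of the Berkovich line and the nonclassical case\<close>

lemma space_berk_borel:
  assumes "sets N = sets (berk_borel v)"
  shows "space N = topspace (berk_P1 v)"
  using sets_eq_imp_space_eq[OF assms] by (simp add: berk_borel_def space_measure_of_conv)

lemma openin_sets_berk:
  assumes "sets N = sets (berk_borel v)" "openin (berk_P1 v) U"
  shows "U \<in> sets N"
proof -
  have "{U. openin (berk_P1 v) U} \<subseteq> Pow (topspace (berk_P1 v))" using openin_subset by blast
  then show ?thesis using assms by (simp add: berk_borel_def sigma_sets.Basic)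
qed

lemma None_sets_berk:
  assumes N: "sets N = sets (berk_borel v)"
  shows "{None} \<in> sets N"
proof -
  have "Some ` mult_seminorms v \<in> sets N"
    using openin_sets_berk[OF N openin_berk_P1_Some[of UNIV]] by simp
  then have "space N - Some ` mult_seminorms v \<in> sets N" by blast
  moreover have "space N - Some ` mult_seminorms v = {None}"
    by (auto simp: space_berk_borel[OF N] topspace_berk_P1)
  ultimately show ?thesis by simp
qed

text \<open>Infinity gets the default value 0. Its singleton is measurable, so openness matters on
  the affine part only.\<close>

lemma borel_measurable_berk:
  fixes \<phi> :: "('a poly \<Rightarrow> real) \<Rightarrow> real"
  assumes N: "sets N = sets (berk_borel v)"
    and op: "\<And>a. \<exists>U. open U \<and> {s \<in> mult_seminorms v. \<phi> s < a} = U \<inter> mult_seminorms v"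
  shows "case_option 0 \<phi> \<in> borel_measurable N"
  unfolding borel_measurable_iff_less
proof
  fix a
  obtain U where U: "open U" "{s \<in> mult_seminorms v. \<phi> s < a} = U \<inter> mult_seminorms v" using op by blast
  have "{w \<in> space N. case_option 0 \<phi> w < a} = Some ` (U \<inter> mult_seminorms v) \<union> (if 0 < a then {None} else {})"
    unfolding U(2)[symmetric] by (auto simp: space_berk_borel[OF N] topspace_berk_P1)
  then show "{w \<in> space N. case_option 0 \<phi> w < a} \<in> sets N"
    using openin_sets_berk[OF N openin_berk_P1_Some[OF U(1)]] None_sets_berk[OF N]
    by (cases "0 < a") (auto intro: sets.Un simp del: Un_insert_right)
qed

lemma borel_measurable_seminorm:
  assumes N: "sets N = sets (berk_borel v)"
  shows "case_option 0 (\<lambda>s. s F :: real) \<in> borel_measurable N"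
proof (rule borel_measurable_berk[OF N])
  fix a :: real
  have "open {s::'a poly \<Rightarrow> real. s F < a}"
    by (intro open_Collect_less continuous_seminorm continuous_on_const)
  then show "\<exists>U. open U \<and> {s \<in> mult_seminorms v. s F < a} = U \<inter> mult_seminorms v"
    by (intro exI[of _ "{s. s F < a}"]) auto
qed

lemma borel_measurable_radius:
  assumes N: "sets N = sets (berk_borel v)"
  shows "case_option 0 radius \<in> borel_measurable N"
proof (rule borel_measurable_berk[OF N])
  fix a :: real
  have "open (\<Union>\<alpha>. {s::'a poly \<Rightarrow> real. s [:- \<alpha>, 1:] < a})"
    by (intro open_UN ballI open_Collect_less continuous_seminorm continuous_on_const)
  moreover have "{s \<in> mult_seminorms v. radius s < a} = (\<Union>\<alpha>. {s. s [:- \<alpha>, 1:] < a}) \<inter> mult_seminorms v"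
    using radius_less by auto
  ultimately show "\<exists>U. open U \<and> {s \<in> mult_seminorms v. radius s < a} = U \<inter> mult_seminorms v" by blast
qed

text \<open>The classical points are the zero set of the radius; the default value 0 at
  \<open>None\<close> places infinity among them.\<close>

lemma classical_sets:
  assumes N: "sets N = sets (berk_borel v)"
  shows "range (classical v) \<in> sets N"
proof -
  have "range (classical v) = {x \<in> space N. case_option 0 radius x = 0}"
  proof (intro equalityI subsetI)
    fix x assume "x \<in> range (classical v)"
    then obtain z where "x = classical v z" by blast
    then show "x \<in> {x \<in> space N. case_option 0 radius x = 0}"
      using classical_in_space[of z] by (cases z) (auto simp: space_berk_borel[OF N] classical_simps radius_eval)
  next
    fix x assume x: "x \<in> {x \<in> space N. case_option 0 radius x = 0}"
    show "x \<in> range (classical v)"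
    proof (rule ccontr)
      assume "x \<notin> range (classical v)"
      then obtain s where "x = Some s" "radius s > 0"
        using nonclassicalE[of x] x space_berk_borel[OF N] by auto
      then show False using x by simp
    qed
  qed
  moreover have "{x \<in> space N. case_option 0 radius x = 0} \<in> sets N"
    using borel_measurable_radius[OF N] by measurable
  ultimately show ?thesis by simp
qed

lemma lyapunov_nonclassical:
  assumes R: "rational_map R" "separable R" "rat_degree R \<ge> 1"
    and N: "prob_space N" "sets N = sets (berk_borel v)"
    and inv: "berk_map v R \<in> measurable N N" "distr N N (berk_map v R) = N"
    and null: "measure N (range (classical v)) = 0"
    and c: "0 < c" "\<And>l. 1 \<le> l \<Longrightarrow> l \<le> rat_degree R \<Longrightarrow> c \<le> v (of_nat l)"
  shows "lyapunov v R N \<ge> ereal (ln c)"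
proof -
  interpret prob_space N by fact
  let ?T = "berk_map v R"
  note T[measurable] = inv(1)
  have [measurable]: "case_option 0 (\<lambda>s. s F) \<in> borel_measurable N" for F
    by (rule borel_measurable_seminorm[OF N(2)])
  have [measurable]: "case_option 0 radius \<in> borel_measurable N"
    by (rule borel_measurable_radius[OF N(2)])
  define ev :: "'a poly \<Rightarrow> 'a berk \<Rightarrow> real" where "ev F = case_option 0 (\<lambda>s. s F)" for F
  have [measurable]: "ev F \<in> borel_measurable N" for F unfolding ev_def by measurable
  define g where "g x = ev (rat_deriv_num R) x * (max 1 (ev X_coord x))\<^sup>2 / (max (ev (rnum R) x) (ev (rden R) x))\<^sup>2" for x
  have [measurable]: "g \<in> borel_measurable N" unfolding g_def[abs_def] by measurable
  define \<delta> where "\<delta> x = case_option 0 radius x / (max 1 (ev X_coord x))\<^sup>2" for x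
  have [measurable]: "\<delta> \<in> borel_measurable N" unfolding \<delta>_def[abs_def] by measurable
  have \<delta>: "\<delta> x > 0" if "x = Some s" "radius s > 0" for x s
  proof -
    have "max 1 (s X_coord) > 0" by linarith
    then show ?thesis using that by (simp add: \<delta>_def ev_def)
  qed
  have nc: "AE x in N. x \<notin> range (classical v)"
    using prob_eq_0[OF classical_sets[OF N(2)]] null by simp
  then have "AE x in distr N N ?T. x \<notin> range (classical v)" unfolding inv(2) .
  then have nc': "AE x in N. ?T x \<notin> range (classical v)"
    by (rule AE_distrD[OF T])
  have main: "AE x in N. sph_deriv v R x = g x \<and> g x > 0 \<and> ln c + (ln (\<delta> (?T x)) - ln (\<delta> x)) \<le> ln (g x)"
    using nc nc' AE_space
  proof eventually_elim
    case (elim x)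
    have x: "x \<in> topspace (berk_P1 v)" using elim by (simp add: space_berk_borel[OF N(2)])
    have Tx: "?T x \<in> topspace (berk_P1 v)"
      using measurable_space[OF T] elim by (simp add: space_berk_borel[OF N(2)])
    obtain s where s: "x = Some s" "s \<in> mult_seminorms v" "radius s > 0"
      using nonclassicalE[OF x elim(1)] .
    obtain s' where s': "?T x = Some s'" "s' \<in> mult_seminorms v" "radius s' > 0"
      using nonclassicalE[OF Tx elim(2)] .
    have eq: "?T (Some s) = Some s'" using s s' by simp
    have g: "g x = hom_sph_deriv R s" by (simp add: g_def ev_def hom_sph_deriv_def s)
    note E = sph_deriv_nonclassical[OF s(2,3) R(2) eq s'(2) less_imp_le[OF c(1)] c(2)]
    have d: "\<delta> x > 0" "\<delta> (?T x) > 0" using \<delta> s s' by auto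
    have ineq: "c * \<delta> (?T x) \<le> g x * \<delta> x"
      using E(2) unfolding g by (simp add: \<delta>_def ev_def s(1) eq)
    then have "g x * \<delta> x > 0" using c(1) d by (smt (verit) mult_pos_pos)
    then have g0: "g x > 0" using d by (simp add: zero_less_mult_iff)
    have "ln (c * \<delta> (?T x)) \<le> ln (g x * \<delta> x)" using ineq c(1) d g0 by simp
    then have "ln c + (ln (\<delta> (?T x)) - ln (\<delta> x)) \<le> ln (g x)"
      using c(1) d g0 by (simp add: ln_mult)
    then show ?case using g0 E(1) s(1) g by simp
  qed
  have "1 \<le> rat_degree R" using R by simp
  \<comment> \<open>The integer 1 is among those that bound \<open>c\<close>;
    \<open>integral_ge_coboundary\<close> requires a nonpositive constant.\<close>
  then have "c \<le> 1" using c(2)[of 1] by simp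
  then have lnc: "ln c \<le> 0" using c(1) by simp
  have "ereal (ln c) \<le> enn2ereal (\<integral>\<^sup>+x. ennreal (ln (g x)) \<partial>N) - enn2ereal (\<integral>\<^sup>+x. ennreal (- ln (g x)) \<partial>N)"
  proof (rule integral_ge_coboundary[OF T inv(2), where u="\<lambda>x. ln (\<delta> x)"])
    show "AE x in N. ln c + (ln (\<delta> (?T x)) - ln (\<delta> x)) \<le> ln (g x)" using main by eventually_elim simp
  qed (use lnc in measurable)
  also have "(\<integral>\<^sup>+x. ennreal (ln (g x)) \<partial>N) = (\<integral>\<^sup>+x. e2ennreal (log_ereal (sph_deriv v R x)) \<partial>N)"
    using main by (intro nn_integral_cong_AE) (auto simp: log_ereal_def elim: eventually_mono)
  also have "(\<integral>\<^sup>+x. ennreal (- ln (g x)) \<partial>N) = (\<integral>\<^sup>+x. e2ennreal (- log_ereal (sph_deriv v R x)) \<partial>N)"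
    using main by (intro nn_integral_cong_AE) (auto simp: log_ereal_def elim: eventually_mono)
  finally show ?thesis by (simp add: lyapunov_def)
qed

subsection \<open>Measures on classical points\<close>

definition pdist_open :: "'a option set \<Rightarrow> bool" where
  "pdist_open U \<longleftrightarrow> (\<forall>z\<in>U. \<exists>e>0. \<forall>w. pdist z w < e \<longrightarrow> w \<in> U)"

definition pdist_borel :: "'a option measure" where
  "pdist_borel = sigma UNIV {U. pdist_open U}"

lemma space_pdist_borel [simp]: "space pdist_borel = UNIV"
  by (simp add: pdist_borel_def space_measure_of_conv)

lemma pdist_open_sets: "pdist_open U \<Longrightarrow> U \<in> sets pdist_borel"
  by (simp add: pdist_borel_def)

text \<open>A total function, so that measures can be pushed forward along it. The default
  \<open>None\<close> is taken on a null set for the measures concentrated on classical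
  points.\<close>

definition classical_point :: "'a berk \<Rightarrow> 'a option" where
  "classical_point x = (if x \<in> range (classical v) then inv (classical v) x else None)"

lemma classical_point [simp]: "classical_point (classical v z) = z"
  using classical_inj by (auto simp: classical_point_def inj_def intro!: inv_f_f)

text \<open>The chordal distance to a finite point \<open>a\<close> extends continuously to the
  affine Berkovich line. A union of balls, however large the index set, is therefore the trace of an
  open set on the Borel set of classical points; infinity is added as a singleton.\<close>

lemma classical_open_sets:
  assumes N: "sets N = sets (berk_borel v)" and U: "pdist_open U"
  shows "classical v ` U \<in> sets N"
proof -
  have "\<forall>a. \<exists>e. Some a \<in> U \<longrightarrow> e > 0 \<and> (\<forall>w. pdist (Some a) w < e \<longrightarrow> w \<in> U)"
    using U unfolding pdist_open_def by blast
  then obtain e where e: "\<And>a. Some a \<in> U \<Longrightarrow> e a > 0" "\<And>a w. Some a \<in> U \<Longrightarrow> pdist (Some a) w < e a \<Longrightarrow> w \<in> U"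
    by metis
  define V where "V = (\<Union>a\<in>{a. Some a \<in> U}. {s::'a poly \<Rightarrow> real. s [:- a, 1:] / (max 1 (v a) * max 1 (s X_coord)) < e a})"
  have ne: "max 1 (v a) * max 1 (s X_coord) \<noteq> 0" for a and s :: "'a poly \<Rightarrow> real"
  proof -
    have "max 1 (v a) > 0" "max 1 (s X_coord) > 0" by linarith+
    then show ?thesis by simp
  qed
  have "open V"
    unfolding V_def
    by (intro open_UN ballI open_Collect_less continuous_intros continuous_on_max continuous_seminorm) (use ne in auto)
  have pd: "v (b - a) / (max 1 (v a) * max 1 (v b)) = pdist (Some a) (Some b)" for a b
    using v_minus_commute[of a b] by (simp add: pdist_def)
  have "classical v ` U = (range (classical v) \<inter> Some ` (V \<inter> mult_seminorms v)) \<union> (if None \<in> U then {None} else {})"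
    (is "?l = ?r")
  proof (intro equalityI subsetI)
    fix x assume "x \<in> ?l"
    then obtain z where z: "z \<in> U" "x = classical v z" by blast
    show "x \<in> ?r"
    proof (cases z)
      case None
      then show ?thesis using z by (simp add: classical_simps)
    next
      case (Some a)
      then have "(\<lambda>F. v (poly F a)) \<in> V"
        using z e(1)[of a] by (auto simp: V_def intro!: exI[of _ a])
      then have "x \<in> Some ` (V \<inter> mult_seminorms v)"
        using z Some eval_seminorm[of a] by (auto simp: classical_simps)
      then show ?thesis using z(2) by blast
    qed
  next
    fix x assume x: "x \<in> ?r"
    show "x \<in> ?l"
    proof (cases "x = None")
      case True
      then have "None \<in> U" using x by (auto split: if_splits)
      then show ?thesis using True classical_simps(1) by (metis imageI)
    next
      case False
      then have "x \<in> range (classical v)" "x \<in> Some ` V" using x by (auto split: if_splits)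
      then obtain z where z: "x = classical v z" "x \<in> Some ` V" by blast
      then obtain b where b: "z = Some b" using False by (cases z) (auto simp: classical_simps)
      then have "(\<lambda>F. v (poly F b)) \<in> V" using z by (auto simp: classical_simps)
      then obtain a where "Some a \<in> U" "pdist (Some a) (Some b) < e a"
        by (auto simp: V_def pd)
      then show ?thesis using e(2) z b by blast
    qed
  qed
  moreover have "range (classical v) \<inter> Some ` (V \<inter> mult_seminorms v) \<in> sets N"
    using openin_sets_berk[OF N openin_berk_P1_Some[OF \<open>open V\<close>]] classical_sets[OF N] by auto
  ultimately show ?thesis
    using sets.Un[OF _ None_sets_berk[OF N]] by (cases "None \<in> U") (auto simp del: Un_insert_right)
qed

lemma classical_point_measurable:
  assumes N: "sets N = sets (berk_borel v)"
  shows "classical_point \<in> measurable N pdist_borel"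
  unfolding pdist_borel_def
proof (rule measurable_sigma_sets[where M=N and \<Omega>=UNIV and A="{U. pdist_open U}"])
  show "sets (sigma UNIV {U. pdist_open U}) = sigma_sets UNIV {U. pdist_open U}" by simp
  fix U assume "U \<in> {U. pdist_open U}"
  then have U: "pdist_open U" by simp
  have "classical_point -` U \<inter> space N = classical v ` U \<union> (if None \<in> U then space N - range (classical v) else {})"
  proof (intro equalityI subsetI)
    fix x assume x: "x \<in> classical_point -` U \<inter> space N"
    show "x \<in> classical v ` U \<union> (if None \<in> U then space N - range (classical v) else {})"
    proof (cases "x \<in> range (classical v)")
      case True
      then show ?thesis using x by auto
    next
      case False
      then show ?thesis using x by (auto simp: classical_point_def)
    qed
  next
    fix x assume x: "x \<in> classical v ` U \<union> (if None \<in> U then space N - range (classical v) else {})"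
    show "x \<in> classical_point -` U \<inter> space N"
    proof (cases "x \<in> range (classical v)")
      case True
      then obtain z where "z \<in> U" "x = classical v z" using x by (auto split: if_splits)
      then show ?thesis using classical_in_space[of z] by (simp add: space_berk_borel[OF N])
    next
      case False
      then show ?thesis using x by (auto simp: classical_point_def split: if_splits)
    qed
  qed
  then show "classical_point -` U \<inter> space N \<in> sets N"
    using classical_open_sets[OF N U] classical_sets[OF N] by auto
qed auto

text \<open>The measure is pushed forward to the classical line to apply
  \<open>ultrametric_dynamics\<close>. The two maps are conjugate on the classical points, which
  have full measure, so invariance, ergodicity and the exponent carry over.\<close>

lemma classical_supported_on_attracting_cycle:
  assumes R: "rational_map R" "rat_degree R \<ge> 2"
    and N: "prob_space N" "sets N = sets (berk_borel v)"
    and inv: "berk_map v R \<in> measurable N N" "distr N N (berk_map v R) = N"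
    and erg: "ergodic_measure N (berk_map v R)"
    and full: "measure N (range (classical v)) = 1"
    and neg: "lyapunov v R N < 0"
  shows "supported_on_attracting_cycle v R N"
proof -
  interpret N: prob_space N by fact
  have R1: "rat_degree R \<ge> 1" using R by simp
  let ?T = "berk_map v R" and ?f = "rat_eval R" and ?\<pi> = classical_point and ?C = "range (classical v)"
  note T = inv(1)
  have \<pi>: "?\<pi> \<in> measurable N pdist_borel" by (rule classical_point_measurable[OF N(2)])
  have C: "?C \<in> sets N" by (rule classical_sets[OF N(2)])
  have AEC: "AE x in N. x \<in> ?C" using N.prob_eq_1[OF C] full by simp
  have spaceN: "space N = topspace (berk_P1 v)" by (rule space_berk_borel[OF N(2)])
  define \<mu> where "\<mu> = distr N pdist_borel ?\<pi>"
  have P: "prob_space \<mu>" unfolding \<mu>_def by (rule N.prob_space_distr[OF \<pi>])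
  interpret P: prob_space \<mu> by (rule P)
  have sets\<mu>: "sets \<mu> = sets pdist_borel" and space\<mu>: "space \<mu> = UNIV" by (simp_all add: \<mu>_def)
  obtain r0 C0 where est: "r0 > 0" "C0 \<ge> 0" "\<And>z w. pdist z w < r0 \<Longrightarrow>
    pdist (?f z) (?f w) \<le> max (sphder R w) (C0 * pdist z w) * pdist z w \<and>
    sphder R z \<le> max (sphder R w) (C0 * pdist z w)"
    using sphere_estimate[OF R(1) R1] by blast
  have sph_nonneg: "sphder R z \<ge> 0" for z
    using nonneg by (auto simp: sphder_def disc_deriv_def split: option.split)
  have sph_meas: "sphder R \<in> borel_measurable pdist_borel"
    unfolding borel_measurable_iff_less
  proof
    fix a
    have "pdist_open {w. sphder R w < a}"
      unfolding pdist_open_def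
    proof
      fix z assume "z \<in> {w. sphder R w < a}"
      then have z: "sphder R z < a" by simp
      then have a: "a > 0" using sph_nonneg[of z] by linarith
      define e where "e = min r0 (a / (C0 + 1))"
      have "w \<in> {w. sphder R w < a}" if "pdist z w < e" for w
      proof -
        have "C0 * pdist w z \<le> (C0 + 1) * pdist z w" using pdist_nonneg[of z w] by (simp add: pdist_sym[of w z] mult_right_mono)
        also have "\<dots> < a" using that est(2) by (simp add: e_def field_simps)
        finally have "C0 * pdist w z < a" .
        moreover have "sphder R w \<le> max (sphder R z) (C0 * pdist w z)"
          using est(3)[of w z] that by (simp add: e_def pdist_sym[of w z])
        ultimately show ?thesis using z by simp
      qed
      moreover have "e > 0" using est a by (simp add: e_def)
      ultimately show "\<exists>e>0. \<forall>w. pdist z w < e \<longrightarrow> w \<in> {w. sphder R w < a}" by blast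
    qed
    then show "{w \<in> space pdist_borel. sphder R w < a} \<in> sets pdist_borel"
      using pdist_open_sets by simp
  qed
  have sph_meas\<mu>: "sphder R \<in> borel_measurable \<mu>" using sph_meas by (simp add: \<mu>_def)
  have f_meas: "?f \<in> measurable pdist_borel pdist_borel"
    unfolding pdist_borel_def
  proof (rule measurable_sigma_sets[where \<Omega>=UNIV and A="{U. pdist_open U}"])
    fix U assume "U \<in> {U. pdist_open U}"
    then have U: "pdist_open U" by simp
    have "pdist_open (?f -` U)"
      unfolding pdist_open_def
    proof
      fix z assume "z \<in> ?f -` U"
      then obtain e where e: "e > 0" "\<And>w. pdist (?f z) w < e \<Longrightarrow> w \<in> U" using U by (auto simp: pdist_open_def)
      define B where "B = sphder R z + C0 + 1"
      have B: "B > 0" using sph_nonneg[of z] est(2) by (simp add: B_def)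
      define e' where "e' = min (min r0 1) (e / B)"
      have "w \<in> ?f -` U" if w: "pdist z w < e'" for w
      proof -
        have "pdist (?f w) (?f z) \<le> max (sphder R z) (C0 * pdist w z) * pdist w z"
          using est(3)[of w z] w by (simp add: e'_def pdist_sym[of w z])
        also have "\<dots> \<le> B * pdist w z"
        proof (rule mult_right_mono)
          have "C0 * pdist w z \<le> C0 * 1" using w est(2) by (intro mult_left_mono) (auto simp: e'_def pdist_sym[of w z])
          then show "max (sphder R z) (C0 * pdist w z) \<le> B" using sph_nonneg[of z] est(2) by (simp add: B_def)
        qed (rule pdist_nonneg)
        also have "\<dots> < e" using w B by (simp add: e'_def pdist_sym[of w z] field_simps)
        finally show ?thesis using e(2) by (simp add: pdist_sym[of "?f z"])
      qed
      moreover have "e' > 0" using est(1) e(1) B by (simp add: e'_def)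
      ultimately show "\<exists>e>0. \<forall>w. pdist z w < e \<longrightarrow> w \<in> ?f -` U" by blast
    qed
    then show "?f -` U \<inter> space (sigma UNIV {U. pdist_open U}) \<in> sets (sigma UNIV {U. pdist_open U})"
      using pdist_open_sets by (simp add: pdist_borel_def)
  qed auto
  have f_meas\<mu>: "?f \<in> measurable \<mu> \<mu>"
    using f_meas measurable_cong_sets[OF sets\<mu> sets\<mu>] by simp
  have conj: "?\<pi> (?T x) = ?f (?\<pi> x)" if "x \<in> ?C" for x
    using that by (auto simp: berk_map_classical)
  have T_C: "?T x \<in> ?C" if "x \<in> ?C" for x
    using that by (auto simp: berk_map_classical)
  have "distr \<mu> \<mu> ?f = distr \<mu> pdist_borel ?f" by (rule distr_cong) (auto simp: sets\<mu>)
  also have "\<dots> = distr N pdist_borel (?f \<circ> ?\<pi>)" unfolding \<mu>_def by (rule distr_distr[OF f_meas \<pi>])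
  also have "\<dots> = distr N pdist_borel (?\<pi> \<circ> ?T)"
  proof (rule distr_cong_AE)
    show "AE x in N. (?f \<circ> ?\<pi>) x = (?\<pi> \<circ> ?T) x" using AEC by eventually_elim (simp add: conj)
  qed (use measurable_comp[OF \<pi> f_meas] measurable_comp[OF T \<pi>] in auto)
  also have "\<dots> = distr (distr N N ?T) pdist_borel ?\<pi>" by (rule distr_distr[OF \<pi> T, symmetric])
  also have "\<dots> = \<mu>" by (simp add: inv(2) \<mu>_def)
  finally have inv\<mu>: "distr \<mu> \<mu> ?f = \<mu>" .
  have meas\<mu>: "measure \<mu> A = measure N (?\<pi> -` A \<inter> ?C)" if "A \<in> sets \<mu>" for A
  proof -
    have A: "A \<in> sets pdist_borel" using that sets\<mu> by simp
    have "measure \<mu> A = measure N (?\<pi> -` A \<inter> space N)" unfolding \<mu>_def by (rule measure_distr[OF \<pi> A])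
    also have "\<dots> = measure N (?\<pi> -` A \<inter> ?C)"
    proof (rule N.finite_measure_eq_AE)
      show "AE x in N. (x \<in> ?\<pi> -` A \<inter> space N) = (x \<in> ?\<pi> -` A \<inter> ?C)"
        using AEC AE_space by eventually_elim auto
      show "?\<pi> -` A \<inter> ?C \<in> sets N"
      proof -
        have "?\<pi> -` A \<inter> ?C = (?\<pi> -` A \<inter> space N) \<inter> ?C" using sets.sets_into_space[OF C] by auto
        then show ?thesis using measurable_sets[OF \<pi> A] C by auto
      qed
    qed (rule measurable_sets[OF \<pi> A])
    finally show ?thesis .
  qed
  have erg\<mu>: "measure \<mu> A = 0 \<or> measure \<mu> A = 1" if A: "A \<in> sets \<mu>" "?f -` A = A" for A
  proof -
    have "?\<pi> -` A \<inter> ?C = (?\<pi> -` A \<inter> space N) \<inter> ?C" using sets.sets_into_space[OF C] by auto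
    then have B: "?\<pi> -` A \<inter> ?C \<in> sets N" using measurable_sets[OF \<pi>, of A] A(1) C sets\<mu> by auto
    \<comment> \<open>\<open>ergodic_measure\<close> speaks of sets that equal their preimage
      exactly; \<open>classical_preimage\<close> ensures that no nonclassical point is mapped into
      this one.\<close>
    have "?T -` (?\<pi> -` A \<inter> ?C) \<inter> space N = ?\<pi> -` A \<inter> ?C"
    proof (intro equalityI subsetI)
      fix x assume x: "x \<in> ?T -` (?\<pi> -` A \<inter> ?C) \<inter> space N"
      then have xC: "x \<in> ?C" using classical_preimage[OF R(1) R1, of x] by (simp add: spaceN)
      then have "?f (?\<pi> x) \<in> A" using x conj by auto
      then show "x \<in> ?\<pi> -` A \<inter> ?C" using A(2) xC by auto
    next
      fix x assume x: "x \<in> ?\<pi> -` A \<inter> ?C"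
      then have "?f (?\<pi> x) \<in> A" using A(2) by auto
      then show "x \<in> ?T -` (?\<pi> -` A \<inter> ?C) \<inter> space N"
        using x conj T_C sets.sets_into_space[OF C] by auto
    qed
    then show ?thesis using erg B meas\<mu>[OF A(1)] by (auto simp: ergodic_measure_def)
  qed
  have AEs: "AE x in N. sph_deriv v R x = sphder R (?\<pi> x)"
    using AEC by eventually_elim (auto simp: sph_deriv_classical[OF R(1) R1])
  have h_meas: "(\<lambda>z. e2ennreal (log_ereal (sphder R z))) \<in> borel_measurable \<mu>"
    "(\<lambda>z. e2ennreal (- log_ereal (sphder R z))) \<in> borel_measurable \<mu>"
    unfolding log_ereal_def using sph_meas\<mu> by measurable
  have "lyapunov v R N = enn2ereal (\<integral>\<^sup>+ z. e2ennreal (log_ereal (sphder R z)) \<partial>\<mu>) -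
     enn2ereal (\<integral>\<^sup>+ z. e2ennreal (- log_ereal (sphder R z)) \<partial>\<mu>)"
  proof -
    have "(\<integral>\<^sup>+ x. h (sph_deriv v R x) \<partial>N) = (\<integral>\<^sup>+ z. h (sphder R z) \<partial>\<mu>)"
      if "(\<lambda>z. h (sphder R z)) \<in> borel_measurable \<mu>" for h :: "real \<Rightarrow> ennreal"
    proof -
      have "(\<integral>\<^sup>+ x. h (sph_deriv v R x) \<partial>N) = (\<integral>\<^sup>+ x. h (sphder R (?\<pi> x)) \<partial>N)"
        using AEs by (intro nn_integral_cong_AE) (auto elim: eventually_mono)
      also have "\<dots> = (\<integral>\<^sup>+ z. h (sphder R z) \<partial>\<mu>)"
        unfolding \<mu>_def using that sets\<mu> by (intro nn_integral_distr[symmetric] \<pi>) (simp add: \<mu>_def)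
      finally show ?thesis .
    qed
    from this[OF h_meas(1)] this[OF h_meas(2)] show ?thesis by (simp add: lyapunov_def)
  qed
  with neg obtain \<epsilon> where \<epsilon>: "\<epsilon> > 0" "integrable \<mu> (\<lambda>z. ln (max (sphder R z) \<epsilon>))"
    "(\<integral>z. ln (max (sphder R z) \<epsilon>) \<partial>\<mu>) < 0"
    using P.ex_truncated_log_integral_neg[OF sph_meas\<mu>] by auto
  \<comment> \<open>On balls of this radius the quadratic error stays below the truncation level
    \<epsilon>, so \<open>max (sphder R z) \<epsilon>\<close> is a Lipschitz constant there and does
    not vary on the ball. The \<open>+ 1\<close> covers \<open>C0 = 0\<close>.\<close>
  define r where "r = min r0 (\<epsilon> / (C0 + 1))"
  have r: "r > 0" "r \<le> r0" using est(1,2) \<epsilon>(1) by (auto simp: r_def)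
  have small: "C0 * pdist z w \<le> \<epsilon>" if "pdist z w < r" for z w
  proof -
    have "C0 * pdist z w \<le> (C0 + 1) * pdist z w" using pdist_nonneg[of z w] by (simp add: mult_right_mono)
    also have "\<dots> \<le> \<epsilon>" using that est(2) by (simp add: r_def field_simps)
    finally show ?thesis .
  qed
  interpret U: ultrametric_dynamics \<mu> pdist ?f "\<lambda>z. ln (max (sphder R z) \<epsilon>)" r
  proof (unfold_locales)
    fix x y z :: "'a option" and X :: "nat \<Rightarrow> 'a option" and A U :: "'a option set" and p :: nat
    show "0 \<le> pdist x y" by (rule pdist_nonneg)
    show "(pdist x y = 0) = (x = y)" by (rule pdist_eq_0)
    show "pdist x y = pdist y x" by (rule pdist_sym)
    show "pdist x z \<le> max (pdist x y) (pdist y z)" by (rule pdist_ultra)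
    show "(\<lambda>k. pdist (X k) (X (Suc k))) \<longlonglongrightarrow> 0 \<Longrightarrow> \<exists>l. (\<lambda>k. pdist (X k) l) \<longlonglongrightarrow> 0" by (rule pdist_complete)
    show "space \<mu> = UNIV" by (rule space\<mu>)
    show "U \<in> sets \<mu>" if "\<And>x. x \<in> U \<Longrightarrow> \<exists>e>0. \<forall>y. pdist x y < e \<longrightarrow> y \<in> U"
      using that pdist_open_sets[of U] by (simp add: sets\<mu> pdist_open_def)
    show "?f \<in> measurable \<mu> \<mu>" by (rule f_meas\<mu>)
    show "distr \<mu> \<mu> ?f = \<mu>" by (rule inv\<mu>)
    show "measure \<mu> A = 0 \<or> measure \<mu> A = 1" if "A \<in> sets \<mu>" "?f -` A = A" using erg\<mu>[OF that] .
    show "0 < r" by (rule r(1))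
    show "pdist (?f x) (?f y) \<le> exp (ln (max (sphder R x) \<epsilon>)) * pdist x y" if "pdist x y < r"
    proof -
      have "pdist (?f y) (?f x) \<le> max (sphder R x) (C0 * pdist y x) * pdist y x"
        using est(3)[of y x] that r by (simp add: pdist_sym[of y x])
      also have "\<dots> \<le> max (sphder R x) \<epsilon> * pdist y x"
        using small[OF that] by (intro mult_right_mono pdist_nonneg) (auto simp: pdist_sym[of y x])
      finally show ?thesis using \<epsilon>(1) by (simp add: pdist_sym[of y x] pdist_sym[of "?f y"] less_max_iff_disj)
    qed
    show "ln (max (sphder R y) \<epsilon>) = ln (max (sphder R x) \<epsilon>)" if "pdist x y < r"
    proof -
      have "sphder R x \<le> max (sphder R y) \<epsilon>" "sphder R y \<le> max (sphder R x) \<epsilon>"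
        using est(3)[of x y] est(3)[of y x] small[OF that] that r by (auto simp: pdist_sym[of y x])
      then have "max (sphder R y) \<epsilon> = max (sphder R x) \<epsilon>" by linarith
      then show ?thesis by simp
    qed
    show "integrable \<mu> (\<lambda>z. ln (max (sphder R z) \<epsilon>))" "(\<integral>z. ln (max (sphder R z) \<epsilon>) \<partial>\<mu>) < 0"
      using \<epsilon> by auto
    show "finite {z. (?f ^^ p) z = z}" if "0 < p"
    proof -
      have it: "rational_map (rat_iter R p)" "rat_degree (rat_iter R p) = rat_degree R ^ p" "rat_eval (rat_iter R p) = ?f ^^ p"
        using rat_iter[OF R(1) R1, of p] by auto
      have "rat_degree R ^ 1 \<le> rat_degree R ^ p" using that R1 by (intro power_increasing) auto
      then have "rat_degree (rat_iter R p) \<ge> 2" using R(2) it(2) by simp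
      from finite_rat_fixed_points[OF it(1) this] show ?thesis by (simp add: it(3))
    qed
  qed
  obtain z p c where zp: "p > 0" "(?f ^^ p) z = z" "\<And>k. 0 < k \<Longrightarrow> k < p \<Longrightarrow> (?f ^^ k) z \<noteq> z"
    "c < 1" "\<And>y. pdist z y < r \<Longrightarrow> pdist ((?f ^^ p) z) ((?f ^^ p) y) \<le> c * pdist z y"
    "(\<lambda>k. (?f ^^ k) z) ` {..<p} \<in> sets \<mu>" "measure \<mu> ((\<lambda>k. (?f ^^ k) z) ` {..<p}) = 1"
    using U.ex_attracting_cycle by blast
  define cycle where "cycle = (\<lambda>k. (?f ^^ k) z) ` {..<p}"
  have it: "rational_map (rat_iter R p)" "rat_degree (rat_iter R p) \<ge> 1" "rat_eval (rat_iter R p) = ?f ^^ p"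
    using rat_iter[OF R(1) R1, of p] R1 by auto
  have "v (fixed_point_multiplier (rat_iter R p) z) = sphder (rat_iter R p) z"
    using zp(2) by (intro multiplier_eq_sphder it) (simp add: it(3))
  also have "\<dots> \<le> max 0 c"
    using zp(5) by (intro sphder_le_contraction[OF it(1,2) r(1)]) (simp add: it(3))
  finally have "v (fixed_point_multiplier (rat_iter R p) z) < 1" using zp(4) by linarith
  then have att: "attracting_cycle v R cycle"
    unfolding attracting_cycle_def cycle_def using zp(1,2,3) by blast
  have "measure N (?\<pi> -` cycle \<inter> ?C) = 1" using meas\<mu>[OF zp(6)] zp(7) by (simp add: cycle_def)
  moreover have "?\<pi> -` cycle \<inter> ?C = classical v ` cycle" by auto
  ultimately have one: "measure N (classical v ` cycle) = 1" by simp
  then have "classical v ` cycle \<in> sets N" using measure_notin_sets by fastforce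
  then have "emeasure N (space N - classical v ` cycle) = 0"
    using one N.prob_compl[of "classical v ` cycle"] by (simp add: N.emeasure_eq_measure)
  then show ?thesis using att unfolding supported_on_attracting_cycle_def by blast
qed

end

theorem mainTheorem12:
  fixes v :: "'a::alg_closed_field \<Rightarrow> real"
    and R :: "'a ratfun"
    and \<nu> :: "'a berk measure"
  assumes "complete_nonarch_field v"
    and "rational_map R"
    and "separable R"
    and "rat_degree R \<ge> 2"
    and "prob_space \<nu>"
    and "sets \<nu> = sets (berk_borel v)"
    and "invariant_measure \<nu> (berk_map v R)"
    and "ergodic_measure \<nu> (berk_map v R)"
    and "\<not> supported_on_attracting_cycle v R \<nu>"
  shows "lyapunov v R \<nu> \<ge> log_ereal (Min ((\<lambda>l. v (of_nat l)) ` {1..rat_degree R}))"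
proof -
  interpret complete_nonarch_field v by fact
  define c where "c = Min ((\<lambda>l. v (of_nat l)) ` {1..rat_degree R})"
  have c: "c \<le> v (of_nat l)" if "1 \<le> l" "l \<le> rat_degree R" for l
    unfolding c_def using that by (intro Min_le) auto
  have c1: "c \<le> 1" using c[of 1] assms(4) by simp
  have inv: "berk_map v R \<in> measurable \<nu> \<nu>" "distr \<nu> \<nu> (berk_map v R) = \<nu>"
    using assms(7) by (auto simp: invariant_measure_def)
  have d1: "rat_degree R \<ge> 1" using assms(4) by simp
  let ?C = "range (classical v)"
  have C: "?C \<in> sets \<nu>" by (rule classical_sets[OF assms(6)])
  have "berk_map v R -` ?C \<inter> space \<nu> = ?C"
  proof (intro equalityI subsetI)
    fix x assume "x \<in> berk_map v R -` ?C \<inter> space \<nu>"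
    then show "x \<in> ?C"
      using classical_preimage[OF assms(2) d1, of x] by (simp add: space_berk_borel[OF assms(6)])
  next
    fix x assume "x \<in> ?C"
    then show "x \<in> berk_map v R -` ?C \<inter> space \<nu>"
      using classical_in_space by (auto simp: space_berk_borel[OF assms(6)] berk_map_classical)
  qed
  then consider "measure \<nu> ?C = 0" | "measure \<nu> ?C = 1"
    using assms(8) C by (auto simp: ergodic_measure_def)
  then have "lyapunov v R \<nu> \<ge> log_ereal c"
  proof cases
    case 1
    show ?thesis
    \<comment> \<open>\<open>c = 0\<close> happens when an integer up to the degree vanishes in the
      field; the claimed bound is then -\<infinity>.\<close>
    proof (cases "c \<le> 0")
      case True
      then show ?thesis by (simp add: log_ereal_def)
    next
      case False
      then show ?thesis
        using lyapunov_nonclassical[OF assms(2,3) d1 assms(5,6) inv 1, of c] c by (simp add: log_ereal_def)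
    qed
  next
    case 2
    \<comment> \<open>For measures on classical points the stronger bound 0 holds; it suffices
      because \<open>c\<close> is at most the norm of 1.\<close>
    have "lyapunov v R \<nu> \<ge> 0"
      using classical_supported_on_attracting_cycle[OF assms(2,4,5,6) inv assms(8) 2] assms(9) by (meson not_less)
    moreover have "log_ereal c \<le> 0" using c1 by (simp add: log_ereal_def)
    ultimately show ?thesis by (rule order_trans[rotated])
  qed
  then show ?thesis by (simp add: c_def)
qed

end
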